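(* Let $n\in\{3,4,\ldots\}$ and let $G$ be a subgroup of Houghton's group $H_n$ with $h(G)=n-1$. Then $G$ is abstractly commensurable to a restricted multi-wreath product $\mathcal W\wr\Gamma$, where: (i) $\mathcal W=\{W_1,\ldots,W_k\}$ and $W_1,\ldots,W_k$ are finite groups; (ii) $\Gamma$ is a subgroup of full Hirsch length of the $n$th Houghton group; and (iii) $\Gamma$ acts on the ray system strongly orbit primitively and with only infinite orbits $\Omega_1,\ldots,\Omega_k$.
   Context: $\mathbb N$ includes $0$. The ray system is $\mathcal R_n=\{1,\dots,n\}\times\mathbb N$. Permutations act on the right. Houghton's group $H_n$ is the group of all permutations $g$ of $\mathcal R_n$ for which there is a vector $(t_1(g),\dots,t_n(g))\in\mathbb Z^n$ with $(j,\ell)g=(j,\ell+t_j(g))$ for all $j$ and all sufficiently large $\ell$. Every subgroup $G$ of $H_n$ has a subnormal series whose factors are infinite cyclic or locally finite; its Hirsch length $h(G)$ is the number of infinite cyclic factors. $G\le H_n$ has full Hirsch length if $h(G)=h(H_n)=n-1$. Groups $A$, $B$ are abstractly commensurable if there are a group $C$ and monomorphisms $C\to A$, $C\to B$ whose images have finite index in $A$ and $B$ respectively. Strongly orbit primitive: for a group $\Gamma$ acting on a set $S$, a $\Gamma$-partition is a partition $\mathcal P$ of $S$ with $Pg\in\mathcal P$ for all $P\in\mathcal P$, $g\in\Gamma$. The action is strongly orbit primitive if for every $\Gamma$-partition, every part is either a singleton or contains an entire $\Gamma$-orbit. Restricted multi-wreath product: let $\Omega$ be a right $\Gamma$-set with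 finitely many orbits $\Omega_1,\dots,\Omega_k$ and let $W_1,\dots,W_k$ be groups, one for each orbit. Let $\Phi$ be the group, under pointwise multiplication, of all functions $\phi:\Omega\to W_1\sqcup\cdots\sqcup W_k$ with $\phi(\omega)\in W_i$ for all $\omega\in\Omega_i$ and with finite support (i.e. $\phi(\omega)$ is the identity of the relevant $W_i$ for all but finitely many $\omega$). $\Gamma$ acts on $\Phi$ on the right by $\phi^a(\omega)=\phi(\omega a^{-1})$. The restricted multi-wreath product $\mathcal W\wr\Gamma=\mathcal W\wr_\Omega\Gamma$ is $\Phi\rtimes\Gamma$, with multiplication $(\phi_1,a_1)(\phi_2,a_2)=(\phi_1\phi_2^{a_1^{-1}},a_1a_2)$. In the claim $\Omega$ is the ray system $\mathcal R_n$, on which $\Gamma\le H_n$ acts naturally. *)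

theory Defs
  imports "HOL-Algebra.Algebra" "HOL-Library.Disjoint_Sets"
begin

section \<open>Houghton's groups\<close>

definition ray_system :: "nat \<Rightarrow> (nat \<times> nat) set" where
  "ray_system n = {1..n} \<times> UNIV"

text \<open>
  Permutations act on the right, so the product of \<open>g\<close> and \<open>h\<close> is \<open>g\<close> followed by \<open>h\<close>.
  A permutation of the ray system is represented by its extension by the identity.
\<close>

definition houghton :: "nat \<Rightarrow> (nat \<times> nat \<Rightarrow> nat \<times> nat) monoid" where
  "houghton n = \<lparr>
     carrier = {g. g permutes ray_system n \<and>
       (\<exists>t :: nat \<Rightarrow> int. \<forall>j\<in>{1..n}. \<forall>\<^sub>F l in sequentially.
          fst (g (j, l)) = j \<and> int (snd (g (j, l))) = int l + t j)},
     monoid.mult = (\<lambda>g h. h \<circ> g),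
     one = id \<rparr>"

lemma group_houghton: "group (houghton n)"
proof (rule groupI)
  fix g h assume g: "g \<in> carrier (houghton n)" and h: "h \<in> carrier (houghton n)"
  from g obtain s where s: "g permutes ray_system n"
    "\<And>j. j \<in> {1..n} \<Longrightarrow> \<forall>\<^sub>F l in sequentially. fst (g (j, l)) = j \<and> int (snd (g (j, l))) = int l + s j"
    unfolding houghton_def partial_object.simps by blast
  from h obtain t where t: "h permutes ray_system n"
    "\<And>j. j \<in> {1..n} \<Longrightarrow> \<forall>\<^sub>F l in sequentially. fst (h (j, l)) = j \<and> int (snd (h (j, l))) = int l + t j"
    unfolding houghton_def partial_object.simps by blast
  have "\<forall>\<^sub>F l in sequentially. fst ((h \<circ> g) (j, l)) = j \<and> int (snd ((h \<circ> g) (j, l))) = int l + (s j + t j)"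
    if j: "j \<in> {1..n}" for j
  proof -
    obtain A where A: "\<And>l. l \<ge> A \<Longrightarrow> fst (g (j, l)) = j \<and> int (snd (g (j, l))) = int l + s j"
      using s(2)[OF j] by (auto simp: eventually_sequentially)
    obtain B where B: "\<And>l. l \<ge> B \<Longrightarrow> fst (h (j, l)) = j \<and> int (snd (h (j, l))) = int l + t j"
      using t(2)[OF j] by (auto simp: eventually_sequentially)
    show ?thesis unfolding eventually_sequentially
    proof (intro exI allI impI)
      fix l assume l: "A + B + nat \<bar>s j\<bar> \<le> l"
      have g: "fst (g (j, l)) = j" "int (snd (g (j, l))) = int l + s j" using A[of l] l by auto
      have "B \<le> snd (g (j, l))" using g l by linarith
      from B[OF this] have "fst (h (g (j, l))) = j \<and> int (snd (h (g (j, l)))) = int l + s j + t j"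
        using g by (metis prod.collapse)
      then show "fst ((h \<circ> g) (j, l)) = j \<and> int (snd ((h \<circ> g) (j, l))) = int l + (s j + t j)" by simp
    qed
  qed
  moreover have "h \<circ> g permutes ray_system n" using s(1) t(1) by (rule permutes_compose)
  ultimately show "g \<otimes>\<^bsub>houghton n\<^esub> h \<in> carrier (houghton n)"
    unfolding houghton_def by (auto simp del: o_apply intro!: exI[of _ "\<lambda>j. s j + t j"])
next
  show "\<one>\<^bsub>houghton n\<^esub> \<in> carrier (houghton n)"
    unfolding houghton_def by (auto simp: permutes_id intro!: exI[of _ "\<lambda>_. 0"])
next
  fix g assume g: "g \<in> carrier (houghton n)"
  then obtain s where s: "g permutes ray_system n"
    "\<And>j. j \<in> {1..n} \<Longrightarrow> \<forall>\<^sub>F l in sequentially. fst (g (j, l)) = j \<and> int (snd (g (j, l))) = int l + s j"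
    unfolding houghton_def partial_object.simps by blast
  have "\<forall>\<^sub>F l in sequentially. fst (inv_into UNIV g (j, l)) = j \<and> int (snd (inv_into UNIV g (j, l))) = int l + (- s j)"
    if j: "j \<in> {1..n}" for j
  proof -
    obtain A where A: "\<And>l. l \<ge> A \<Longrightarrow> fst (g (j, l)) = j \<and> int (snd (g (j, l))) = int l + s j"
      using s(2)[OF j] by (auto simp: eventually_sequentially)
    show ?thesis unfolding eventually_sequentially
    proof (intro exI allI impI)
      fix l assume l: "A + nat \<bar>s j\<bar> \<le> l"
      define m where "m = nat (int l - s j)"
      have m: "int m = int l - s j" "A \<le> m" using l unfolding m_def by linarith+
      have "g (j, m) = (j, l)" using A[OF m(2)] m(1) by (simp add: prod_eq_iff)
      then have "inv_into UNIV g (j, l) = (j, m)" using permutes_inv_eq[OF s(1)] by blast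
      then show "fst (inv_into UNIV g (j, l)) = j \<and> int (snd (inv_into UNIV g (j, l))) = int l + (- s j)"
        using m by simp
    qed
  qed
  then have "inv_into UNIV g \<in> carrier (houghton n)"
    unfolding houghton_def using permutes_inv[OF s(1)] by (auto intro!: exI[of _ "\<lambda>j. - s j"])
  moreover have "inv_into UNIV g \<otimes>\<^bsub>houghton n\<^esub> g = \<one>\<^bsub>houghton n\<^esub>"
    unfolding houghton_def using permutes_inv_o(1)[OF s(1)] by simp
  ultimately show "\<exists>h\<in>carrier (houghton n). h \<otimes>\<^bsub>houghton n\<^esub> g = \<one>\<^bsub>houghton n\<^esub>" by blast
qed (auto simp: houghton_def comp_assoc)

section \<open>Hirsch length\<close>

definition infinite_cyclic_group :: "('a, 'b) monoid_scheme \<Rightarrow> bool" where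
  "infinite_cyclic_group F \<longleftrightarrow> F \<cong> integer_group"

definition locally_finite_group :: "('a, 'b) monoid_scheme \<Rightarrow> bool" where
  "locally_finite_group F \<longleftrightarrow>
     group F \<and> (\<forall>A. A \<subseteq> carrier F \<longrightarrow> finite A \<longrightarrow> finite (generate F A))"

definition series_factor ::
    "('a, 'b) monoid_scheme \<Rightarrow> (nat \<Rightarrow> 'a set) \<Rightarrow> nat \<Rightarrow> 'a set monoid" where
  "series_factor G N i = (G\<lparr>carrier := N (Suc i)\<rparr>) Mod (N i)"

definition cyclic_locfin_series ::
    "('a, 'b) monoid_scheme \<Rightarrow> nat \<Rightarrow> (nat \<Rightarrow> 'a set) \<Rightarrow> bool" where
  "cyclic_locfin_series G r N \<longleftrightarrow>
     N 0 = {\<one>\<^bsub>G\<^esub>} \<and> N r = carrier G \<and>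
     (\<forall>i\<le>r. subgroup (N i) G) \<and>
     (\<forall>i<r. N i \<lhd> G\<lparr>carrier := N (Suc i)\<rparr> \<and>
        (infinite_cyclic_group (series_factor G N i) \<or>
         locally_finite_group (series_factor G N i)))"

text \<open>
  For groups possessing a series as above, the number of infinite cyclic factors does not
  depend on the series; on other groups the value is unspecified.
\<close>

definition hirsch_length :: "('a, 'b) monoid_scheme \<Rightarrow> nat" where
  "hirsch_length G = (THE h. \<exists>r N. cyclic_locfin_series G r N \<and>
     h = card {i. i < r \<and> infinite_cyclic_group (series_factor G N i)})"

section \<open>Abstract commensurability\<close>

text \<open>
  The common group \<open>C\<close> may be taken on the element type of \<open>A\<close> without loss of generality,
  since it is isomorphic to its image in \<open>A\<close>.
\<close>

definition abstractly_commensurable ::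
    "('a, 'c) monoid_scheme \<Rightarrow> ('b, 'd) monoid_scheme \<Rightarrow> bool" where
  "abstractly_commensurable A B \<longleftrightarrow>
     group A \<and> group B \<and>
     (\<exists>(C :: 'a monoid) f g. group C \<and> f \<in> mon C A \<and> g \<in> mon C B \<and>
        finite (rcosets\<^bsub>A\<^esub> (f ` carrier C)) \<and> finite (rcosets\<^bsub>B\<^esub> (g ` carrier C)))"

section \<open>Right actions\<close>

text \<open>
  Here \<open>act g x\<close> is the image of the point \<open>x\<close> under \<open>g\<close>. The library's constants \<open>orbit\<close> and
  \<open>orbits\<close> make no assumption on the side of the action.
\<close>

definition right_action ::
    "('g, 'b) monoid_scheme \<Rightarrow> 's set \<Rightarrow> ('g \<Rightarrow> 's \<Rightarrow> 's) \<Rightarrow> bool" where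
  "right_action \<Gamma> S act \<longleftrightarrow>
     (\<forall>g\<in>carrier \<Gamma>. \<forall>x\<in>S. act g x \<in> S) \<and>
     (\<forall>x\<in>S. act \<one>\<^bsub>\<Gamma>\<^esub> x = x) \<and>
     (\<forall>g\<in>carrier \<Gamma>. \<forall>h\<in>carrier \<Gamma>. \<forall>x\<in>S. act (g \<otimes>\<^bsub>\<Gamma>\<^esub> h) x = act h (act g x))"

lemma right_action_houghton:
  assumes "subgroup K (houghton n)"
  shows "right_action (houghton n\<lparr>carrier := K\<rparr>) (ray_system n) (\<lambda>g x. g x)"
  using subgroup.subset[OF assms]
  by (auto simp: right_action_def houghton_def subset_iff permutes_in_image)

definition invariant_partition ::
    "('g, 'b) monoid_scheme \<Rightarrow> 's set \<Rightarrow> ('g \<Rightarrow> 's \<Rightarrow> 's) \<Rightarrow> 's set set \<Rightarrow> bool" where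
  "invariant_partition \<Gamma> S act \<P> \<longleftrightarrow>
     partition_on S \<P> \<and> (\<forall>P\<in>\<P>. \<forall>g\<in>carrier \<Gamma>. act g ` P \<in> \<P>)"

definition strongly_orbit_primitive ::
    "('g, 'b) monoid_scheme \<Rightarrow> 's set \<Rightarrow> ('g \<Rightarrow> 's \<Rightarrow> 's) \<Rightarrow> bool" where
  "strongly_orbit_primitive \<Gamma> S act \<longleftrightarrow>
     (\<forall>\<P>. invariant_partition \<Gamma> S act \<P> \<longrightarrow>
        (\<forall>P\<in>\<P>. is_singleton P \<or> (\<exists>\<Omega>\<in>orbits \<Gamma> S act. \<Omega> \<subseteq> P)))"

section \<open>Restricted multi-wreath products\<close>

text \<open>
  The groups \<open>W\<close> are indexed by the orbits. They share one element type, and a function in the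
  base group takes its value at \<open>x\<close> in the group belonging to the orbit of \<open>x\<close>; this replaces
  the disjoint union. Such functions are undefined outside \<open>S\<close>, as usual for \<open>sum_group\<close>.
\<close>

definition wreath_base ::
    "('g, 'b) monoid_scheme \<Rightarrow> 's set \<Rightarrow> ('g \<Rightarrow> 's \<Rightarrow> 's) \<Rightarrow> ('s set \<Rightarrow> 'w monoid) \<Rightarrow> ('s \<Rightarrow> 'w) monoid"
  where "wreath_base \<Gamma> S act W = sum_group S (\<lambda>x. W (orbit \<Gamma> act x))"

definition wreath_base_act ::
    "('g, 'b) monoid_scheme \<Rightarrow> 's set \<Rightarrow> ('g \<Rightarrow> 's \<Rightarrow> 's) \<Rightarrow> ('s \<Rightarrow> 'w) \<Rightarrow> 'g \<Rightarrow> ('s \<Rightarrow> 'w)"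
  where "wreath_base_act \<Gamma> S act \<phi> a = (\<lambda>x\<in>S. \<phi> (act (inv\<^bsub>\<Gamma>\<^esub> a) x))"

definition multi_wreath ::
    "('g, 'b) monoid_scheme \<Rightarrow> 's set \<Rightarrow> ('g \<Rightarrow> 's \<Rightarrow> 's) \<Rightarrow> ('s set \<Rightarrow> 'w monoid)
      \<Rightarrow> (('s \<Rightarrow> 'w) \<times> 'g) monoid"
  where "multi_wreath \<Gamma> S act W = \<lparr>
     carrier = carrier (wreath_base \<Gamma> S act W) \<times> carrier \<Gamma>,
     monoid.mult = (\<lambda>(\<phi>\<^sub>1, a\<^sub>1) (\<phi>\<^sub>2, a\<^sub>2).
       (\<phi>\<^sub>1 \<otimes>\<^bsub>wreath_base \<Gamma> S act W\<^esub> wreath_base_act \<Gamma> S act \<phi>\<^sub>2 (inv\<^bsub>\<Gamma>\<^esub> a\<^sub>1), a\<^sub>1 \<otimes>\<^bsub>\<Gamma>\<^esub> a\<^sub>2)),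
     one = (\<one>\<^bsub>wreath_base \<Gamma> S act W\<^esub>, \<one>\<^bsub>\<Gamma>\<^esub>) \<rparr>"

lemma group_multi_wreath:
  assumes "group \<Gamma>" and act: "right_action \<Gamma> S act"
    and W: "\<And>\<Omega>. \<Omega> \<in> orbits \<Gamma> S act \<Longrightarrow> group (W \<Omega>)"
  shows "group (multi_wreath \<Gamma> S act W)"
proof -
  interpret \<Gamma>: group \<Gamma> by fact
  have actS: "act a x \<in> S" if "a \<in> carrier \<Gamma>" "x \<in> S" for a x
    using act that unfolding right_action_def by blast
  have act1: "act \<one>\<^bsub>\<Gamma>\<^esub> x = x" if "x \<in> S" for x
    using act that unfolding right_action_def by blast
  have actm: "act (a \<otimes>\<^bsub>\<Gamma>\<^esub> b) x = act b (act a x)"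
    if "a \<in> carrier \<Gamma>" "b \<in> carrier \<Gamma>" "x \<in> S" for a b x
    using act that unfolding right_action_def by blast
  have orb: "orbit \<Gamma> act (act a x) = orbit \<Gamma> act x" if a: "a \<in> carrier \<Gamma>" and x: "x \<in> S" for a x
  proof -
    have "act b (act a x) \<in> orbit \<Gamma> act x" if "b \<in> carrier \<Gamma>" for b
      using actm[OF a that x] \<Gamma>.m_closed[OF a that] unfolding orbit_def by (metis (mono_tags, lifting) mem_Collect_eq)
    moreover have "act b x \<in> orbit \<Gamma> act (act a x)" if b: "b \<in> carrier \<Gamma>" for b
    proof -
      have "act (inv\<^bsub>\<Gamma>\<^esub> a \<otimes>\<^bsub>\<Gamma>\<^esub> b) (act a x) = act b x"
        using actm[of a "inv\<^bsub>\<Gamma>\<^esub> a \<otimes>\<^bsub>\<Gamma>\<^esub> b" x] a b x by (simp flip: \<Gamma>.m_assoc)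
      then show ?thesis unfolding orbit_def using a b by (metis (mono_tags, lifting) \<Gamma>.inv_closed \<Gamma>.m_closed mem_Collect_eq)
    qed
    ultimately show ?thesis unfolding orbit_def by blast
  qed
  have Wg: "group (W (orbit \<Gamma> act x))" if "x \<in> S" for x
    using W that unfolding orbits_def by blast
  let ?B = "wreath_base \<Gamma> S act W"
  let ?A = "wreath_base_act \<Gamma> S act"
  interpret B: group ?B unfolding wreath_base_def using Wg by (rule sum_group)
  have carB: "carrier ?B = {\<phi> \<in> \<Pi>\<^sub>E x\<in>S. carrier (W (orbit \<Gamma> act x)).
      finite {x \<in> S. \<phi> x \<noteq> \<one>\<^bsub>W (orbit \<Gamma> act x)\<^esub>}}"
    unfolding wreath_base_def using Wg by (rule carrier_sum_group)
  have Ain: "?A \<phi> (inv\<^bsub>\<Gamma>\<^esub> a) \<in> carrier ?B" if \<phi>: "\<phi> \<in> carrier ?B" and a: "a \<in> carrier \<Gamma>" for \<phi> a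
  proof -
    have "\<phi> (act a x) \<in> carrier (W (orbit \<Gamma> act x))" if "x \<in> S" for x
    proof -
      have "\<phi> (act a x) \<in> carrier (W (orbit \<Gamma> act (act a x)))"
        using \<phi> actS[OF a that] unfolding carB by blast
      then show ?thesis by (simp only: orb[OF a that])
    qed
    moreover have "finite {x \<in> S. \<phi> (act a x) \<noteq> \<one>\<^bsub>W (orbit \<Gamma> act x)\<^esub>}"
    proof (rule inj_on_finite)
      show "inj_on (act a) {x \<in> S. \<phi> (act a x) \<noteq> \<one>\<^bsub>W (orbit \<Gamma> act x)\<^esub>}"
        by (rule inj_on_inverseI[where g = "act (inv\<^bsub>\<Gamma>\<^esub> a)"]) (use a act1 in \<open>simp flip: actm\<close>)
      show "act a ` {x \<in> S. \<phi> (act a x) \<noteq> \<one>\<^bsub>W (orbit \<Gamma> act x)\<^esub>}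
          \<subseteq> {x \<in> S. \<phi> x \<noteq> \<one>\<^bsub>W (orbit \<Gamma> act x)\<^esub>}"
        using a actS orb by auto
      show "finite {x \<in> S. \<phi> x \<noteq> \<one>\<^bsub>W (orbit \<Gamma> act x)\<^esub>}" using \<phi> unfolding carB by simp
    qed
    moreover have "{x \<in> S. ?A \<phi> (inv\<^bsub>\<Gamma>\<^esub> a) x \<noteq> \<one>\<^bsub>W (orbit \<Gamma> act x)\<^esub>}
        = {x \<in> S. \<phi> (act a x) \<noteq> \<one>\<^bsub>W (orbit \<Gamma> act x)\<^esub>}"
      using a by (auto simp: wreath_base_act_def)
    ultimately show ?thesis unfolding carB using a by (auto simp: wreath_base_act_def)
  qed
  have Amult: "?A (\<phi> \<otimes>\<^bsub>?B\<^esub> \<psi>) (inv\<^bsub>\<Gamma>\<^esub> a) = ?A \<phi> (inv\<^bsub>\<Gamma>\<^esub> a) \<otimes>\<^bsub>?B\<^esub> ?A \<psi> (inv\<^bsub>\<Gamma>\<^esub> a)"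
    if "a \<in> carrier \<Gamma>" for \<phi> \<psi> a
    using that by (auto simp: wreath_base_act_def wreath_base_def actS orb fun_eq_iff)
  have Acomp: "?A \<phi> (inv\<^bsub>\<Gamma>\<^esub> (a \<otimes>\<^bsub>\<Gamma>\<^esub> b)) = ?A (?A \<phi> (inv\<^bsub>\<Gamma>\<^esub> b)) (inv\<^bsub>\<Gamma>\<^esub> a)"
    if "a \<in> carrier \<Gamma>" "b \<in> carrier \<Gamma>" for \<phi> a b
    using that by (auto simp: wreath_base_act_def actS actm fun_eq_iff)
  have Aone: "?A \<one>\<^bsub>?B\<^esub> (inv\<^bsub>\<Gamma>\<^esub> a) = \<one>\<^bsub>?B\<^esub>" if "a \<in> carrier \<Gamma>" for a
    using that by (auto simp: wreath_base_act_def wreath_base_def actS orb fun_eq_iff)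
  have A1: "?A \<phi> (inv\<^bsub>\<Gamma>\<^esub> \<one>\<^bsub>\<Gamma>\<^esub>) = \<phi>" if "\<phi> \<in> carrier ?B" for \<phi>
    using that unfolding carB by (auto simp: wreath_base_act_def act1 fun_eq_iff PiE_def extensional_def)
  show ?thesis
  proof (rule groupI, goal_cases)
    case (1 x y) then show ?case by (auto simp: multi_wreath_def intro!: B.m_closed Ain)
  next
    case 2 then show ?case by (auto simp: multi_wreath_def)
  next
    case (3 x y z)
    then show ?case by (auto simp: multi_wreath_def Amult Acomp Ain B.m_assoc \<Gamma>.m_assoc simp del: \<Gamma>.inv_mult_group)
  next
    case (4 x) then show ?case using A1 by (auto simp: multi_wreath_def)
  next
    case (5 x)
    obtain \<phi> a where x: "x = (\<phi>, a)" "\<phi> \<in> carrier ?B" "a \<in> carrier \<Gamma>"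
      using 5 by (auto simp: multi_wreath_def)
    let ?i = "inv\<^bsub>\<Gamma>\<^esub> a"
    let ?y = "(inv\<^bsub>?B\<^esub> (?A \<phi> (inv\<^bsub>\<Gamma>\<^esub> ?i)), ?i)"
    have "?A \<phi> (inv\<^bsub>\<Gamma>\<^esub> ?i) \<in> carrier ?B" using x by (intro Ain) auto
    then have "?y \<in> carrier (multi_wreath \<Gamma> S act W)"
      and "?y \<otimes>\<^bsub>multi_wreath \<Gamma> S act W\<^esub> x = \<one>\<^bsub>multi_wreath \<Gamma> S act W\<^esub>"
      using x by (auto simp: multi_wreath_def simp del: \<Gamma>.inv_inv)
    then show ?case by blast
  qed
qed

end

theory Submission
  imports Defs
begin

text \<open>
  Let \<open>G\<close> have full Hirsch length. The translation vectors of its elements have coordinate sum \<open>0\<close>,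
  and the Hirsch length is the rank of the lattice they form (\<open>hirsch_length_eq_pivots\<close>): locally
  finite factors of a series do not change the rank, infinite cyclic factors raise it by one. So for
  some \<open>d > 0\<close> all vectors \<open>d (e\<^sub>i - e\<^sub>k)\<close> occur. On passing to a subgroup of finite index, the lattice
  consists of all vectors divisible by \<open>d\<close> with coordinate sum \<open>0\<close>, and the points with finite
  orbits, finite in number, are fixed (\<open>ex_lattice_subgroup\<close>).

  Since there are at least three rays, an element can fix almost all of ray \<open>j\<close> and translate
  another ray \<open>i\<close>. Hence an infinite block of imprimitivity, which is preserved by all elements
  fixing almost all of some ray, spreads over all rays; it is therefore preserved by enough elements
  to contain a whole orbit (\<open>block_contains_orbit\<close>). Far out on the rays, finite blocks have
  bounded diameter. The coarsest invariant partition
  into finite parts consists of the classes of points with commensurable stabilisers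
  (\<open>acl_near\<close>, \<open>acl_sym\<close>, \<open>acl_trans\<close>). Far out, the classes follow one another periodically along
  each ray, so the set of classes is again a ray system (\<open>ex_quotient_map\<close>), on which \<open>G\<close> acts as
  a subgroup \<open>\<Gamma>\<close> of Houghton's group; in this action, all finite blocks are singletons. Thus \<open>\<Gamma>\<close>
  is strongly orbit primitive. By B. H. Neumann's separation lemma a nontrivial finitary element of
  \<open>\<Gamma>\<close> and a conjugate have supports meeting in one point, so that their commutator is a three-cycle;
  by primitivity \<open>\<Gamma>\<close> contains all three-cycles inside an orbit (\<open>three_cycles_in\<close>).

  The kernel \<open>K\<close> of the action on the classes consists of finitary elements. A three-cycle of \<open>\<Gamma>\<close>
  avoiding a finite set \<open>S\<close> of classes lifts to an element of \<open>G\<close> fixing the classes in \<open>S\<close>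
  pointwise (\<open>lift_cyc\<close>). This has two consequences.

  First, up to \<open>K\<close>, the lifts of three-cycles provide a canonical way to transport one class to
  another class in its orbit. The elements acting by transport maps on all classes form a subgroup of
  finite index (\<open>Good_fin_idx\<close>), in which the stabiliser of a class acts on this class like \<open>K\<close>
  (\<open>ex_inner_subgroup\<close>). Replace \<open>G\<close> by this subgroup. Choose elements of \<open>G\<close> moving
  representatives of the orbits of classes to the other classes, compatibly with the translations
  along the rays (\<open>ex_frame\<close>).
  Recording the action of the elements of \<open>G\<close> on the classes embeds \<open>G\<close> into the restricted
  multi-wreath product of the finite groups induced by \<open>K\<close> on the representatives with \<open>\<Gamma>\<close>.

  Second, conjugating an element of \<open>K\<close> by a suitable lift and dividing shows that \<open>K\<close> contains
  elements with prescribed action on one class and with support in this class and the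
  representative of its orbit (\<open>Ker_localize\<close>). So every coset of the image of \<open>G\<close> in the wreath
  product is represented by a function supported on the finitely many representatives, and the index
  is finite (\<open>embed_finite_index\<close>).
\<close>


section \<open>Permutations that are eventually translations\<close>

text \<open>
  The inverse of a function; within group theory the name \<open>inv\<close> stands for inversion in a group.
\<close>

abbreviation finv :: "('a \<Rightarrow> 'a) \<Rightarrow> 'a \<Rightarrow> 'a" where
  "finv \<equiv> inv_into UNIV"

definition evt :: "(nat \<times> nat \<Rightarrow> nat \<times> nat) \<Rightarrow> nat \<Rightarrow> int \<Rightarrow> bool" where
  "evt g j k \<longleftrightarrow> (\<exists>L. \<forall>l\<ge>L. fst (g (j, l)) = j \<and> int (snd (g (j, l))) = int l + k)"

text \<open>
  The value is meaningful only if \<open>g\<close> is eventually a translation of ray \<open>j\<close>.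
\<close>

definition trans_len :: "(nat \<times> nat \<Rightarrow> nat \<times> nat) \<Rightarrow> nat \<Rightarrow> int" where
  "trans_len g j = (THE k. evt g j k)"

lemma evt_unique: "evt g j k \<Longrightarrow> evt g j k' \<Longrightarrow> k = k'"
proof -
  assume "evt g j k" "evt g j k'"
  then obtain L L' where "\<forall>l\<ge>L. int (snd (g (j, l))) = int l + k"
    "\<forall>l\<ge>L'. int (snd (g (j, l))) = int l + k'" unfolding evt_def by blast
  from this(1)[rule_format, of "L + L'"] this(2)[rule_format, of "L + L'"] show ?thesis by simp
qed

lemma trans_len_eqI: "evt g j k \<Longrightarrow> trans_len g j = k"
  unfolding trans_len_def by (rule the_equality) (auto dest: evt_unique)

lemma evt_comp: assumes "evt g j k" "evt h j k'" shows "evt (g \<circ> h) j (k + k')"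
proof -
  obtain L where L: "\<And>l. l \<ge> L \<Longrightarrow> fst (g (j, l)) = j \<and> int (snd (g (j, l))) = int l + k"
    using assms(1) unfolding evt_def by blast
  obtain M where M: "\<And>l. l \<ge> M \<Longrightarrow> fst (h (j, l)) = j \<and> int (snd (h (j, l))) = int l + k'"
    using assms(2) unfolding evt_def by blast
  have "fst ((g \<circ> h) (j, l)) = j \<and> int (snd ((g \<circ> h) (j, l))) = int l + (k + k')"
    if l: "l \<ge> L + M + nat \<bar>k'\<bar>" for l
  proof -
    have h: "fst (h (j, l)) = j" "int (snd (h (j, l))) = int l + k'" using M[of l] l by auto
    then have "snd (h (j, l)) \<ge> L" using l by linarith
    from L[OF this] h show ?thesis by (cases "h (j, l)") simp
  qed
  then show ?thesis unfolding evt_def by blast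
qed

lemma evt_id: "evt id j 0" unfolding evt_def by auto

lemma evt_inv: assumes "bij g" "evt g j k" shows "evt (finv g) j (- k)"
proof -
  obtain L where L: "\<And>l. l \<ge> L \<Longrightarrow> fst (g (j, l)) = j \<and> int (snd (g (j, l))) = int l + k"
    using assms(2) unfolding evt_def by blast
  have "fst (finv g (j, l)) = j \<and> int (snd (finv g (j, l))) = int l + (- k)"
    if l: "l \<ge> L + nat \<bar>k\<bar>" for l
  proof -
    define m where "m = nat (int l - k)"
    have m: "int m = int l - k" "m \<ge> L" using l unfolding m_def by linarith+
    have "g (j, m) = (j, l)" using L[OF m(2)] m(1) by (simp add: prod_eq_iff)
    then have "finv g (j, l) = (j, m)" using assms(1) by (metis bij_inv_eq_iff)
    then show ?thesis using m by simp
  qed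
  then show ?thesis unfolding evt_def by blast
qed

lemma houghton_carrier_iff:
  "g \<in> carrier (houghton n) \<longleftrightarrow> g permutes ray_system n \<and> (\<forall>j\<in>{1..n}. \<exists>k. evt g j k)"
proof -
  have "(\<exists>t :: nat \<Rightarrow> int. \<forall>j\<in>{1..n}. evt g j (t j)) \<longleftrightarrow> (\<forall>j\<in>{1..n}. \<exists>k. evt g j k)"
    by metis
  then show ?thesis
    unfolding houghton_def evt_def eventually_sequentially by simp
qed

lemma houghton_mult [simp]: "g \<otimes>\<^bsub>houghton n\<^esub> h = h \<circ> g"
  and houghton_one [simp]: "\<one>\<^bsub>houghton n\<^esub> = id"
  by (simp_all add: houghton_def)

lemma houghton_evt:
  "g \<in> carrier (houghton n) \<Longrightarrow> j \<in> {1..n} \<Longrightarrow> evt g j (trans_len g j)"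
  using houghton_carrier_iff trans_len_eqI by metis

lemma houghton_permutes: "g \<in> carrier (houghton n) \<Longrightarrow> g permutes ray_system n"
  using houghton_carrier_iff by blast

lemma houghton_bij: "g \<in> carrier (houghton n) \<Longrightarrow> bij g"
  using houghton_permutes permutes_bij by blast

lemma houghton_inv: assumes "g \<in> carrier (houghton n)" shows "inv\<^bsub>houghton n\<^esub> g = finv g"
proof -
  interpret group "houghton n" by (rule group_houghton)
  have c: "finv g \<in> carrier (houghton n)"
    using assms unfolding houghton_carrier_iff
    by (metis permutes_inv evt_inv permutes_bij)
  show ?thesis
    by (rule inv_equality) (use assms c permutes_inv_o[OF houghton_permutes[OF assms]] in auto)
qed

lemma trans_len_comp:
  assumes "g \<in> carrier (houghton n)" "h \<in> carrier (houghton n)" "j \<in> {1..n}"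
  shows "trans_len (g \<circ> h) j = trans_len g j + trans_len h j"
  using assms by (intro trans_len_eqI evt_comp houghton_evt)

lemma trans_len_id [simp]: "trans_len id j = 0"
  by (rule trans_len_eqI) (rule evt_id)

lemma trans_len_inv:
  assumes "g \<in> carrier (houghton n)" "j \<in> {1..n}"
  shows "trans_len (finv g) j = - trans_len g j"
  using assms by (intro trans_len_eqI evt_inv houghton_evt houghton_bij)

lemma finite_core: "finite {x \<in> ray_system n. snd x < L}"
proof -
  have "{x \<in> ray_system n. snd x < L} = {1..n} \<times> {..<L}" by (auto simp: ray_system_def)
  then show ?thesis by simp
qed

lemma houghton_threshold:
  assumes "g \<in> carrier (houghton n)"
  shows "\<exists>L. \<forall>j\<in>{1..n}. \<forall>l\<ge>L. fst (g (j, l)) = j \<and> int (snd (g (j, l))) = int l + trans_len g j"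
proof -
  have "\<forall>j\<in>{1..n}. \<exists>L. \<forall>l\<ge>L. fst (g (j, l)) = j \<and> int (snd (g (j, l))) = int l + trans_len g j"
    using houghton_evt[OF assms] unfolding evt_def by blast
  then obtain L where L: "\<forall>j\<in>{1..n}. \<forall>l\<ge>L j. fst (g (j, l)) = j \<and> int (snd (g (j, l))) = int l + trans_len g j"
    by metis
  have "L j \<le> Max (L ` {1..n})" if "j \<in> {1..n}" for j using that by simp
  then show ?thesis using L by (meson le_trans)
qed

text \<open>
  Compare the points below height \<open>L\<close> with their images: the complement of the former is moved
  to the complement of \<open>{(j, l). l < L + t\<^sub>j}\<close>.
\<close>

lemma sum_trans_len:
  assumes g: "g \<in> carrier (houghton n)"
  shows "(\<Sum>j\<in>{1..n}. trans_len g j) = 0"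
proof -
  obtain L0 where L0: "\<And>j l. j\<in>{1..n} \<Longrightarrow> l\<ge>L0 \<Longrightarrow> fst (g (j, l)) = j \<and> int (snd (g (j, l))) = int l + trans_len g j"
    using houghton_threshold[OF g] by blast
  define t where "t = trans_len g"
  define L where "L = L0 + (\<Sum>j\<in>{1..n}. nat \<bar>t j\<bar>)"
  have tL: "nat \<bar>t j\<bar> \<le> L" if "j \<in> {1..n}" for j
    using that member_le_sum[of j "{1..n}" "\<lambda>j. nat \<bar>t j\<bar>"] unfolding L_def by simp
  have p: "g permutes ray_system n" using g by (rule houghton_permutes)
  have L: "g (j, l) = (j, nat (int l + t j))" if "j \<in> {1..n}" "l \<ge> L" for j l
    using L0[OF that(1), of l] that(2) unfolding L_def t_def by (auto simp: prod_eq_iff)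
  let ?B = "Sigma {1..n} (\<lambda>j. {..<L})"
  let ?C = "Sigma {1..n} (\<lambda>j. {..<nat (int L + t j)})"
  have "g ` (ray_system n - ?B) = ray_system n - ?C"
  proof (intro equalityI subsetI)
    fix x assume "x \<in> g ` (ray_system n - ?B)"
    then obtain y where y: "y \<in> ray_system n - ?B" "x = g y" by blast
    then have "x = g (fst y, snd y)" "fst y \<in> {1..n}" "snd y \<ge> L"
      by (auto simp: ray_system_def not_less[symmetric])
    then obtain j l where "x = g (j, l)" "j \<in> {1..n}" "l \<ge> L" by blast
    then show "x \<in> ray_system n - ?C" using L[of j l] tL[of j] by (auto simp: ray_system_def)
  next
    fix x assume "x \<in> ray_system n - ?C"
    then obtain j l where x: "x = (j, l)" "j \<in> {1..n}" "l \<ge> nat (int L + t j)"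
      by (cases x) (auto simp: ray_system_def)
    then have l: "nat (int l - t j) \<ge> L" using tL[of j] by linarith
    have "g (j, nat (int l - t j)) = x" using L[OF x(2) l] x l tL[of j] by auto
    moreover have "(j, nat (int l - t j)) \<in> ray_system n - ?B" using x l by (auto simp: ray_system_def)
    ultimately show "x \<in> g ` (ray_system n - ?B)" by blast
  qed
  moreover have "g ` (ray_system n - ?B) = ray_system n - g ` ?B"
    by (simp add: image_set_diff[OF permutes_inj[OF p]] permutes_image[OF p])
  moreover have "g ` ?B \<subseteq> ray_system n"
  proof -
    have "?B \<subseteq> ray_system n" by (auto simp: ray_system_def)
    then show ?thesis using permutes_image[OF p] by blast
  qed
  moreover have "?C \<subseteq> ray_system n" by (auto simp: ray_system_def)
  ultimately have eq: "ray_system n - g ` ?B = ray_system n - ?C" "g ` ?B \<subseteq> ray_system n" "?C \<subseteq> ray_system n"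
    by simp_all
  have "g ` ?B = ray_system n - (ray_system n - g ` ?B)" using eq(2) by (rule double_diff[OF _ order_refl, symmetric])
  also have "\<dots> = ?C" unfolding eq(1) using eq(3) by (rule double_diff[OF _ order_refl])
  finally have "g ` ?B = ?C" .
  then have "card ?C = card ?B"
    using card_image[OF inj_on_subset[OF permutes_inj[OF p] subset_UNIV], of ?B] by simp
  then have "(\<Sum>j\<in>{1..n}. nat (int L + t j)) = n * L" by simp
  then have "(\<Sum>j\<in>{1..n}. int (nat (int L + t j))) = int n * int L"
    unfolding of_nat_sum[symmetric] of_nat_mult[symmetric] by (rule arg_cong)
  moreover have "int (nat (int L + t j)) = int L + t j" if "j \<in> {1..n}" for j
    using tL[OF that] by linarith
  ultimately have "(\<Sum>j\<in>{1..n}. int L + t j) = int n * int L" by simp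
  then show ?thesis by (simp add: sum.distrib t_def)
qed

lemma finite_support_if_trans_len_zero:
  assumes "g \<in> carrier (houghton n)" "\<And>j. j \<in> {1..n} \<Longrightarrow> trans_len g j = 0"
  shows "finite {x. g x \<noteq> x}"
proof -
  obtain L where L: "\<And>j l. j\<in>{1..n} \<Longrightarrow> l\<ge>L \<Longrightarrow> fst (g (j, l)) = j \<and> int (snd (g (j, l))) = int l + trans_len g j"
    using houghton_threshold[OF assms(1)] by blast
  have "{x. g x \<noteq> x} \<subseteq> {x \<in> ray_system n. snd x < L}"
  proof
    fix x assume x: "x \<in> {x. g x \<noteq> x}"
    then have "x \<in> ray_system n" using permutes_not_in[OF houghton_permutes[OF assms(1)]] by blast
    then obtain j l where jl: "x = (j, l)" "j \<in> {1..n}" by (auto simp: ray_system_def)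
    have "g (j, l) = (j, l)" if "l \<ge> L" using L[OF jl(2) that] assms(2)[OF jl(2)] by (simp add: prod_eq_iff)
    then show "x \<in> {x \<in> ray_system n. snd x < L}"
      using x jl by (auto simp: ray_system_def not_less[symmetric])
  qed
  then show ?thesis using finite_core finite_subset by blast
qed

lemma subgroup_houghton_iff:
  "subgroup G (houghton n) \<longleftrightarrow> G \<subseteq> carrier (houghton n) \<and> id \<in> G \<and>
     (\<forall>g\<in>G. \<forall>h\<in>G. g \<circ> h \<in> G) \<and> (\<forall>g\<in>G. finv g \<in> G)"
proof
  assume s: "subgroup G (houghton n)"
  have "finv g \<in> G" if "g \<in> G" for g
    using subgroup.m_inv_closed[OF s that] houghton_inv subgroup.subset[OF s] that by fastforce
  then show "G \<subseteq> carrier (houghton n) \<and> id \<in> G \<and> (\<forall>g\<in>G. \<forall>h\<in>G. g \<circ> h \<in> G) \<and> (\<forall>g\<in>G. finv g \<in> G)"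
    using subgroup.subset[OF s] subgroup.one_closed[OF s] subgroup.m_closed[OF s] by auto
next
  assume "G \<subseteq> carrier (houghton n) \<and> id \<in> G \<and> (\<forall>g\<in>G. \<forall>h\<in>G. g \<circ> h \<in> G) \<and> (\<forall>g\<in>G. finv g \<in> G)"
  then show "subgroup G (houghton n)"
    by (intro subgroup.intro) (auto simp: houghton_inv subset_iff)
qed

section \<open>The Hirsch length of a subgroup of Houghton's group\<close>

lemma locally_finite_quotient_power:
  assumes "N \<lhd> A" "locally_finite_group (A Mod N)" "g \<in> carrier A"
  shows "\<exists>m::int. m > 0 \<and> g [^]\<^bsub>A\<^esub> m \<in> N"
proof -
  interpret normal N A by fact
  interpret Q: group "A Mod N" by (rule factorgroup_is_group)
  interpret h: group_hom A "A Mod N" "\<lambda>x. N #>\<^bsub>A\<^esub> x"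
    using r_coset_hom_Mod by unfold_locales
  let ?c = "N #>\<^bsub>A\<^esub> g"
  have c: "?c \<in> carrier (A Mod N)" using assms(3) by (rule h.hom_closed)
  have "finite (generate (A Mod N) {?c})"
    using assms(2) c unfolding locally_finite_group_def by blast
  then have "finite (carrier (subgroup_generated (A Mod N) {?c}))"
    using c by (simp add: carrier_subgroup_generated)
  then obtain m :: nat where m: "m \<noteq> 0" "?c [^]\<^bsub>A Mod N\<^esub> m = \<one>\<^bsub>A Mod N\<^esub>"
    using Q.finite_cyclic_subgroup[OF c] by blast
  have "N #>\<^bsub>A\<^esub> (g [^]\<^bsub>A\<^esub> m) = N" using m(2) assms(3) by (simp add: h.hom_nat_pow)
  then have "g [^]\<^bsub>A\<^esub> int m \<in> N"
    using rcos_self[OF nat_pow_closed[OF assms(3)] is_subgroup, of m] by (simp add: int_pow_int)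
  then show ?thesis using m(1) by (intro exI[of _ "int m"]) auto
qed

lemma infinite_cyclic_quotient_hom:
  assumes "N \<lhd> A" "infinite_cyclic_group (A Mod N)"
  shows "\<exists>f \<in> hom A integer_group. f ` carrier A = UNIV \<and> (\<forall>x\<in>carrier A. f x = 0 \<longleftrightarrow> x \<in> N)"
proof -
  interpret normal N A by fact
  interpret Q: group "A Mod N" by (rule factorgroup_is_group)
  obtain \<phi> where \<phi>: "\<phi> \<in> iso (A Mod N) integer_group"
    using assms(2) unfolding infinite_cyclic_group_def is_iso_def by blast
  let ?f = "\<phi> \<circ> (\<lambda>x. N #>\<^bsub>A\<^esub> x)"
  have "?f \<in> hom A integer_group"
    using Group.hom_compose[OF r_coset_hom_Mod] \<phi> by (auto simp: iso_def)
  moreover have "?f ` carrier A = UNIV"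
    using \<phi> by (simp add: iso_def bij_betw_def carrier_FactGroup image_comp)
  moreover have "?f x = 0 \<longleftrightarrow> x \<in> N" if x: "x \<in> carrier A" for x
  proof -
    have inj: "inj_on \<phi> (carrier (A Mod N))" and h: "\<phi> \<in> hom (A Mod N) integer_group"
      using \<phi> by (auto simp: iso_def bij_betw_def)
    have one: "\<phi> \<one>\<^bsub>A Mod N\<^esub> = 0"
      using hom_one[OF h Q.is_group group_integer_group] by simp
    have "N #>\<^bsub>A\<^esub> x \<in> carrier (A Mod N)" using x by (simp add: carrier_FactGroup)
    then have "?f x = 0 \<longleftrightarrow> N #>\<^bsub>A\<^esub> x = \<one>\<^bsub>A Mod N\<^esub>"
      using inj one Q.one_closed unfolding inj_on_def by (metis comp_apply)
    also have "\<dots> \<longleftrightarrow> x \<in> N"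
      using x rcos_self[OF x is_subgroup] rcos_const[of x] by auto
    finally show ?thesis .
  qed
  ultimately show ?thesis by blast
qed

text \<open>
  The pivots of an echelon form of the lattice of translation vectors of \<open>G\<close>. Their number is the
  rank of this lattice.
\<close>

definition pivots :: "nat \<Rightarrow> (nat \<times> nat \<Rightarrow> nat \<times> nat) set \<Rightarrow> nat set" where
  "pivots n G = {i\<in>{1..n}. \<exists>g\<in>G. trans_len g i \<noteq> 0 \<and> (\<forall>j\<in>{i<..n}. trans_len g j = 0)}"

lemma pivots_mono: "G \<subseteq> H \<Longrightarrow> pivots n G \<subseteq> pivots n H"
  unfolding pivots_def by blast

lemma finite_pivots [simp]: "finite (pivots n G)"
  unfolding pivots_def by simp

lemma trans_len_hom:
  assumes "subgroup G (houghton n)" "j \<in> {1..n}"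
  shows "group_hom (houghton n\<lparr>carrier := G\<rparr>) integer_group (\<lambda>g. trans_len g j)"
proof -
  interpret group "houghton n" by (rule group_houghton)
  have "(\<lambda>g. trans_len g j) \<in> hom (houghton n\<lparr>carrier := G\<rparr>) integer_group"
    using assms(2) trans_len_comp[of _ n _ j] subgroup.subset[OF assms(1)]
    by (auto simp: hom_def subset_iff)
  then show ?thesis
    using subgroup_imp_group[OF assms(1)] by (simp add: group_hom_def group_hom_axioms_def)
qed

lemma trans_len_int_pow:
  assumes "subgroup G (houghton n)" "j \<in> {1..n}" "g \<in> G"
  shows "trans_len (g [^]\<^bsub>houghton n\<lparr>carrier := G\<rparr>\<^esub> (k::int)) j = k * trans_len g j"
  using group_hom.hom_int_pow[OF trans_len_hom[OF assms(1,2)], of g k] assms(3) by simp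

text \<open>
  A vector and its nonzero multiples have the same last nonzero position.
\<close>

lemma pivots_torsion_step:
  assumes G: "subgroup G (houghton n)" and "N \<subseteq> G"
    and tors: "\<And>g. g \<in> G \<Longrightarrow> \<exists>m::int. m > 0 \<and> g [^]\<^bsub>houghton n\<lparr>carrier := G\<rparr>\<^esub> m \<in> N"
  shows "pivots n G = pivots n N"
proof
  show "pivots n N \<subseteq> pivots n G" by (rule pivots_mono) fact
  show "pivots n G \<subseteq> pivots n N"
  proof
    fix i assume "i \<in> pivots n G"
    then obtain g where i: "i \<in> {1..n}" and g: "g \<in> G" "trans_len g i \<noteq> 0" "\<forall>j\<in>{i<..n}. trans_len g j = 0"
      unfolding pivots_def by blast
    obtain m :: int where m: "m > 0" "g [^]\<^bsub>houghton n\<lparr>carrier := G\<rparr>\<^esub> m \<in> N"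
      using tors[OF g(1)] by blast
    have "trans_len (g [^]\<^bsub>houghton n\<lparr>carrier := G\<rparr>\<^esub> m) j = m * trans_len g j" if "j \<in> {i..n}" for j
      using trans_len_int_pow[OF G _ g(1)] that i by auto
    then show "i \<in> pivots n N" unfolding pivots_def using i g m by (auto intro!: bexI[OF _ m(2)])
  qed
qed

lemma finitary_power_id:
  assumes "g \<in> carrier (houghton n)" "finite {x. g x \<noteq> x}"
  shows "\<exists>m>0. (g ^^ m) = id"
proof -
  have p: "g permutes {x. g x \<noteq> x}"
    using houghton_bij[OF assms(1)] by (auto simp: permutes_def bij_iff) 
  have "(g ^^ k) permutes {x. g x \<noteq> x}" for k
    using p by (induction k) (auto simp: permutes_id permutes_compose)
  then have "range (\<lambda>k. g ^^ k) \<subseteq> {f. f permutes {x. g x \<noteq> x}}" by auto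
  then have "finite (range (\<lambda>k. g ^^ k))" using finite_permutations[OF assms(2)] finite_subset by blast
  then have "\<not> inj (\<lambda>k. g ^^ k)" using finite_imageD infinite_UNIV_nat by blast
  then obtain a' b' where "a' \<noteq> b'" "g ^^ a' = g ^^ b'" unfolding inj_def by blast
  then obtain a b where ab: "a < b" "g ^^ a = g ^^ b" by (metis linorder_neqE_nat)
  have "g ^^ b = g ^^ a \<circ> g ^^ (b - a)" using ab(1) by (simp flip: funpow_add)
  then have "g ^^ a \<circ> g ^^ (b - a) = g ^^ a \<circ> id" using ab(2) by simp
  moreover have "inj (g ^^ a)" using houghton_bij[OF assms(1)] by (simp add: bij_is_inj inj_fn)
  ultimately have "g ^^ (b - a) = id" by (metis fun.inj_map_strong inj_compose injD fun_eq_iff comp_apply)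
  then show ?thesis using ab(1) by (intro exI[of _ "b - a"]) auto
qed

lemma houghton_nat_pow: "g [^]\<^bsub>houghton n\<lparr>carrier := G\<rparr>\<^esub> (k::nat) = g ^^ k"
  by (induction k) (simp_all add: nat_pow_def flip: funpow_Suc_right)

text \<open>
  Among the elements outside the kernel of \<open>f\<close> let \<open>b\<close> have the smallest pivot \<open>p\<close>. An element
  of \<open>N\<close> with pivot \<open>p\<close> could be used to lower the pivot of a power of \<open>b\<close>, so \<open>p\<close> is new; and every
  other pivot of \<open>G\<close> is a pivot of \<open>N\<close>, because a power of \<open>b\<close> corrects the value of \<open>f\<close> to \<open>0\<close>
  without changing a pivot above \<open>p\<close>. Such pivots exist because a permutation without translation
  is finitary, hence of finite order, whereas the integers are torsion-free.
\<close>

lemma pivots_cyclic_step: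
  assumes G: "subgroup G (houghton n)" and "N \<subseteq> G"
    and f: "f \<in> hom (houghton n\<lparr>carrier := G\<rparr>) integer_group" "f ` G = UNIV"
    and ker: "\<And>x. x \<in> G \<Longrightarrow> f x = 0 \<longleftrightarrow> x \<in> N"
  shows "card (pivots n G) = Suc (card (pivots n N))"
proof -
  interpret H: group "houghton n" by (rule group_houghton)
  let ?A = "houghton n\<lparr>carrier := G\<rparr>"
  interpret A: group ?A by (rule H.subgroup_imp_group) fact
  interpret f: group_hom ?A integer_group f
    by (intro group_hom.intro group_hom_axioms.intro A.is_group group_integer_group f(1))
  have GH: "G \<subseteq> carrier (houghton n)" using G by (rule subgroup.subset)
  have "\<exists>i\<in>{1..n}. trans_len x i \<noteq> 0" if x: "x \<in> G" "f x \<noteq> 0" for x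
  proof (rule ccontr)
    assume "\<not> ?thesis"
    then have "finite {y. x y \<noteq> y}" using finite_support_if_trans_len_zero x(1) GH by blast
    then obtain m where m: "m > 0" "x ^^ m = id" using finitary_power_id x(1) GH by blast
    have "f (x [^]\<^bsub>?A\<^esub> m) = int m * f x" using x(1) f.hom_nat_pow[of x m] by simp
    moreover have "f (x [^]\<^bsub>?A\<^esub> m) = 0" unfolding houghton_nat_pow m(2) using f.hom_one by simp
    ultimately show False using x m by simp
  qed
  moreover define lead where "lead x i \<longleftrightarrow> i \<in> {1..n} \<and> trans_len x i \<noteq> 0 \<and> (\<forall>j\<in>{i<..n}. trans_len x j = 0)" for x i
  ultimately have lead: "\<exists>i. lead x i" if "x \<in> G" "f x \<noteq> 0" for x
  proof -
    let ?S = "{i\<in>{1..n}. trans_len x i \<noteq> 0}"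
    assume *: "\<And>x. x \<in> G \<Longrightarrow> f x \<noteq> 0 \<Longrightarrow> \<exists>i\<in>{1..n}. trans_len x i \<noteq> 0"
    have S: "finite ?S" "?S \<noteq> {}" using *[OF that] by auto
    have "trans_len x j = 0" if "j \<in> {Max ?S<..n}" for j
    proof (rule ccontr)
      assume "trans_len x j \<noteq> 0"
      moreover have "Max ?S < j" "j \<le> n" using that by (simp_all only: greaterThanAtMost_iff)
      moreover from this have "j \<ge> 1" by linarith
      ultimately have "j \<in> ?S" by auto
      then have "j \<le> Max ?S" by (rule Max_ge[OF S(1)])
      then show False using \<open>Max ?S < j\<close> by simp
    qed
    moreover have "Max ?S \<in> {1..n}" "trans_len x (Max ?S) \<noteq> 0" using Max_in[OF S] by blast+
    ultimately have "lead x (Max ?S)" unfolding lead_def by blast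
    then show ?thesis ..
  qed
  have piv: "pivots n S = {i. \<exists>x\<in>S. lead x i}" for S unfolding pivots_def lead_def by blast
  obtain g0 where g0: "g0 \<in> G" "f g0 = 1" using f(2) by (metis UNIV_I imageE)
  define p where "p = (LEAST i. \<exists>x\<in>G. f x \<noteq> 0 \<and> lead x i)"
  have "\<exists>i. \<exists>x\<in>G. f x \<noteq> 0 \<and> lead x i" using lead[of g0] g0 by force
  then have "\<exists>x\<in>G. f x \<noteq> 0 \<and> lead x p" unfolding p_def by (rule LeastI_ex)
  then obtain b where b: "b \<in> G" "f b \<noteq> 0" "lead b p" by blast
  have least: "p \<le> i" if "x \<in> G" "f x \<noteq> 0" "lead x i" for x i
    unfolding p_def by (rule Least_le) (use that in blast)
  define cmb where "cmb x k y l = (x [^]\<^bsub>?A\<^esub> k) \<otimes>\<^bsub>?A\<^esub> (y [^]\<^bsub>?A\<^esub> l)" for x y and k l :: int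
  have cmb: "cmb x k y l \<in> G" "f (cmb x k y l) = k * f x + l * f y" if "x \<in> G" "y \<in> G" for x y k l
    using that A.m_closed[OF A.int_pow_closed A.int_pow_closed, of x y k l]
      f.hom_mult[OF A.int_pow_closed A.int_pow_closed, of x y k l] f.hom_int_pow[of x k] f.hom_int_pow[of y l]
    by (simp_all add: cmb_def del: houghton_mult)
  have cmbt: "trans_len (cmb x k y l) j = k * trans_len x j + l * trans_len y j"
    if "x \<in> G" "y \<in> G" "j \<in> {1..n}" for x y k l j
  proof -
    interpret t: group_hom ?A integer_group "\<lambda>g. trans_len g j" by (rule trans_len_hom[OF G that(3)])
    show ?thesis
      using that t.hom_mult[OF A.int_pow_closed A.int_pow_closed, of x y k l] t.hom_int_pow[of x k] t.hom_int_pow[of y l]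
      by (simp add: cmb_def del: houghton_mult)
  qed
  have "p \<notin> pivots n N"
  proof
    assume "p \<in> pivots n N"
    then obtain a where a: "a \<in> N" "lead a p" unfolding piv by blast
    then have aG: "a \<in> G" "f a = 0" using ker \<open>N \<subseteq> G\<close> by auto
    let ?c = "cmb b (trans_len a p) a (- trans_len b p)"
    have c: "?c \<in> G" "f ?c \<noteq> 0" using cmb[OF b(1) aG(1)] aG(2) b a(2) by (auto simp: lead_def)
    obtain i where i: "lead ?c i" using lead[OF c] by blast
    have "trans_len ?c j = 0" if "j \<in> {p..n}" for j
      using that cmbt[OF b(1) aG(1), of j] a(2) b(3) by (cases "j = p") (auto simp: lead_def)
    then have "i < p" using i unfolding lead_def by (metis atLeastAtMost_iff not_le)
    then show False using least[OF c i] by simp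
  qed
  moreover have "pivots n G = insert p (pivots n N)"
  proof (intro equalityI subsetI)
    fix i assume "i \<in> insert p (pivots n N)"
    then show "i \<in> pivots n G" using pivots_mono[OF \<open>N \<subseteq> G\<close>, of n] b unfolding piv by blast
  next
    fix i assume "i \<in> pivots n G"
    then obtain x where x: "x \<in> G" "lead x i" unfolding piv by blast
    show "i \<in> insert p (pivots n N)"
    proof (cases "f x = 0 \<or> i = p")
      case True then show ?thesis using x ker unfolding piv by blast
    next
      case False
      then have "p < i" using least[OF x(1) _ x(2)] by auto
      let ?c = "cmb x (f b) b (- f x)"
      have c: "?c \<in> G" "f ?c = 0" using cmb[OF x(1) b(1)] by auto
      have "trans_len ?c j = f b * trans_len x j" if "j \<in> {i..n}" for j
        using that cmbt[OF x(1) b(1), of j] b(3) \<open>p < i\<close> by (auto simp: lead_def)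
      then have "lead ?c i" using x(2) b(2) by (auto simp: lead_def)
      then show ?thesis using c ker unfolding piv by blast
    qed
  qed
  ultimately show ?thesis by simp
qed

text \<open>
  Passing up the series, a locally finite factor keeps the set of pivots and an infinite cyclic
  factor adds one pivot. In particular the count is the same for all series.
\<close>

lemma series_count:
  assumes G: "subgroup G (houghton n)" and ser: "cyclic_locfin_series (houghton n\<lparr>carrier := G\<rparr>) r N"
  shows "card {i. i < r \<and> infinite_cyclic_group (series_factor (houghton n\<lparr>carrier := G\<rparr>) N i)} = card (pivots n G)"
proof -
  interpret H: group "houghton n" by (rule group_houghton)
  let ?A = "houghton n\<lparr>carrier := G\<rparr>"
  interpret A: group ?A by (rule H.subgroup_imp_group) fact
  note ser' = ser[unfolded cyclic_locfin_series_def]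
  have "card {i. i < k \<and> infinite_cyclic_group (series_factor ?A N i)} = card (pivots n (N k))"
    if "k \<le> r" for k
    using that
  proof (induction k)
    case 0
    have "pivots n (N 0) = {}" using ser' by (auto simp: pivots_def)
    then show ?case by simp
  next
    case (Suc k)
    let ?B = "houghton n\<lparr>carrier := N (Suc k)\<rparr>"
    have sub: "subgroup (N (Suc k)) (houghton n)"
    proof -
      have "subgroup (N (Suc k)) ?A" using ser' Suc.prems by blast
      then show ?thesis using H.incl_subgroup[OF G] by blast
    qed
    have nor: "N k \<lhd> ?B" and
      fac: "infinite_cyclic_group (?B Mod N k) \<or> locally_finite_group (?B Mod N k)"
      using ser' Suc.prems unfolding series_factor_def by auto
    have sf: "series_factor ?A N k = ?B Mod N k" unfolding series_factor_def by simp
    have le: "N k \<subseteq> N (Suc k)" using normal_imp_subgroup[OF nor] subgroup.subset by force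
    show ?case
    proof (cases "infinite_cyclic_group (?B Mod N k)")
      case True
      obtain f where f: "f \<in> hom ?B integer_group" "f ` N (Suc k) = UNIV"
          "\<And>x. x \<in> N (Suc k) \<Longrightarrow> f x = 0 \<longleftrightarrow> x \<in> N k"
        using infinite_cyclic_quotient_hom[OF nor True] by auto
      have "card (pivots n (N (Suc k))) = Suc (card (pivots n (N k)))"
        by (rule pivots_cyclic_step[OF sub le f])
      moreover have "{i. i < Suc k \<and> infinite_cyclic_group (series_factor ?A N i)}
          = insert k {i. i < k \<and> infinite_cyclic_group (series_factor ?A N i)}"
        using True sf by (auto simp: less_Suc_eq)
      ultimately show ?thesis using Suc by simp
    next
      case False
      then have lf: "locally_finite_group (?B Mod N k)" using fac by blast
      have "pivots n (N (Suc k)) = pivots n (N k)"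
        by (rule pivots_torsion_step[OF sub le])
           (use locally_finite_quotient_power[OF nor lf] in auto)
      moreover have "{i. i < Suc k \<and> infinite_cyclic_group (series_factor ?A N i)}
          = {i. i < k \<and> infinite_cyclic_group (series_factor ?A N i)}"
        using False sf by (auto simp: less_Suc_eq)
      ultimately show ?thesis using Suc by simp
    qed
  qed
  from this[of r] show ?thesis using ser' by simp
qed


lemma finite_locally_finite: "group F \<Longrightarrow> finite (carrier F) \<Longrightarrow> locally_finite_group F"
  unfolding locally_finite_group_def
  by (metis group.generate_incl finite_subset)

lemma locally_finite_quotient:
  assumes "N \<lhd> A" "locally_finite_group A"
  shows "locally_finite_group (A Mod N)"
proof -
  interpret normal N A by fact
  interpret Q: group "A Mod N" by (rule factorgroup_is_group)
  interpret h: group_hom A "A Mod N" "\<lambda>x. N #>\<^bsub>A\<^esub> x"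
    using r_coset_hom_Mod by unfold_locales
  have "finite (generate (A Mod N) S)" if S: "S \<subseteq> carrier (A Mod N)" "finite S" for S
  proof -
    obtain T where T: "T \<subseteq> carrier A" "finite T" "S = (\<lambda>x. N #>\<^bsub>A\<^esub> x) ` T"
      using finite_subset_image[OF S(2)] S(1) unfolding carrier_FactGroup by blast
    have "finite (generate A T)" using assms(2) T(1,2) unfolding locally_finite_group_def by simp
    then show ?thesis using h.generate_img[OF T(1)] T(3) by simp
  qed
  then show ?thesis unfolding locally_finite_group_def using Q.is_group by simp
qed

text \<open>
  Finitely many finitary permutations move points of one finite set only.
\<close>

lemma finitary_locally_finite:
  assumes G: "subgroup G (houghton n)" and fin: "\<And>g. g \<in> G \<Longrightarrow> finite {x. g x \<noteq> x}"
  shows "locally_finite_group (houghton n\<lparr>carrier := G\<rparr>)"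
proof -
  interpret H: group "houghton n" by (rule group_houghton)
  let ?A = "houghton n\<lparr>carrier := G\<rparr>"
  interpret A: group ?A by (rule H.subgroup_imp_group) fact
  have "finite (generate ?A T)" if T: "T \<subseteq> G" "finite T" for T
  proof -
    define S where "S = (\<Union>g\<in>T. {x. g x \<noteq> x})"
    have S: "finite S" unfolding S_def using T fin by blast
    have bij: "bij g" if "g \<in> G" for g
      using houghton_bij subsetD[OF subgroup.subset[OF G] that] .
    have gT: "g permutes S" if "g \<in> T" for g
    proof -
      have "bij g" using that T by (intro bij) (rule subsetD)
      then have "g permutes {x. g x \<noteq> x}" by (auto simp: permutes_def bij_iff)
      then show ?thesis by (rule permutes_subset) (use that S_def in blast)
    qed
    have "g permutes S" if "g \<in> generate ?A T" for g
      using that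
    proof (induction rule: generate.induct)
      case one then show ?case by (simp add: permutes_def)
    next
      case (incl h) then show ?case by (rule gT)
    next
      case (inv h)
      then have hG: "h \<in> G" using T by blast
      have "inv\<^bsub>?A\<^esub> h = finv h"
        unfolding H.m_inv_consistent[OF G hG] by (rule houghton_inv[OF subsetD[OF subgroup.subset[OF G] hG]])
      then show ?case using permutes_inv[OF gT[OF inv]] by simp
    next
      case (eng h1 h2) then show ?case using permutes_compose[of h1 S h2] by (simp add: o_def)
    qed
    then have "generate ?A T \<subseteq> {g. g permutes S}" by blast
    then show ?thesis using finite_permutations[OF S] finite_subset by blast
  qed
  then show ?thesis unfolding locally_finite_group_def using A.group_axioms by auto
qed

text \<open>
  The quotient is isomorphic to the set of values of the homomorphism \<open>\<lambda>g. trans_len g i\<close>, which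
  is a subgroup of the integers.
\<close>

lemma trans_len_quotient:
  assumes G: "subgroup G (houghton n)" and i: "i \<in> {1..n}"
  defines "N \<equiv> {g\<in>G. trans_len g i = 0}"
  shows "N \<lhd> houghton n\<lparr>carrier := G\<rparr>"
    and "infinite_cyclic_group (houghton n\<lparr>carrier := G\<rparr> Mod N) \<or>
      locally_finite_group (houghton n\<lparr>carrier := G\<rparr> Mod N)"
proof -
  let ?A = "houghton n\<lparr>carrier := G\<rparr>"
  interpret t: group_hom ?A integer_group "\<lambda>g. trans_len g i" by (rule trans_len_hom[OF G i])
  have "kernel ?A integer_group (\<lambda>g. trans_len g i) = N" by (simp add: kernel_def N_def)
  then show nor: "N \<lhd> ?A" using t.normal_kernel by simp
  interpret normal N ?A by fact
  show "infinite_cyclic_group (?A Mod N) \<or> locally_finite_group (?A Mod N)"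
  proof (cases "N = G")
    case True
    have "carrier (?A Mod N) \<subseteq> {N}"
      unfolding carrier_FactGroup using t.G.coset_join2[OF _ is_subgroup] True by auto
    then have "finite (carrier (?A Mod N))" using finite_subset by blast
    then show ?thesis using finite_locally_finite[OF factorgroup_is_group] by blast
  next
    case False
    define k where "k = (LEAST k. k > 0 \<and> (\<exists>g\<in>G. trans_len g i = int k))"
    obtain g where g: "g \<in> G" "trans_len g i \<noteq> 0" using False N_def by blast
    have "\<exists>k>0. \<exists>g\<in>G. trans_len g i = int k"
    proof (cases "trans_len g i > 0")
      case True then show ?thesis using g by (intro exI[of _ "nat (trans_len g i)"]) auto
    next
      case False
      have "trans_len (inv\<^bsub>?A\<^esub> g) i = - trans_len g i" using t.hom_inv g by simp
      then show ?thesis using g False t.G.inv_closed[of g]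
        by (intro exI[of _ "nat (- trans_len g i)"] conjI bexI[of _ "inv\<^bsub>?A\<^esub> g"]) simp_all
    qed
    then have "k > 0 \<and> (\<exists>g\<in>G. trans_len g i = int k)" unfolding k_def by (rule LeastI_ex)
    then obtain u where k: "k > 0" and u: "u \<in> G" "trans_len u i = int k" by blast
    have kmin: "k \<le> m" if "m > 0" "x \<in> G" "trans_len x i = int m" for m x
      unfolding k_def by (rule Least_le) (use that in blast)
    have dv: "int k dvd trans_len g i" if g: "g \<in> G" for g
    proof (rule ccontr)
      assume nd: "\<not> ?thesis"
      let ?q = "trans_len g i div int k" and ?r = "trans_len g i mod int k"
      let ?h = "g \<otimes>\<^bsub>?A\<^esub> (u [^]\<^bsub>?A\<^esub> (- ?q))"
      have h: "?h \<in> G" using t.G.m_closed[of g "u [^]\<^bsub>?A\<^esub> (- ?q)"] t.G.int_pow_closed[of u] u g by simp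
      have "trans_len ?h i = trans_len g i + (- ?q) * int k"
        using t.hom_mult[of g "u [^]\<^bsub>?A\<^esub> (- ?q)"] t.hom_int_pow[of u "- ?q"] t.G.int_pow_closed[of u] u g by simp
      then have "trans_len ?h i = ?r" by (simp add: minus_div_mult_eq_mod)
      moreover have "?r \<ge> 0" "?r < int k" "?r \<noteq> 0" using nd k by (simp_all add: dvd_eq_mod_eq_0)
      moreover from this have "?r > 0" by linarith
      ultimately have "k \<le> nat ?r" using h by (intro kmin[of _ ?h]) auto
      then show False using \<open>?r > 0\<close> \<open>?r < int k\<close> by linarith
    qed
    let ?f = "\<lambda>g. trans_len g i div int k"
    have "?f \<in> hom ?A integer_group"
    proof (rule homI)
      fix x y assume "x \<in> carrier ?A" "y \<in> carrier ?A"
      then show "?f (x \<otimes>\<^bsub>?A\<^esub> y) = ?f x \<otimes>\<^bsub>integer_group\<^esub> ?f y"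
        using t.hom_mult[of x y] dv[of x] by (simp add: div_plus_div_distrib_dvd_left del: houghton_mult)
    qed simp
    then interpret f: group_hom ?A integer_group ?f by unfold_locales
    have "?f ` carrier ?A = carrier integer_group"
    proof -
      have "\<exists>g\<in>G. z = ?f g" for z
        using t.hom_int_pow[of u z] t.G.int_pow_closed[of u z] u k
        by (intro bexI[of _ "u [^]\<^bsub>?A\<^esub> z"]) auto
      then show ?thesis by auto
    qed
    moreover have "kernel ?A integer_group ?f = N"
      using dv k by (auto simp: kernel_def N_def dvd_div_eq_0_iff)
    ultimately show ?thesis using f.FactGroup_iso unfolding infinite_cyclic_group_def by simp
  qed
qed

text \<open>
  The finitary elements come first. Then the coordinates of the translation vector are released
  one after the other.
\<close>

lemma series_exists:
  assumes G: "subgroup G (houghton n)"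
  shows "\<exists>r N. cyclic_locfin_series (houghton n\<lparr>carrier := G\<rparr>) r N"
proof -
  interpret H: group "houghton n" by (rule group_houghton)
  let ?A = "houghton n\<lparr>carrier := G\<rparr>"
  interpret A: group ?A by (rule H.subgroup_imp_group) fact
  define N where "N i = (if i = 0 then {id} else {g\<in>G. \<forall>j\<in>{i..n}. trans_len g j = 0})" for i :: nat
  have GH: "G \<subseteq> carrier (houghton n)" using G by (rule subgroup.subset)
  have subH: "subgroup (N i) (houghton n)" for i
  proof (cases "i = 0")
    case True then show ?thesis using H.triv_subgroup by (simp add: N_def)
  next
    case False
    then show ?thesis
      using G trans_len_comp[where n = n] trans_len_inv[where n = n]
      unfolding subgroup_houghton_iff N_def by (simp add: subset_iff)
  qed
  have NG: "N i \<subseteq> G" for i using G by (auto simp: N_def subgroup_houghton_iff)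
  have "subgroup (N i) ?A" for i
    using H.subgroup_incl[OF subH G NG] .
  moreover have "N i \<lhd> ?A\<lparr>carrier := N (Suc i)\<rparr> \<and>
        (infinite_cyclic_group (series_factor ?A N i) \<or> locally_finite_group (series_factor ?A N i))"
    if "i < Suc n" for i
  proof (cases "i = 0")
    case True
    have nor: "{id} \<lhd> houghton n\<lparr>carrier := N 1\<rparr>"
      using group.one_is_normal[OF H.subgroup_imp_group[OF subH[of 1]]] by simp
    have "finite {x. g x \<noteq> x}" if "g \<in> N 1" for g
      using that GH by (intro finite_support_if_trans_len_zero[of g n]) (auto simp: N_def)
    then have "locally_finite_group (houghton n\<lparr>carrier := N 1\<rparr>)"
      by (rule finitary_locally_finite[OF subH])
    then show ?thesis using True nor locally_finite_quotient[OF nor]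
      by (simp add: series_factor_def N_def)
  next
    case False
    then have i: "i \<in> {1..n}" using that by simp
    have "N i = {g\<in>N (Suc i). trans_len g i = 0}"
    proof -
      have "{i..n} = insert i {Suc i..n}" using i by auto
      then show ?thesis using False by (auto simp: N_def)
    qed
    then show ?thesis using trans_len_quotient[OF subH[of "Suc i"] i]
      by (simp add: series_factor_def)
  qed
  moreover have "N 0 = {\<one>\<^bsub>?A\<^esub>}" "N (Suc n) = carrier ?A" by (auto simp: N_def)
  ultimately have "cyclic_locfin_series ?A (Suc n) N" unfolding cyclic_locfin_series_def by blast
  then show ?thesis by blast
qed

lemma hirsch_length_eq_pivots:
  assumes G: "subgroup G (houghton n)"
  shows "hirsch_length (houghton n\<lparr>carrier := G\<rparr>) = card (pivots n G)"
  unfolding hirsch_length_def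
proof (rule the_equality)
  obtain r N where "cyclic_locfin_series (houghton n\<lparr>carrier := G\<rparr>) r N"
    using series_exists[OF G] by blast
  then show "\<exists>r N. cyclic_locfin_series (houghton n\<lparr>carrier := G\<rparr>) r N \<and>
      card (pivots n G) = card {i. i < r \<and> infinite_cyclic_group (series_factor (houghton n\<lparr>carrier := G\<rparr>) N i)}"
    using series_count[OF G] by (intro exI conjI) (assumption, rule sym)
qed (use series_count[OF G] in blast)

section \<open>Subgroups of finite index\<close>

text \<open>
  The index is witnessed by a finite transversal \<open>T\<close>. The sets of all \<open>t \<circ> h\<close> with \<open>h \<in> H\<close>
  are right cosets for the product of Houghton's group, where permutations act on the right.
\<close>

definition fin_idx :: "('a \<Rightarrow> 'a) set \<Rightarrow> ('a \<Rightarrow> 'a) set \<Rightarrow> bool" where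
  "fin_idx H G \<longleftrightarrow> H \<subseteq> G \<and> (\<exists>T. finite T \<and> T \<subseteq> G \<and> (\<forall>g\<in>G. \<exists>t\<in>T. \<exists>h\<in>H. g = t \<circ> h))"

lemma subgroup_houghtonD:
  assumes "subgroup G (houghton n)"
  shows "g \<in> G \<Longrightarrow> g \<in> carrier (houghton n)" "id \<in> G"
    "g \<in> G \<Longrightarrow> h \<in> G \<Longrightarrow> g \<circ> h \<in> G" "g \<in> G \<Longrightarrow> finv g \<in> G"
    "g \<in> G \<Longrightarrow> bij g" "g \<in> G \<Longrightarrow> (g ^^ k) \<in> G"
proof -
  note s = assms[unfolded subgroup_houghton_iff]
  show "g \<in> G \<Longrightarrow> g \<in> carrier (houghton n)" "id \<in> G" "g \<in> G \<Longrightarrow> h \<in> G \<Longrightarrow> g \<circ> h \<in> G" "g \<in> G \<Longrightarrow> finv g \<in> G"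
    using s by auto
  then show "g \<in> G \<Longrightarrow> bij g" using houghton_bij by blast
  show "g \<in> G \<Longrightarrow> (g ^^ k) \<in> G" using s by (induction k) (auto simp: id_def)
qed

lemma bij_finv:
  assumes "bij g" shows "finv g (g x) = x" "g (finv g x) = x" "finv g \<circ> g = id" "g \<circ> finv g = id"
  using assms by (auto simp: bij_def surj_f_inv_f fun_eq_iff)

text \<open>
  Choose one element of each of the finitely many colours; the colour of an element determines its coset.
\<close>

lemma fin_idxI:
  assumes G: "subgroup G (houghton n)" and "H \<subseteq> G" and fin: "finite (c ` G)"
    and c: "\<And>g h. g \<in> G \<Longrightarrow> h \<in> G \<Longrightarrow> c g = c h \<Longrightarrow> finv h \<circ> g \<in> H"
  shows "fin_idx H G"
proof -
  define r where "r v = (SOME h. h \<in> G \<and> c h = v)" for v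
  have r: "r (c g) \<in> G \<and> c (r (c g)) = c g" if "g \<in> G" for g
    unfolding r_def by (rule someI[of _ g]) (use that in simp)
  have "\<exists>t\<in>r ` c ` G. \<exists>h\<in>H. g = t \<circ> h" if g: "g \<in> G" for g
  proof -
    have "finv (r (c g)) \<circ> g \<in> H" using r[OF g] c[OF g] by auto
    moreover have "g = r (c g) \<circ> (finv (r (c g)) \<circ> g)"
      using bij_finv(4)[OF subgroup_houghtonD(5)[OF G]] r[OF g] by (simp flip: comp_assoc)
    ultimately show ?thesis using g by blast
  qed
  moreover have "r ` c ` G \<subseteq> G" using r by blast
  ultimately show ?thesis using \<open>H \<subseteq> G\<close> fin unfolding fin_idx_def by (metis finite_imageI)
qed

lemma fin_idx_trans:
  assumes "subgroup G (houghton n)" "fin_idx H G" "fin_idx K H"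
  shows "fin_idx K G"
proof -
  obtain S T where S: "finite S" "S \<subseteq> G" "\<And>g. g \<in> G \<Longrightarrow> \<exists>s\<in>S. \<exists>h\<in>H. g = s \<circ> h"
    and T: "finite T" "T \<subseteq> H" "\<And>h. h \<in> H \<Longrightarrow> \<exists>t\<in>T. \<exists>k\<in>K. h = t \<circ> k"
    using assms unfolding fin_idx_def by meson
  let ?U = "(\<lambda>(s, t). s \<circ> t) ` (S \<times> T)"
  have "\<exists>u\<in>?U. \<exists>k\<in>K. g = u \<circ> k" if g: "g \<in> G" for g
  proof -
    obtain s h where sh: "s \<in> S" "h \<in> H" "g = s \<circ> h" using S(3)[OF g] by blast
    moreover obtain t k where tk: "t \<in> T" "k \<in> K" "h = t \<circ> k" using T(3)[OF sh(2)] by blast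
    ultimately have "s \<circ> t \<in> ?U" "g = (s \<circ> t) \<circ> k" by (auto simp: comp_assoc)
    then show ?thesis using tk(2) by blast
  qed
  moreover have "H \<subseteq> G" "K \<subseteq> H" using assms unfolding fin_idx_def by auto
  moreover have "?U \<subseteq> G" using S(2) T(2) \<open>H \<subseteq> G\<close> subgroup_houghtonD(3)[OF assms(1)]
    by (auto simp: subset_iff)
  ultimately show ?thesis using S(1) T(1) unfolding fin_idx_def
    by (intro conjI exI[of _ ?U]) auto
qed

definition orb :: "('a \<Rightarrow> 'a) set \<Rightarrow> 'a \<Rightarrow> 'a set" where
  "orb G x = (\<lambda>g. g x) ` G"

definition fixing :: "('a \<Rightarrow> 'a) set \<Rightarrow> 'a set \<Rightarrow> ('a \<Rightarrow> 'a) set" where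
  "fixing G S = {g \<in> G. \<forall>x\<in>S. g x = x}"

text \<open>
  The stabiliser in \<open>G\<close> is covered by finitely many translates of the stabiliser in \<open>H\<close>; for each
  coset that meets the stabiliser in \<open>G\<close>, a translating element \<open>r t\<close> is chosen in the intersection.
\<close>

lemma fin_idx_stabilizer_orbit:
  assumes G: "subgroup G (houghton n)" and H: "subgroup H (houghton n)" and fi: "fin_idx H G"
    and fin: "finite (orb (fixing H S) y)"
  shows "finite (orb (fixing G S) y)"
proof -
  obtain T where T: "finite T" "T \<subseteq> G" "\<And>g. g \<in> G \<Longrightarrow> \<exists>t\<in>T. \<exists>h\<in>H. g = t \<circ> h" and HG: "H \<subseteq> G"
    using fi unfolding fin_idx_def by meson
  let ?fix = "\<lambda>g. \<forall>x\<in>S. g x = x"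
  let ?O = "orb (fixing H S) y"
  define r where "r t = (SOME g. g \<in> G \<and> ?fix g \<and> (\<exists>h\<in>H. g = t \<circ> h))" for t
  have "orb (fixing G S) y \<subseteq> (\<Union>t\<in>T. r t ` ?O)"
  proof
    fix z assume "z \<in> orb (fixing G S) y"
    then obtain g where g: "g \<in> G" "?fix g" "z = g y" unfolding orb_def fixing_def by blast
    obtain t h where t: "t \<in> T" "h \<in> H" "g = t \<circ> h" using T(3) g(1) by blast
    then have "g \<in> G \<and> ?fix g \<and> (\<exists>h\<in>H. g = t \<circ> h)" using g(1,2) by blast
    then have "r t \<in> G \<and> ?fix (r t) \<and> (\<exists>h\<in>H. r t = t \<circ> h)"
      unfolding r_def by (rule someI[where P = "\<lambda>g. g \<in> G \<and> ?fix g \<and> (\<exists>h\<in>H. g = t \<circ> h)"])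
    then obtain h' where r: "r t \<in> G" "?fix (r t)" "h' \<in> H" "r t = t \<circ> h'" by blast
    let ?k = "finv h' \<circ> h"
    have k: "?k \<in> H" using subgroup_houghtonD[OF H] r t by blast
    have g_eq: "g x = r t (?k x)" for x
      using bij_finv(2)[OF subgroup_houghtonD(5)[OF H r(3)]] t(3) r(4) by simp
    have "?fix ?k"
    proof
      fix x assume "x \<in> S"
      then have "r t (?k x) = r t x" using g_eq g(2) r(2) by metis
      then show "?k x = x" using subgroup_houghtonD(5)[OF G r(1)] by (metis bij_pointE)
    qed
    then have "?k y \<in> ?O" using k unfolding orb_def fixing_def by blast
    then have "z \<in> r t ` ?O" using g_eq[of y] g(3) by blast
    then show "z \<in> (\<Union>t\<in>T. r t ` ?O)" using t(1) by blast
  qed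
  then show ?thesis using T(1) fin finite_subset by (metis (no_types, lifting) finite_UN finite_imageI)
qed

lemma fin_idx_infinite_orbit:
  assumes "subgroup G (houghton n)" "subgroup H (houghton n)" "fin_idx H G" "infinite (orb G y)"
  shows "infinite (orb H y)"
  using fin_idx_stabilizer_orbit[OF assms(1-3), of "{}" y] assms(4) by (auto simp: fixing_def)

text \<open>
  Two of the powers of \<open>g\<close> lie in the same coset.
\<close>

lemma fin_idx_power:
  assumes G: "subgroup G (houghton n)" and H: "subgroup H (houghton n)" and fi: "fin_idx H G" and g: "g \<in> G"
  shows "\<exists>m>0. (g ^^ m) \<in> H"
proof -
  obtain T where T: "finite T" "T \<subseteq> G" "\<And>g. g \<in> G \<Longrightarrow> \<exists>t\<in>T. \<exists>h\<in>H. g = t \<circ> h" and HG: "H \<subseteq> G"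
    using fi unfolding fin_idx_def by meson
  have "\<forall>m. \<exists>t\<in>T. \<exists>h\<in>H. g ^^ m = t \<circ> h" using T(3) subgroup_houghtonD(6)[OF G g] by blast
  then obtain t h where th: "\<And>m. t m \<in> T" "\<And>m. h m \<in> H" "\<And>m. g ^^ m = t m \<circ> h m"
    by metis
  have "finite (range t)" using T(1) th(1) by (metis finite_subset image_subsetI)
  then have "\<not> inj t" using finite_imageD infinite_UNIV_nat by blast
  then obtain a' b' where "a' \<noteq> b'" "t a' = t b'" unfolding inj_def by blast
  then obtain a b where ab: "a < b" "t a = t b" by (metis linorder_neqE_nat)
  have bt: "bij (g ^^ a)" "bij (h a)" using subgroup_houghtonD(5)[OF G subgroup_houghtonD(6)[OF G g]]
     subgroup_houghtonD(5)[OF H th(2)] by auto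
  have "(g ^^ (b - a)) x = (finv (h a) \<circ> h b) x" for x
  proof -
    have "(g ^^ a) ((g ^^ (b - a)) x) = (g ^^ b) x" using ab(1) by (metis comp_apply funpow_add le_add_diff_inverse less_imp_le)
    also have "\<dots> = t a (h b x)" using th(3)[of b] ab(2) by simp
    also have "\<dots> = t a (h a ((finv (h a) \<circ> h b) x))" using bij_finv(2)[OF bt(2)] by simp
    also have "\<dots> = (g ^^ a) ((finv (h a) \<circ> h b) x)" using th(3)[of a] by simp
    finally show ?thesis using bt(1) by (metis bij_pointE)
  qed
  then have "g ^^ (b - a) = finv (h a) \<circ> h b" by blast
  moreover have "finv (h a) \<circ> h b \<in> H" using subgroup_houghtonD(3,4)[OF H] th(2) by blast
  ultimately show ?thesis using ab(1) by (intro exI[of _ "b - a"]) simp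
qed

lemma fin_idx_finite_rcosets:
  assumes G: "subgroup G (houghton n)" and H: "subgroup H (houghton n)" and fi: "fin_idx H G"
  shows "finite (rcosets\<^bsub>houghton n\<lparr>carrier := G\<rparr>\<^esub> H)"
proof -
  obtain T where T: "finite T" "T \<subseteq> G" "\<And>g. g \<in> G \<Longrightarrow> \<exists>t\<in>T. \<exists>h\<in>H. g = t \<circ> h"
    using fi unfolding fin_idx_def by meson
  have "rcosets\<^bsub>houghton n\<lparr>carrier := G\<rparr>\<^esub> H \<subseteq> (\<lambda>t. {t \<circ> h | h. h \<in> H}) ` T"
  proof
    fix C assume "C \<in> rcosets\<^bsub>houghton n\<lparr>carrier := G\<rparr>\<^esub> H"
    then obtain g where g: "g \<in> G" "C = {g \<circ> h | h. h \<in> H}"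
      unfolding RCOSETS_def r_coset_def by auto
    obtain t k where tk: "t \<in> T" "k \<in> H" "g = t \<circ> k" using T(3) g(1) by blast
    have "{g \<circ> h | h. h \<in> H} = {t \<circ> h | h. h \<in> H}"
    proof (intro equalityI subsetI)
      fix x assume "x \<in> {g \<circ> h | h. h \<in> H}"
      then obtain h where "h \<in> H" "x = t \<circ> (k \<circ> h)" using tk(3) by (auto simp: comp_assoc)
      then show "x \<in> {t \<circ> h | h. h \<in> H}" using subgroup_houghtonD(3)[OF H tk(2)] by blast
    next
      fix x assume "x \<in> {t \<circ> h | h. h \<in> H}"
      then obtain h where h: "h \<in> H" "x = t \<circ> h" by blast
      have "x = g \<circ> (finv k \<circ> h)" unfolding h(2) tk(3) using bij_finv(2)[OF subgroup_houghtonD(5)[OF H tk(2)]]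
        by (simp add: fun_eq_iff)
      then show "x \<in> {g \<circ> h | h. h \<in> H}" using subgroup_houghtonD(3,4)[OF H] tk(2) h(1) by blast
    qed
    then show "C \<in> (\<lambda>t. {t \<circ> h | h. h \<in> H}) ` T" using g(2) tk(1) by blast
  qed
  then show ?thesis using T(1) finite_subset by blast
qed

section \<open>Subgroups of full Hirsch length\<close>

text \<open>The translation vector is \<open>d (e\<^sub>i - e\<^sub>k)\<close>, which is \<open>0\<close> for \<open>i = k\<close>.\<close>

definition moves :: "nat \<Rightarrow> nat \<Rightarrow> nat \<Rightarrow> nat \<Rightarrow> (nat \<times> nat \<Rightarrow> nat \<times> nat) \<Rightarrow> bool" where
  "moves n d i k g \<longleftrightarrow> (\<forall>j\<in>{1..n}. trans_len g j = int d * ((if j = i then 1 else 0) - (if j = k then 1 else 0)))"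

definition has_moves :: "nat \<Rightarrow> nat \<Rightarrow> (nat \<times> nat \<Rightarrow> nat \<times> nat) set \<Rightarrow> bool" where
  "has_moves n d G \<longleftrightarrow> d > 0 \<and> (\<forall>i\<in>{1..n}. \<forall>k\<in>{1..n}. \<exists>g\<in>G. moves n d i k g)"

lemma trans_len_funpow:
  assumes "g \<in> carrier (houghton n)" "j \<in> {1..n}"
  shows "trans_len (g ^^ m) j = int m * trans_len g j"
proof -
  have "(g ^^ m) \<in> carrier (houghton n)" for m
    using subgroup_houghtonD(6)[OF group.subgroup_self[OF group_houghton] assms(1)] .
  then show ?thesis
    using assms trans_len_comp by (induction m) (auto simp: algebra_simps id_def[symmetric] simp del: funpow.simps(2) simp add: funpow.simps(2))
qed

lemma has_moves_common:
  assumes G: "subgroup G (houghton n)" and "d > 0"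
    and ex: "\<And>i k. i \<in> {1..n} \<Longrightarrow> k \<in> {1..n} \<Longrightarrow> \<exists>m>0. \<exists>g\<in>G. moves n (m * d) i k g"
  shows "\<exists>c>0. has_moves n (c * d) G"
proof -
  obtain m where m: "\<And>i k. i \<in> {1..n} \<Longrightarrow> k \<in> {1..n} \<Longrightarrow> m i k > 0 \<and> (\<exists>g\<in>G. moves n (m i k * d) i k g)"
    using ex by metis
  define c where "c = (\<Prod>i\<in>{1..n}. \<Prod>k\<in>{1..n}. m i k)"
  have c: "c > 0" unfolding c_def using m by (intro prod_pos ballI) auto
  have dv: "m i k dvd c" if "i \<in> {1..n}" "k \<in> {1..n}" for i k
    unfolding c_def using that by (meson dvd_prodI dvd_trans finite_atLeastAtMost)
  have "\<exists>g\<in>G. moves n (c * d) i k g" if ik: "i \<in> {1..n}" "k \<in> {1..n}" for i k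
  proof -
    obtain q where q: "c = m i k * q" using dv[OF ik] by blast
    obtain g where g: "g \<in> G" "moves n (m i k * d) i k g" using m[OF ik] by blast
    have "moves n (c * d) i k (g ^^ q)"
      unfolding moves_def
    proof
      fix j assume j: "j \<in> {1..n}"
      have "trans_len (g ^^ q) j = int q * trans_len g j"
        using trans_len_funpow[OF subgroup_houghtonD(1)[OF G g(1)] j] .
      then show "trans_len (g ^^ q) j = int (c * d) * ((if j = i then 1 else 0) - (if j = k then 1 else 0))"
        using g(2) j q by (simp add: moves_def)
    qed
    then show ?thesis using subgroup_houghtonD(6)[OF G g(1)] by blast
  qed
  then show ?thesis using c \<open>d > 0\<close> unfolding has_moves_def by (intro exI[of _ c]) auto
qed

text \<open>Eliminate the coordinates of a vector from the last one downwards.\<close>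

lemma multiple_in_trans_lens:
  assumes G: "subgroup G (houghton n)" and piv: "{2..n} \<subseteq> pivots n G"
    and v: "(\<Sum>j\<in>{1..n}. v j) = 0" "\<And>j. j \<in> {p<..n} \<Longrightarrow> v j = 0"
  shows "\<exists>m>0. \<exists>g\<in>G. \<forall>j\<in>{1..n}. trans_len g j = m * (v j :: int)"
  using v
proof (induction p arbitrary: v)
  case 0
  then have "\<forall>j\<in>{1..n}. trans_len id j = 1 * v j" unfolding trans_len_id by auto
  then show ?case using subgroup_houghtonD(2)[OF G] zero_less_one by blast
next
  case (Suc p)
  show ?case
  proof (cases "Suc p \<in> {2..n}")
    case True
    then obtain a where a: "a \<in> G" "trans_len a (Suc p) \<noteq> 0" "\<forall>j\<in>{Suc p<..n}. trans_len a j = 0"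
      using piv unfolding pivots_def by blast
    interpret H: group "houghton n" by (rule group_houghton)
    let ?A = "houghton n\<lparr>carrier := G\<rparr>"
    interpret A: group ?A by (rule H.subgroup_imp_group) fact
    let ?t = "trans_len a (Suc p)"
    have aH: "a \<in> carrier (houghton n)" using a(1) by (rule subgroup_houghtonD(1)[OF G])
    \<comment> \<open>The additional factor \<open>?t\<close> makes the multiplier \<open>m * (?t * ?t)\<close> of \<open>v\<close> positive.\<close>
    define w where "w j = ?t * (?t * v j - v (Suc p) * trans_len a j)" for j
    have "(\<Sum>j\<in>{1..n}. w j) = ?t * (?t * (\<Sum>j\<in>{1..n}. v j) - v (Suc p) * (\<Sum>j\<in>{1..n}. trans_len a j))"
      by (simp add: w_def sum_distrib_left sum_subtractf right_diff_distrib)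
    then have w0: "(\<Sum>j\<in>{1..n}. w j) = 0" using Suc.prems(1) sum_trans_len[OF aH] by simp
    have "w j = 0" if "j \<in> {p<..n}" for j
      using that a(3) Suc.prems(2) by (cases "j = Suc p") (auto simp: w_def)
    then obtain m g where m: "m > 0" and g: "g \<in> G" "\<forall>j\<in>{1..n}. trans_len g j = m * w j"
      using Suc.IH[OF w0] by blast
    let ?u = "a [^]\<^bsub>?A\<^esub> (m * ?t * v (Suc p))"
    have u: "?u \<in> G" using A.int_pow_closed[of a] a(1) by simp
    have "trans_len (g \<circ> ?u) j = (m * (?t * ?t)) * v j" if j: "j \<in> {1..n}" for j
    proof -
      have "trans_len (g \<circ> ?u) j = m * w j + (m * ?t * v (Suc p)) * trans_len a j"
        using trans_len_comp[OF subgroup_houghtonD(1)[OF G g(1)] subgroup_houghtonD(1)[OF G u] j]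
          trans_len_int_pow[OF G j a(1)] g(2) j by simp
      then show ?thesis by (simp add: w_def algebra_simps)
    qed
    moreover have "m * (?t * ?t) > 0" using m a(2) by (simp add: zero_less_mult_iff) linarith
    moreover have "g \<circ> ?u \<in> G" using subgroup_houghtonD(3)[OF G g(1) u] .
    ultimately show ?thesis by blast
  next
    case False
    have "v j = 0" if j: "j \<in> {p<..n}" for j
    proof -
      have "p = 0" using False j by auto
      have "j = 1 \<Longrightarrow> (\<Sum>j\<in>{1..n}. v j) = v 1"
        using j Suc.prems(2) \<open>p = 0\<close> by (subst sum.remove[of _ 1]) auto
      then show ?thesis using Suc.prems j \<open>p = 0\<close> by (cases "j = 1") auto
    qed
    then show ?thesis using Suc.IH[OF Suc.prems(1)] by blast
  qed
qed

text \<open>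
  Translation lengths add up to \<open>0\<close>, so the first coordinate cannot be the only nonzero one.
\<close>

lemma pivots_one:
  assumes G: "subgroup G (houghton n)"
  shows "pivots n G \<subseteq> {2..n}"
proof
  fix i assume "i \<in> pivots n G"
  then obtain g where i: "i \<in> {1..n}" and g: "g \<in> G" "trans_len g i \<noteq> 0" "\<forall>j\<in>{i<..n}. trans_len g j = 0"
    unfolding pivots_def by blast
  have "i \<noteq> 1"
  proof
    assume "i = 1"
    then have "(\<Sum>j\<in>{1..n}. trans_len g j) = trans_len g 1"
      using g(3) i by (subst sum.remove[of _ 1]) auto
    then show False using sum_trans_len[OF subgroup_houghtonD(1)[OF G g(1)]] g(2) \<open>i = 1\<close> by simp
  qed
  then show "i \<in> {2..n}" using i by auto
qed

text \<open>
  Vectors with coordinate sum \<open>0\<close> have a pivot in \<open>{2..n}\<close>. If all these pivots occur, then the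
  translation vectors span the space of these vectors over the rationals, and a common denominator
  gives \<open>d\<close>.
\<close>

lemma full_hirsch_length_iff:
  assumes G: "subgroup G (houghton n)"
  shows "hirsch_length (houghton n\<lparr>carrier := G\<rparr>) = n - 1 \<longleftrightarrow> (\<exists>d. has_moves n d G)"
proof
  assume "hirsch_length (houghton n\<lparr>carrier := G\<rparr>) = n - 1"
  then have "card (pivots n G) = card {2..n}" using hirsch_length_eq_pivots[OF G] by simp
  then have piv: "{2..n} \<subseteq> pivots n G" using pivots_one[OF G] by (metis card_subset_eq finite_atLeastAtMost subset_refl)
  have "\<exists>m>0. \<exists>g\<in>G. moves n (m * 1) i k g" if ik: "i \<in> {1..n}" "k \<in> {1..n}" for i k
  proof -
    let ?v = "\<lambda>j. (if j = i then 1 else 0) - (if j = k then 1 else 0) :: int"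
    have "(\<Sum>j\<in>{1..n}. ?v j) = 0" using ik by (simp add: sum_subtractf)
    then obtain m g where "m > 0" "g \<in> G" "\<forall>j\<in>{1..n}. trans_len g j = m * ?v j"
      using multiple_in_trans_lens[OF G piv, of ?v n] by auto
    then show ?thesis by (intro exI[of _ "nat m"] conjI bexI[of _ g]) (auto simp: moves_def)
  qed
  then show "\<exists>d. has_moves n d G" using has_moves_common[OF G, of 1] by auto
next
  assume "\<exists>d. has_moves n d G"
  then obtain d where d: "has_moves n d G" ..
  have "i \<in> pivots n G" if i: "i \<in> {2..n}" for i
  proof -
    obtain g where "g \<in> G" "moves n d i 1 g" using d i unfolding has_moves_def by fastforce
    then show ?thesis using i d unfolding pivots_def moves_def has_moves_def
      by (auto intro!: bexI[of _ g])
  qed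
  then have "pivots n G = {2..n}" using pivots_one[OF G] by blast
  then show "hirsch_length (houghton n\<lparr>carrier := G\<rparr>) = n - 1" using hirsch_length_eq_pivots[OF G] by simp
qed

text \<open>
  A subgroup of finite index still has powers of the required elements. Restricting it to the
  translation vectors divisible by a common multiple \<open>c\<close> makes its lattice of translation vectors
  exactly the set of vectors divisible by \<open>c\<close> with coordinate sum \<open>0\<close>.
\<close>

lemma lattice_refine:
  assumes G: "subgroup G (houghton n)" "has_moves n d G"
    and H: "subgroup H (houghton n)" "fin_idx H G"
  defines "H' \<equiv> \<lambda>c. {g\<in>H. \<forall>j\<in>{1..n}. int c dvd trans_len g j}"
  shows "\<exists>c. d dvd c \<and> subgroup (H' c) (houghton n) \<and> fin_idx (H' c) H \<and> has_moves n c (H' c)"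
proof -
  have HG: "H \<subseteq> G" using H(2) fin_idx_def by blast
  have d: "d > 0" using G(2) has_moves_def by blast
  have "\<exists>m>0. \<exists>g\<in>H. moves n (m * d) i k g" if ik: "i \<in> {1..n}" "k \<in> {1..n}" for i k
  proof -
    obtain g where g: "g \<in> G" "moves n d i k g" using G(2) ik unfolding has_moves_def by blast
    obtain m where m: "m > 0" "(g ^^ m) \<in> H" using fin_idx_power[OF G(1) H g(1)] by blast
    have "moves n (m * d) i k (g ^^ m)"
      using g(2) trans_len_funpow[OF subgroup_houghtonD(1)[OF G(1) g(1)]] by (simp add: moves_def)
    then show ?thesis using m by blast
  qed
  then obtain c where c: "c > 0" "has_moves n (c * d) H" using has_moves_common[OF H(1) d] by blast
  let ?c = "c * d"
  have sub: "subgroup (H' ?c) (houghton n)"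
    using H(1) trans_len_comp[where n = n] trans_len_inv[where n = n]
    unfolding subgroup_houghton_iff H'_def by (simp add: subset_iff)
  have "fin_idx (H' ?c) H"
  proof (rule fin_idxI[OF H(1), where c = "\<lambda>g. \<lambda>j\<in>{1..n}. trans_len g j mod int ?c"])
    show "H' ?c \<subseteq> H" unfolding H'_def by blast
    have "(\<lambda>g. \<lambda>j\<in>{1..n}. trans_len g j mod int ?c) ` H \<subseteq> {1..n} \<rightarrow>\<^sub>E {0..<int ?c}"
      using c(1) d by auto
    then show "finite ((\<lambda>g. \<lambda>j\<in>{1..n}. trans_len g j mod int ?c) ` H)"
      by (rule finite_subset) (intro finite_PiE; simp)
    fix g h assume gh: "g \<in> H" "h \<in> H"
      and eq: "(\<lambda>j\<in>{1..n}. trans_len g j mod int ?c) = (\<lambda>j\<in>{1..n}. trans_len h j mod int ?c)"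
    have "int ?c dvd trans_len (finv h \<circ> g) j" if j: "j \<in> {1..n}" for j
    proof -
      have "trans_len g j mod int ?c = trans_len h j mod int ?c" using fun_cong[OF eq, of j] j by simp
      then have "int ?c dvd trans_len g j - trans_len h j" by (simp add: mod_eq_dvd_iff)
      moreover have "trans_len (finv h \<circ> g) j = trans_len g j - trans_len h j"
        using trans_len_comp[of "finv h" n g j] trans_len_inv[of h n j] j subgroup_houghtonD[OF H(1)] gh by simp
      ultimately show ?thesis by simp
    qed
    then show "finv h \<circ> g \<in> H' ?c" unfolding H'_def using subgroup_houghtonD[OF H(1)] gh by blast
  qed
  moreover have "has_moves n ?c (H' ?c)"
  proof -
    have "g \<in> H' ?c" if "g \<in> H" "moves n ?c i k g" for g i k
      using that by (auto simp: H'_def moves_def simp del: of_nat_mult)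
    then show ?thesis using c(2) unfolding has_moves_def by blast
  qed
  ultimately show ?thesis using sub by (intro exI[of _ ?c]) auto
qed

section \<open>Dynamics near the ends of the rays\<close>

text \<open>
  For at least three rays, every group of full Hirsch length has a subgroup of finite index of this kind. The translation
  vectors are exactly the vectors divisible by \<open>d\<close> with coordinate sum \<open>0\<close>, and points in finite orbits
  are fixed. Three rays are essential: an element translating ray \<open>i\<close> can fix almost all of ray \<open>j\<close>,
  because the compensating translation takes place on a third ray.
\<close>

locale lattice_subgroup =
  fixes n :: nat and G :: "(nat \<times> nat \<Rightarrow> nat \<times> nat) set" and d :: nat and Fx :: "(nat \<times> nat) set"
  assumes three_le: "3 \<le> n"
    and sub: "subgroup G (houghton n)"
    and has_moves: "has_moves n d G"
    and dvd_trans_len: "g \<in> G \<Longrightarrow> j \<in> {1..n} \<Longrightarrow> int d dvd trans_len g j"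
    and Fx: "finite Fx" "Fx \<subseteq> ray_system n"
    and fix_Fx: "g \<in> G \<Longrightarrow> x \<in> Fx \<Longrightarrow> g x = x"
    and infinite_orb: "x \<in> ray_system n - Fx \<Longrightarrow> infinite (orb G x)"
begin

definition "pts = ray_system n - Fx"

lemmas in_houghton = subgroup_houghtonD(1)[OF sub]
  and id_in = subgroup_houghtonD(2)[OF sub]
  and comp_in = subgroup_houghtonD(3)[OF sub]
  and finv_in = subgroup_houghtonD(4)[OF sub]
  and bij_in = subgroup_houghtonD(5)[OF sub]
  and funpow_in = subgroup_houghtonD(6)[OF sub]

lemma d_pos: "d > 0" using has_moves unfolding has_moves_def by blast

lemma inj_in: "g \<in> G \<Longrightarrow> g x = g y \<longleftrightarrow> x = y"
  using bij_in by (metis bij_pointE)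

lemma in_pts: assumes "g \<in> G" shows "g x \<in> pts \<longleftrightarrow> x \<in> pts"
proof -
  have "g x \<in> Fx \<longleftrightarrow> x \<in> Fx" using fix_Fx[OF assms] inj_in[OF assms] by metis
  then show ?thesis unfolding pts_def
    using permutes_in_image[OF houghton_permutes[OF in_houghton[OF assms]]] by blast
qed

lemma orb_subset: assumes "x \<in> pts" shows "orb G x \<subseteq> pts"
  unfolding orb_def using in_pts assms by blast

definition gen :: "nat \<Rightarrow> nat \<Rightarrow> nat \<times> nat \<Rightarrow> nat \<times> nat" where
  "gen i k = (SOME g. g \<in> G \<and> moves n d i k g)"

lemma gen: assumes "i \<in> {1..n}" "k \<in> {1..n}" shows "gen i k \<in> G" "moves n d i k (gen i k)"
proof -
  have "\<exists>g. g \<in> G \<and> moves n d i k g" using has_moves assms unfolding has_moves_def by blast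
  then have "gen i k \<in> G \<and> moves n d i k (gen i k)" unfolding gen_def by (rule someI_ex)
  then show "gen i k \<in> G" "moves n d i k (gen i k)" by auto
qed

definition D0 :: nat where
  "D0 = (SOME L. \<forall>i\<in>{1..n}. \<forall>k\<in>{1..n}. \<forall>j\<in>{1..n}. \<forall>l\<ge>L. fst (gen i k (j, l)) = j \<and>
     int (snd (gen i k (j, l))) = int l + trans_len (gen i k) j)"

lemma D0:
  assumes "i \<in> {1..n}" "k \<in> {1..n}" "j \<in> {1..n}" "l \<ge> D0"
  shows "fst (gen i k (j, l)) = j" "int (snd (gen i k (j, l))) = int l + trans_len (gen i k) j"
proof -
  have "\<forall>i\<in>{1..n}. \<forall>k\<in>{1..n}. \<exists>L. \<forall>j\<in>{1..n}. \<forall>l\<ge>L. fst (gen i k (j, l)) = j \<and>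
     int (snd (gen i k (j, l))) = int l + trans_len (gen i k) j"
    by (intro ballI houghton_threshold in_houghton gen(1))
  then obtain L where L: "\<And>i k j l. i \<in> {1..n} \<Longrightarrow> k \<in> {1..n} \<Longrightarrow> j \<in> {1..n} \<Longrightarrow> l \<ge> L i k \<Longrightarrow> fst (gen i k (j, l)) = j \<and>
     int (snd (gen i k (j, l))) = int l + trans_len (gen i k) j"
    by metis
  define M where "M = Max ((\<lambda>(i, k). L i k) ` ({1..n} \<times> {1..n}))"
  have LM: "L i k \<le> M" if "i \<in> {1..n}" "k \<in> {1..n}" for i k
    unfolding M_def using that by (intro Max_ge) auto
  have ex: "\<exists>M. \<forall>i\<in>{1..n}. \<forall>k\<in>{1..n}. \<forall>j\<in>{1..n}. \<forall>l\<ge>M. fst (gen i k (j, l)) = j \<and>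
     int (snd (gen i k (j, l))) = int l + trans_len (gen i k) j"
  proof (intro exI[of _ M] ballI allI impI)
    fix i k j l assume *: "i \<in> {1..n}" "k \<in> {1..n}" "j \<in> {1..n}" "M \<le> l"
    have "l \<ge> L i k" using LM[OF *(1,2)] *(4) by simp
    then show "fst (gen i k (j, l)) = j \<and> int (snd (gen i k (j, l))) = int l + trans_len (gen i k) j"
      by (rule L[OF *(1-3)])
  qed
  have "\<forall>i\<in>{1..n}. \<forall>k\<in>{1..n}. \<forall>j\<in>{1..n}. \<forall>l\<ge>D0. fst (gen i k (j, l)) = j \<and>
     int (snd (gen i k (j, l))) = int l + trans_len (gen i k) j"
    using someI_ex[OF ex] unfolding D0_def .
  then show "fst (gen i k (j, l)) = j" "int (snd (gen i k (j, l))) = int l + trans_len (gen i k) j"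
    using assms by blast+
qed

lemma gen_up: "i \<in> {1..n} \<Longrightarrow> k \<in> {1..n} \<Longrightarrow> i \<noteq> k \<Longrightarrow> l \<ge> D0 \<Longrightarrow> gen i k (i, l) = (i, l + d)"
  using D0[of i k i l] gen(2)[of i k] by (auto simp: moves_def prod_eq_iff)

lemma gen_down: "i \<in> {1..n} \<Longrightarrow> k \<in> {1..n} \<Longrightarrow> i \<noteq> k \<Longrightarrow> l \<ge> D0 \<Longrightarrow> gen i k (k, l + d) = (k, l)"
  using D0[of i k k "l + d"] gen(2)[of i k] by (auto simp: moves_def prod_eq_iff)

lemma gen_fix: "i \<in> {1..n} \<Longrightarrow> k \<in> {1..n} \<Longrightarrow> j \<in> {1..n} \<Longrightarrow> j \<noteq> i \<Longrightarrow> j \<noteq> k \<Longrightarrow> l \<ge> D0 \<Longrightarrow> gen i k (j, l) = (j, l)"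
  using D0[of i k j l] gen(2)[of i k] by (auto simp: moves_def prod_eq_iff)

lemma gen_up_pow: "i \<in> {1..n} \<Longrightarrow> k \<in> {1..n} \<Longrightarrow> i \<noteq> k \<Longrightarrow> l \<ge> D0 \<Longrightarrow> (gen i k ^^ m) (i, l) = (i, l + m * d)"
  by (induction m) (simp_all add: gen_up algebra_simps)

lemma gen_down_pow: "i \<in> {1..n} \<Longrightarrow> k \<in> {1..n} \<Longrightarrow> i \<noteq> k \<Longrightarrow> l \<ge> D0 \<Longrightarrow> (gen i k ^^ m) (k, l + m * d) = (k, l)"
proof (induction m)
  case (Suc m)
  have "(gen i k ^^ Suc m) (k, l + Suc m * d) = (gen i k ^^ m) (gen i k (k, (l + m * d) + d))"
    by (simp add: funpow_swap1 algebra_simps)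
  then show ?case using Suc gen_down[of i k "l + m * d"] by simp
qed simp

lemma gen_fix_pow: "i \<in> {1..n} \<Longrightarrow> k \<in> {1..n} \<Longrightarrow> j \<in> {1..n} \<Longrightarrow> j \<noteq> i \<Longrightarrow> j \<noteq> k \<Longrightarrow> l \<ge> D0 \<Longrightarrow> (gen i k ^^ m) (j, l) = (j, l)"
  by (induction m) (simp_all add: gen_fix)

lemma gen_pow_in: "i \<in> {1..n} \<Longrightarrow> k \<in> {1..n} \<Longrightarrow> (gen i k ^^ m) \<in> G"
  using funpow_in gen by blast

lemma trans_len_gen_pow:
  assumes "i \<in> {1..n}" "k \<in> {1..n}" "j \<in> {1..n}"
  shows "trans_len (gen i k ^^ m) j = int m * int d * ((if j = i then 1 else 0) - (if j = k then 1 else 0))"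
  using trans_len_funpow[OF in_houghton[OF gen(1)[OF assms(1,2)]] assms(3), of m] gen(2)[OF assms(1,2)] assms(3)
  by (simp add: moves_def)

lemma ex_other: "\<exists>k\<in>{1..n}. k \<noteq> i \<and> k \<noteq> j"
proof -
  have "\<not> {1..n} \<subseteq> {i, j}"
  proof
    assume "{1..n} \<subseteq> {i, j}"
    then have "card {1..n} \<le> card {i, j}" by (intro card_mono) auto
    also have "\<dots> \<le> 2" by (simp add: card_insert_if)
    finally show False using three_le by simp
  qed
  then show ?thesis by blast
qed

lemma deep_in_pts: assumes "j \<in> {1..n}" "l \<ge> D0" shows "(j, l) \<in> pts"
proof -
  obtain k where k: "k \<in> {1..n}" "k \<noteq> j" using ex_other by blast
  have "gen j k (j, l) \<noteq> (j, l)" using gen_up[OF assms(1) k(1) _ assms(2)] k d_pos by simp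
  then have "(j, l) \<notin> Fx" using fix_Fx[OF gen(1)[OF assms(1) k(1)]] by blast
  then show ?thesis using assms by (simp add: pts_def ray_system_def)
qed

lemma infinite_orb_meets:
  assumes "infinite A" "A \<subseteq> ray_system n"
  shows "\<exists>j\<in>{1..n}. \<exists>l\<ge>B. (j, l) \<in> A"
proof (rule ccontr)
  assume "\<not> ?thesis"
  then have "A \<subseteq> {x \<in> ray_system n. snd x < B}"
    using assms(2) by (force simp: ray_system_def not_le)
  then show False using assms(1) finite_core finite_subset by blast
qed

text \<open>
  The forward orbit under \<open>gen i k\<close> of a point far out on ray \<open>k\<close> is infinite, because the backward
  orbit is. It cannot return to ray \<open>k\<close> above its starting height, so it leaves along ray \<open>i\<close>.
\<close>

lemma change_ray:
  assumes ik: "i \<in> {1..n}" "k \<in> {1..n}" "i \<noteq> k" and l: "l \<ge> D0"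
  shows "\<exists>g\<in>G. \<exists>l'\<ge>D0. g (k, l) = (i, l')"
proof -
  define u where "u = gen i k"
  define p where "p m = (u ^^ m) (k, l)" for m
  have uG: "(u ^^ m) \<in> G" for m unfolding u_def using ik by (intro gen_pow_in)
  have "inj p"
  proof (rule linorder_injI)
    fix a b :: nat assume "a < b"
    show "p a \<noteq> p b"
    proof
      assume "p a = p b"
      moreover have "p b = (u ^^ a) (p (b - a))"
        using \<open>a < b\<close> unfolding p_def by (metis comp_apply funpow_add le_add_diff_inverse less_imp_le)
      ultimately have "p (b - a) = (k, l)" using inj_in[OF uG] unfolding p_def by metis
      moreover have "(u ^^ (b - a)) (k, l + (b - a) * d) = (k, l)"
        unfolding u_def by (rule gen_down_pow[OF ik l])
      ultimately have "(k, l + (b - a) * d) = (k, l)" using inj_in[OF uG] unfolding p_def by metis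
      then show False using \<open>a < b\<close> d_pos by simp
    qed
  qed
  then have "infinite (range p)" by (rule range_inj_infinite)
  moreover have "range p \<subseteq> ray_system n"
  proof -
    have "p m \<in> pts" for m unfolding p_def using in_pts[OF uG] deep_in_pts[OF ik(2) l] by blast
    then show ?thesis unfolding pts_def by blast
  qed
  ultimately obtain j l' where j: "j \<in> {1..n}" "l' \<ge> max D0 (l + 1)" "(j, l') \<in> range p"
    using infinite_orb_meets by blast
  then obtain m where m: "(j, l') = p m" by blast
  have "j = i"
  proof (rule ccontr)
    assume "j \<noteq> i"
    show False
    proof (cases "j = k")
      case True
      have "(u ^^ m) (k, l' + m * d) = (k, l')" unfolding u_def using j by (intro gen_down_pow[OF ik]) auto
      then have "(k, l' + m * d) = (k, l)" using inj_in[OF uG] m True unfolding p_def by metis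
      then show False using j by simp
    next
      case False
      have "u (p m) = p m" unfolding m[symmetric] u_def using gen_fix[OF ik(1,2) j(1)] \<open>j \<noteq> i\<close> False j by simp
      then have "p (Suc m) = p m" unfolding p_def by simp
      then show False using \<open>inj p\<close> unfolding inj_def by (metis n_not_Suc_n)
    qed
  qed
  then show ?thesis using m j uG unfolding p_def by (metis max.boundedE)
qed

text \<open>
  Move \<open>x\<close> to ray \<open>i\<close> and then correct the translation of ray \<open>j\<close> by elements that translate
  ray \<open>j\<close> and a third ray but fix ray \<open>i\<close> far out.
\<close>

lemma reach:
  assumes x: "x \<in> pts" and ij: "i \<in> {1..n}" "j \<in> {1..n}" "i \<noteq> j"
  shows "\<exists>g\<in>G. trans_len g j = 0 \<and> (\<exists>l\<ge>D0. g x = (i, l))"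
proof -
  have "infinite (orb G x)" "orb G x \<subseteq> ray_system n"
    using x infinite_orb orb_subset[OF x] unfolding pts_def by auto
  then obtain k l g where k: "k \<in> {1..n}" "l \<ge> D0" and g: "g \<in> G" "g x = (k, l)"
    using infinite_orb_meets[of "orb G x" D0] unfolding orb_def by force
  have "\<exists>g\<in>G. \<exists>l\<ge>D0. g x = (i, l)"
  proof (cases "k = i")
    case False
    then obtain h l' where "h \<in> G" "l' \<ge> D0" "h (k, l) = (i, l')" using change_ray[of i k] ij k by blast
    then show ?thesis using g by (intro bexI[of _ "h \<circ> g"] exI[of _ l']) (auto intro: comp_in)
  qed (use g k in blast)
  then obtain g l where g: "g \<in> G" "l \<ge> D0" "g x = (i, l)" by blast
  obtain k where k: "k \<in> {1..n}" "k \<noteq> i" "k \<noteq> j" using ex_other by blast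
  obtain z where z: "trans_len g j = int d * z" using dvd_trans_len[OF g(1) ij(2)] by blast
  define u where "u = (if z \<ge> 0 then gen k j ^^ nat z else gen j k ^^ nat (- z))"
  have uG: "u \<in> G" unfolding u_def using gen_pow_in k ij by simp
  have "u (i, l) = (i, l)" unfolding u_def using gen_fix_pow k ij g(2) by auto
  moreover have "trans_len u j = - (int d * z)" unfolding u_def using trans_len_gen_pow k ij by simp
  then have "trans_len (u \<circ> g) j = 0"
    using trans_len_comp[OF in_houghton[OF uG] in_houghton[OF g(1)] ij(2)] z by simp
  ultimately show ?thesis using comp_in[OF uG g(1)] g by (intro bexI[of _ "u \<circ> g"]) auto
qed

text \<open>
  A point \<open>y\<close> that escapes has infinite orbits under the stabilisers of all points of ray \<open>j\<close> from
  height \<open>L\<close> on.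
\<close>

definition escapes :: "nat \<Rightarrow> nat \<times> nat \<Rightarrow> nat \<Rightarrow> bool" where
  "escapes j y L \<longleftrightarrow> (\<forall>B. \<exists>g\<in>G. (\<forall>l\<ge>L. g (j, l) = (j, l)) \<and> (\<exists>i\<in>{1..n} - {j}. \<exists>l\<ge>B. g y = (i, l)))"

lemma escapes_mono: "escapes j y L \<Longrightarrow> L \<le> L' \<Longrightarrow> escapes j y L'"
  unfolding escapes_def by (meson le_trans)

lemma escapes_off_ray:
  assumes "i \<in> {1..n}" "j \<in> {1..n}" "i \<noteq> j" "l \<ge> D0"
  shows "escapes j (i, l) D0"
  unfolding escapes_def
proof
  fix B
  obtain k where k: "k \<in> {1..n}" "k \<noteq> i" "k \<noteq> j" using ex_other by blast
  let ?g = "gen i k ^^ B"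
  have "\<forall>l\<ge>D0. ?g (j, l) = (j, l)" using gen_fix_pow assms k by simp
  moreover have "?g (i, l) = (i, l + B * d)" using gen_up_pow assms k by simp
  moreover have "l + B * d \<ge> B" using d_pos by (cases d) auto
  ultimately show "\<exists>g\<in>G. (\<forall>l\<ge>D0. g (j, l) = (j, l)) \<and> (\<exists>i'\<in>{1..n} - {j}. \<exists>l'\<ge>B. g (i, l) = (i', l'))"
    using gen_pow_in[OF assms(1) k(1)] assms(1,3) by blast
qed

lemma escapes_ex:
  assumes y: "y \<in> pts" and j: "j \<in> {1..n}"
  shows "\<exists>L. escapes j y L"
proof -
  obtain i where i: "i \<in> {1..n}" "i \<noteq> j" using ex_other by blast
  obtain g l where g: "g \<in> G" "trans_len g j = 0" "l \<ge> D0" "g y = (i, l)" using reach[OF y i(1) j i(2)] by blast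
  obtain L where L: "\<forall>l\<ge>L. g (j, l) = (j, l)"
    using houghton_threshold[OF in_houghton[OF g(1)]] j g(2) by (metis add.right_neutral of_nat_eq_iff prod.collapse)
  have "escapes j y (max D0 L)"
    unfolding escapes_def
  proof
    fix B
    obtain h i' l' where h: "h \<in> G" "\<forall>l\<ge>D0. h (j, l) = (j, l)" "i' \<in> {1..n} - {j}" "l' \<ge> B" "h (i, l) = (i', l')"
      using escapes_off_ray[OF i(1) j i(2) g(3)] unfolding escapes_def by blast
    have "\<forall>l\<ge>max D0 L. (h \<circ> g) (j, l) = (j, l)" using h(2) L by simp
    moreover have "(h \<circ> g) y = (i', l')" using g(4) h(5) by simp
    ultimately show "\<exists>g\<in>G. (\<forall>l\<ge>max D0 L. g (j, l) = (j, l)) \<and> (\<exists>i\<in>{1..n} - {j}. \<exists>l\<ge>B. g y = (i, l))"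
      using comp_in[OF h(1) g(1)] h(3,4) by blast
  qed
  then show ?thesis by blast
qed

text \<open>
  Points far out on another ray escape by \<open>escapes_off_ray\<close>; only finitely many points need
  individual thresholds. The bound \<open>D0 + d\<close> instead of \<open>D0\<close> leaves room for a full period above
  \<open>D0\<close>, into which every higher point of the ray can be translated.
\<close>

lemma uniform_escape:
  "\<exists>D\<ge>D0. \<forall>j\<in>{1..n}. \<forall>y\<in>pts. fst y \<noteq> j \<or> snd y < D0 + d \<longrightarrow> escapes j y D"
proof -
  let ?C = "{1..n} \<times> {x \<in> ray_system n. snd x < D0 + d}"
  define L where "L = (\<lambda>(j, y). SOME K. escapes j y K)"
  have L: "escapes j y (L (j, y))" if "j \<in> {1..n}" "y \<in> pts" for j y
    using someI_ex[OF escapes_ex[OF that(2,1)]] by (simp add: L_def)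
  have fin: "finite ?C" using finite_core by simp
  define D where "D = Max (insert D0 (L ` ?C))"
  have "escapes j y D" if "j \<in> {1..n}" "y \<in> pts" "fst y \<noteq> j \<or> snd y < D0 + d" for j y
  proof (cases "snd y < D0 + d")
    case True
    then have "(j, y) \<in> ?C" using that by (auto simp: pts_def)
    then have "L (j, y) \<le> D" unfolding D_def using fin by (intro Max_ge) auto
    then show ?thesis using L[OF that(1,2)] escapes_mono by blast
  next
    case False
    then have "escapes j (fst y, snd y) D0"
      using that by (intro escapes_off_ray) (auto simp: pts_def ray_system_def)
    moreover have "D0 \<le> D" unfolding D_def using fin by (intro Max_ge) auto
    ultimately show ?thesis using escapes_mono by simp
  qed
  moreover have "D0 \<le> D" unfolding D_def using fin by (intro Max_ge) auto
  ultimately show ?thesis by blast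
qed

definition D1 :: nat where
  "D1 = (SOME D. D \<ge> D0 \<and> (\<forall>j\<in>{1..n}. \<forall>y\<in>pts. fst y \<noteq> j \<or> snd y < D0 + d \<longrightarrow> escapes j y D))"

lemma D1: "D1 \<ge> D0" "j \<in> {1..n} \<Longrightarrow> y \<in> pts \<Longrightarrow> fst y \<noteq> j \<or> snd y < D0 + d \<Longrightarrow> escapes j y D1"
proof -
  have "D1 \<ge> D0 \<and> (\<forall>j\<in>{1..n}. \<forall>y\<in>pts. fst y \<noteq> j \<or> snd y < D0 + d \<longrightarrow> escapes j y D1)"
    using someI_ex[OF uniform_escape] unfolding D1_def .
  then show "D1 \<ge> D0" "j \<in> {1..n} \<Longrightarrow> y \<in> pts \<Longrightarrow> fst y \<noteq> j \<or> snd y < D0 + d \<Longrightarrow> escapes j y D1"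
    by blast+
qed

section \<open>Points with commensurable stabilisers\<close>

text \<open>
  The algebraic closure of \<open>x\<close>: the points with finite orbit under the stabiliser of \<open>x\<close>. It turns
  out that \<open>y \<in> acl x\<close> holds exactly if the stabilisers of \<open>x\<close> and \<open>y\<close> are commensurable. The
  classes of this equivalence relation form the coarsest invariant partition of \<open>pts\<close> into finite
  parts: the stabiliser of \<open>x\<close> preserves the part of \<open>x\<close>.
\<close>

definition acl :: "nat \<times> nat \<Rightarrow> (nat \<times> nat) set" where
  "acl x = {y \<in> pts. finite (orb (fixing G {x}) y)}"

lemma acl_refl: "x \<in> pts \<Longrightarrow> x \<in> acl x"
proof -
  have "orb (fixing G {x}) x \<subseteq> {x}" unfolding orb_def fixing_def by auto
  then have "finite (orb (fixing G {x}) x)" using finite_subset by blast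
  then show "x \<in> pts \<Longrightarrow> x \<in> acl x" unfolding acl_def by blast
qed

lemma acl_image: assumes "g \<in> G" "y \<in> acl x" shows "g y \<in> acl (g x)"
proof -
  have "orb (fixing G {g x}) (g y) \<subseteq> g ` orb (fixing G {x}) y"
  proof
    fix z assume "z \<in> orb (fixing G {g x}) (g y)"
    then obtain h where h: "h \<in> G" "h (g x) = g x" "z = h (g y)" unfolding orb_def fixing_def by blast
    let ?k = "finv g \<circ> (h \<circ> g)"
    have "?k \<in> fixing G {x}" unfolding fixing_def
      using comp_in finv_in assms(1) h bij_finv(1)[OF bij_in[OF assms(1)]] by simp
    moreover have "z = g (?k y)" using h(3) bij_finv(2)[OF bij_in[OF assms(1)]] by simp
    ultimately show "z \<in> g ` orb (fixing G {x}) y" unfolding orb_def by blast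
  qed
  then show ?thesis using assms in_pts finite_subset unfolding acl_def by blast
qed

lemma escapes_not_acl:
  assumes "escapes j y L" "l \<ge> L" shows "y \<notin> acl (j, l)"
proof
  assume "y \<in> acl (j, l)"
  then have fin: "finite (snd ` orb (fixing G {(j, l)}) y)" unfolding acl_def by blast
  obtain g i l' where g: "g \<in> G" "\<forall>l\<ge>L. g (j, l) = (j, l)" "g y = (i, l')"
      "l' \<ge> Suc (Max (snd ` orb (fixing G {(j, l)}) y))"
    using assms(1) unfolding escapes_def by blast
  have "g y \<in> orb (fixing G {(j, l)}) y" using g(1,2) assms(2) unfolding orb_def fixing_def by blast
  then have "l' \<in> snd ` orb (fixing G {(j, l)}) y" using g(3) by force
  then have "l' \<le> Max (snd ` orb (fixing G {(j, l)}) y)" using fin by (rule Max_ge[rotated])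
  then show False using g(4) by simp
qed

lemma acl_same_ray:
  assumes "j \<in> {1..n}" "l \<ge> D1" "y \<in> acl (j, l)"
  shows "fst y = j" "snd y \<ge> D0 + d"
proof -
  have "y \<in> pts" using assms(3) unfolding acl_def by blast
  then have "\<not> (fst y \<noteq> j \<or> snd y < D0 + d)"
    using D1(2)[OF assms(1)] escapes_not_acl assms(2,3) by blast
  then show "fst y = j" "snd y \<ge> D0 + d" by auto
qed

text \<open>
  Translate both points down the ray until the lower one enters the window \<open>[D0, D0 + d)\<close>;
  the two points can then be separated.
\<close>

lemma acl_near:
  assumes j: "j \<in> {1..n}" and l: "l \<ge> D1" and y: "(j, l') \<in> acl (j, l)"
  shows "l < l' + D1" "l' < l + D1"
proof -
  obtain k where k: "k \<in> {1..n}" "k \<noteq> j" using ex_other by blast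
  have l': "l' \<ge> D0 + d" using acl_same_ray[OF j l y] by simp
  have ll: "l \<ge> D0" using l D1(1) by simp
  show "l < l' + D1"
  proof (rule ccontr)
    assume "\<not> ?thesis"
    define c where "c = (l' - D0) div d"
    define r where "r = D0 + (l' - D0) mod d"
    have r: "l' = r + c * d" "r \<ge> D0" "r < D0 + d"
      using l' d_pos by (auto simp: r_def c_def algebra_simps)
    have lc: "l = (l - c * d) + c * d" "l - c * d \<ge> D1" using \<open>\<not> l < l' + D1\<close> r by auto
    have "(gen k j ^^ c) (j, l) = (j, l - c * d)" "(gen k j ^^ c) (j, l') = (j, r)"
      using gen_down_pow[of k j "l - c * d" c] gen_down_pow[of k j r c] lc r D1(1) k j by auto
    then have "(j, r) \<in> acl (j, l - c * d)" using acl_image[OF gen_pow_in[OF k(1) j] y] by metis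
    then show False using acl_same_ray(2)[OF j lc(2)] r(3) by force
  qed
  show "l' < l + D1"
  proof (rule ccontr)
    assume "\<not> ?thesis"
    define c where "c = (l - D0) div d"
    define r where "r = D0 + (l - D0) mod d"
    have r: "l = r + c * d" "r \<ge> D0" "r < D0 + d"
      using ll d_pos by (auto simp: r_def c_def algebra_simps)
    have lc: "l' = (l' - c * d) + c * d" "l' - c * d \<ge> D1" using \<open>\<not> l' < l + D1\<close> r by auto
    have "(gen k j ^^ c) (j, l') = (j, l' - c * d)" "(gen k j ^^ c) (j, l) = (j, r)"
      using gen_down_pow[of k j "l' - c * d" c] gen_down_pow[of k j r c] lc r D1(1) k j by auto
    then have y': "(j, l' - c * d) \<in> acl (j, r)" using acl_image[OF gen_pow_in[OF k(1) j] y] by metis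
    have "escapes j (j, r) D1" using D1(2)[OF j deep_in_pts[OF j r(2)]] r(3) by simp
    then obtain g i l'' where g: "g \<in> G" "\<forall>l\<ge>D1. g (j, l) = (j, l)" "i \<in> {1..n} - {j}" "l'' \<ge> D1" "g (j, r) = (i, l'')"
      unfolding escapes_def by blast
    have "(j, l' - c * d) \<in> acl (i, l'')" using acl_image[OF g(1) y'] g(2,5) lc(2) by metis
    then show False using acl_same_ray(1)[of i l''] g(3,4) by force
  qed
qed

lemma reach_deep: assumes "x \<in> pts" shows "\<exists>g\<in>G. \<exists>j\<in>{1..n}. \<exists>l\<ge>B. g x = (j, l)"
proof -
  have "infinite (orb G x)" "orb G x \<subseteq> ray_system n"
    using assms infinite_orb orb_subset[OF assms] unfolding pts_def by auto
  then show ?thesis using infinite_orb_meets[of "orb G x" B] unfolding orb_def by force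
qed

lemma finite_acl: assumes "x \<in> pts" shows "finite (acl x)"
proof -
  obtain g j l where g: "g \<in> G" "j \<in> {1..n}" "l \<ge> D1" "g x = (j, l)" using reach_deep[OF assms] by blast
  have "g ` acl x \<subseteq> {j} \<times> {..<l + D1}"
  proof
    fix z assume "z \<in> g ` acl x"
    then have z: "z \<in> acl (j, l)" using acl_image[OF g(1), of _ x] unfolding g(4) by blast
    then have "fst z = j" using acl_same_ray g by blast
    then show "z \<in> {j} \<times> {..<l + D1}" using acl_near(2)[OF g(2,3), of "snd z"] z by (cases z) auto
  qed
  then have "finite (g ` acl x)" using finite_subset by blast
  then show ?thesis using finite_imageD inj_in[OF g(1)] by (metis inj_onI)
qed

lemma acl_pts: "y \<in> acl x \<Longrightarrow> y \<in> pts" unfolding acl_def by blast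

text \<open>
  By \<open>acl_near\<close> only finitely many points \<open>z\<close> satisfy \<open>y \<in> acl z\<close>, and the orbit of \<open>x\<close> under the
  stabiliser of \<open>y\<close> consists of such points.
\<close>

lemma acl_sym: assumes "x \<in> pts" "y \<in> acl x" shows "x \<in> acl y"
proof -
  let ?Z = "{z \<in> pts. y \<in> acl z}"
  have "?Z \<subseteq> {z \<in> ray_system n. snd z < D1 + snd y}"
  proof
    fix z assume z: "z \<in> ?Z"
    then have zR: "z \<in> ray_system n" "fst z \<in> {1..n}" by (auto simp: pts_def ray_system_def)
    have "snd z < D1 + snd y"
    proof (cases "snd z \<ge> D1")
      case True
      then have "fst y = fst z" using acl_same_ray(1)[OF zR(2) True, of y] z by simp
      then show ?thesis using acl_near(1)[OF zR(2) True, of "snd y"] z by (cases y) auto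
    qed simp
    then show "z \<in> {z \<in> ray_system n. snd z < D1 + snd y}" using zR by blast
  qed
  then have fin: "finite ?Z" using finite_core finite_subset by blast
  have "orb (fixing G {y}) x \<subseteq> ?Z"
  proof
    fix z assume "z \<in> orb (fixing G {y}) x"
    then obtain g where g: "g \<in> G" "g y = y" "z = g x" unfolding orb_def fixing_def by blast
    then show "z \<in> ?Z" using acl_image[OF g(1) assms(2)] in_pts[OF g(1)] assms(1) by simp
  qed
  then show ?thesis using fin assms(1) finite_subset unfolding acl_def by blast
qed

lemma acl_trans: assumes "y \<in> acl x" "z \<in> acl y" shows "z \<in> acl x"
proof -
  let ?O = "orb (fixing G {x}) y"
  have O: "finite ?O" using assms(1) unfolding acl_def by blast
  have "?O \<subseteq> pts" using acl_pts[OF assms(1)] in_pts unfolding orb_def fixing_def by blast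
  then have "finite (\<Union>w\<in>?O. acl w)" using O finite_acl by blast
  moreover have "orb (fixing G {x}) z \<subseteq> (\<Union>w\<in>?O. acl w)"
  proof
    fix v assume "v \<in> orb (fixing G {x}) z"
    then obtain g where g: "g \<in> fixing G {x}" "v = g z" unfolding orb_def by blast
    then have "v \<in> acl (g y)" using acl_image[OF _ assms(2)] unfolding fixing_def by blast
    then show "v \<in> (\<Union>w\<in>?O. acl w)" using g(1) unfolding orb_def by blast
  qed
  ultimately show ?thesis using acl_pts[OF assms(2)] finite_subset unfolding acl_def by blast
qed

lemma acl_eq_iff: assumes "x \<in> pts" "y \<in> pts" shows "acl x = acl y \<longleftrightarrow> y \<in> acl x"
  using acl_refl[OF assms(2)] acl_sym[OF assms(1)] acl_trans by blast

end

section \<open>Passing to subgroups of finite index\<close>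

lemma fixing_subgroup:
  assumes "subgroup G (houghton n)" shows "subgroup (fixing G S) (houghton n)"
proof -
  have "finv g \<in> fixing G S" if "g \<in> fixing G S" for g
  proof -
    have g: "g \<in> G" "\<And>x. x \<in> S \<Longrightarrow> g x = x" using that unfolding fixing_def by auto
    have "finv g x = x" if "x \<in> S" for x
      using bij_finv(1)[OF subgroup_houghtonD(5)[OF assms g(1)], of x] g(2)[OF that] by simp
    then show ?thesis using subgroup_houghtonD(4)[OF assms g(1)] unfolding fixing_def by blast
  qed
  then show ?thesis
    using subgroup_houghtonD[OF assms] unfolding subgroup_houghton_iff fixing_def by auto
qed

text \<open>
  The points with finite orbits form a finite set, and the pointwise stabiliser of this set has
  finite index.
\<close>

lemma ex_lattice_subgroup:
  assumes n: "3 \<le> n" and G: "subgroup G (houghton n)" and d: "has_moves n d G"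
  shows "\<exists>G' d' Fx. fin_idx G' G \<and> lattice_subgroup n G' d' Fx"
proof -
  have d0: "d > 0" using d unfolding has_moves_def by blast
  define Fx where "Fx = {x \<in> ray_system n. finite (orb G x)}"
  have orbG: "g x \<in> ray_system n \<longleftrightarrow> x \<in> ray_system n" if "g \<in> G" for g x
    using permutes_in_image[OF houghton_permutes[OF subgroup_houghtonD(1)[OF G that]]] .
  have orb_eq: "orb G (g x) \<subseteq> orb G x" if "g \<in> G" for g x
  proof
    fix y assume "y \<in> orb G (g x)"
    then obtain h where "h \<in> G" "y = (h \<circ> g) x" unfolding orb_def by auto
    then show "y \<in> orb G x" using subgroup_houghtonD(3)[OF G _ that] unfolding orb_def by blast
  qed
  have "\<exists>L. \<forall>l\<ge>L. infinite (orb G (j, l))" if j: "j \<in> {1..n}" for j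
  proof -
    define k where "k = (if j = 1 then 2 else 1 :: nat)"
    have k: "k \<in> {1..n}" "k \<noteq> j" using n by (auto simp: k_def)
    obtain u where u: "u \<in> G" "moves n d j k u" using d j k unfolding has_moves_def by blast
    obtain L where L: "\<And>l. l \<ge> L \<Longrightarrow> fst (u (j, l)) = j \<and> int (snd (u (j, l))) = int l + trans_len u j"
      using houghton_threshold[OF subgroup_houghtonD(1)[OF G u(1)]] j by blast
    have step: "u (j, l) = (j, l + d)" if "l \<ge> L" for l
      using L[OF that] u(2) j k by (auto simp: moves_def prod_eq_iff)
    have "infinite (orb G (j, l))" if "l \<ge> L" for l
    proof -
      have p: "(u ^^ m) (j, l) = (j, l + m * d)" for m
        using that by (induction m) (auto simp: step algebra_simps)
      have "inj (\<lambda>m. (u ^^ m) (j, l))" using d0 by (auto simp: inj_def p)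
      then have "infinite (range (\<lambda>m. (u ^^ m) (j, l)))" by (rule range_inj_infinite)
      moreover have "range (\<lambda>m. (u ^^ m) (j, l)) \<subseteq> orb G (j, l)"
        using subgroup_houghtonD(6)[OF G u(1)] unfolding orb_def by blast
      ultimately show ?thesis using finite_subset by blast
    qed
    then show ?thesis by blast
  qed
  then obtain L where L: "\<And>j l. j \<in> {1..n} \<Longrightarrow> l \<ge> L j \<Longrightarrow> infinite (orb G (j, l))" by metis
  have LM: "L j \<le> Max (L ` {1..n})" if "j \<in> {1..n}" for j using that by simp
  have "Fx \<subseteq> {x \<in> ray_system n. snd x < Max (L ` {1..n})}"
  proof
    fix x assume x: "x \<in> Fx"
    then have "fst x \<in> {1..n}" "finite (orb G (fst x, snd x))" "x \<in> ray_system n"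
      unfolding Fx_def by (auto simp: ray_system_def)
    then have "snd x < L (fst x)" using L[of "fst x" "snd x"] by (meson not_le)
    also have "\<dots> \<le> Max (L ` {1..n})" using LM \<open>fst x \<in> {1..n}\<close> by blast
    finally show "x \<in> {x \<in> ray_system n. snd x < Max (L ` {1..n})}" using \<open>x \<in> ray_system n\<close> by blast
  qed
  then have finFx: "finite Fx" using finite_core finite_subset by blast
  have inv: "g x \<in> Fx" if "g \<in> G" "x \<in> Fx" for g x
    using that orb_eq[OF that(1), of x] orbG[OF that(1)] finite_subset unfolding Fx_def by blast
  let ?H = "fixing G Fx"
  have subH: "subgroup ?H (houghton n)" by (rule fixing_subgroup[OF G])
  have fiH: "fin_idx ?H G"
  proof (rule fin_idxI[OF G, where c = "\<lambda>g. restrict g Fx"])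
    show "?H \<subseteq> G" unfolding fixing_def by blast
    have "(\<lambda>g. restrict g Fx) ` G \<subseteq> Fx \<rightarrow>\<^sub>E Fx" using inv by auto
    then show "finite ((\<lambda>g. restrict g Fx) ` G)"
      by (rule finite_subset) (intro finite_PiE finFx)
    fix g h assume gh: "g \<in> G" "h \<in> G" and eq: "restrict g Fx = restrict h Fx"
    have "(finv h \<circ> g) x = x" if "x \<in> Fx" for x
      using fun_cong[OF eq, of x] that bij_finv(1)[OF subgroup_houghtonD(5)[OF G gh(2)], of x] by simp
    then show "finv h \<circ> g \<in> ?H" unfolding fixing_def using subgroup_houghtonD[OF G] gh by blast
  qed
  define H' where "H' c = {g\<in>?H. \<forall>j\<in>{1..n}. int c dvd trans_len g j}" for c
  obtain c where c: "subgroup (H' c) (houghton n)" "fin_idx (H' c) ?H" "has_moves n c (H' c)"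
    using lattice_refine[OF G d subH fiH] unfolding H'_def by blast
  have fi: "fin_idx (H' c) G" by (rule fin_idx_trans[OF G fiH c(2)])
  have "lattice_subgroup n (H' c) c Fx"
  proof (rule lattice_subgroup.intro[OF n c(1,3)])
    show "int c dvd trans_len g j" if "g \<in> H' c" "j \<in> {1..n}" for g j
      using that unfolding H'_def by blast
    show "finite Fx" by fact
    show "Fx \<subseteq> ray_system n" unfolding Fx_def by blast
    show "g x = x" if "g \<in> H' c" "x \<in> Fx" for g x using that unfolding H'_def fixing_def by blast
    show "infinite (orb (H' c) x)" if "x \<in> ray_system n - Fx" for x
      using fin_idx_infinite_orbit[OF G c(1) fi] that unfolding Fx_def by blast
  qed
  then show ?thesis using fi by blast
qed

text \<open>
  A point has a finite orbit under a stabiliser in \<open>G\<close> exactly if it has a finite orbit under the stabiliser in \<open>H\<close>.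
\<close>

lemma acl_fin_idx:
  assumes "lattice_subgroup n G d Fx" "lattice_subgroup n H d' Fx" "fin_idx H G"
  shows "lattice_subgroup.acl n H Fx x = lattice_subgroup.acl n G Fx x"
proof -
  interpret G: lattice_subgroup n G d Fx by fact
  interpret H: lattice_subgroup n H d' Fx by fact
  have HG: "H \<subseteq> G" using assms(3) fin_idx_def by blast
  have "finite (orb (fixing H {x}) y) \<longleftrightarrow> finite (orb (fixing G {x}) y)" for y
  proof
    show "finite (orb (fixing H {x}) y) \<Longrightarrow> finite (orb (fixing G {x}) y)"
      by (rule fin_idx_stabilizer_orbit[OF G.sub H.sub assms(3)])
    have "orb (fixing H {x}) y \<subseteq> orb (fixing G {x}) y" using HG unfolding orb_def fixing_def by blast
    then show "finite (orb (fixing G {x}) y) \<Longrightarrow> finite (orb (fixing H {x}) y)" by (rule finite_subset)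
  qed
  then show ?thesis unfolding G.acl_def H.acl_def G.pts_def H.pts_def by simp
qed

section \<open>The quotient ray system\<close>

lemma card_below_surj:
  fixes M :: "nat set"
  assumes "infinite M"
  shows "\<exists>l\<in>M. card {m\<in>M. m < l} = k"
proof (induction k)
  case 0
  obtain l where "l \<in> M" "\<And>m. m \<in> M \<Longrightarrow> l \<le> m"
    using infinite_imp_nonempty[OF assms] LeastI[of "\<lambda>m. m \<in> M"] Least_le[of "\<lambda>m. m \<in> M"] by blast
  then have "{m\<in>M. m < l} = {}" by force
  then show ?case using \<open>l \<in> M\<close> by (intro bexI[of _ l]) simp
next
  case (Suc k)
  then obtain l where l: "l \<in> M" "card {m\<in>M. m < l} = k" by blast
  define l' where "l' = (LEAST m. m \<in> M \<and> l < m)"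
  have "\<exists>m. m \<in> M \<and> l < m" using assms by (metis infinite_nat_iff_unbounded)
  then have l': "l' \<in> M" "l < l'" unfolding l'_def by (metis (mono_tags, lifting) LeastI)+
  have "{m\<in>M. m < l'} = insert l {m\<in>M. m < l}"
  proof (intro equalityI subsetI)
    fix m assume m: "m \<in> {m\<in>M. m < l'}"
    have "\<not> l < m" using m not_less_Least[of m "\<lambda>m. m \<in> M \<and> l < m"] unfolding l'_def by blast
    then show "m \<in> insert l {m\<in>M. m < l}" using m by auto
  qed (use l l' in auto)
  then have "card {m\<in>M. m < l'} = Suc k" using l by simp
  then show ?case using l' by blast
qed

lemma card_below_less:
  fixes M :: "nat set"
  assumes "l \<in> M" "l < l'" shows "card {m\<in>M. m < l} < card {m\<in>M. m < l'}"
  using assms by (intro psubset_card_mono) auto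

context lattice_subgroup begin

lemma acl_image_eq: assumes "g \<in> G" shows "acl (g x) = g ` acl x"
proof
  show "g ` acl x \<subseteq> acl (g x)" using acl_image[OF assms] by blast
  show "acl (g x) \<subseteq> g ` acl x"
  proof
    fix y assume "y \<in> acl (g x)"
    then have "finv g y \<in> acl x"
      using acl_image[OF finv_in[OF assms]] bij_finv(1)[OF bij_in[OF assms]] by metis
    then show "y \<in> g ` acl x" using bij_finv(2)[OF bij_in[OF assms]] by (metis image_eqI)
  qed
qed

text \<open>
  The heights of the least elements of classes that lie far out on ray \<open>j\<close>.
\<close>

definition lead :: "nat \<Rightarrow> nat set" where
  "lead j = {l. l \<ge> D1 \<and> (\<forall>l'. (j, l') \<in> acl (j, l) \<longrightarrow> l \<le> l')}"

lemma acl_shift: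
  assumes j: "j \<in> {1..n}" and l: "l \<ge> D1"
  shows "(j, l' + d) \<in> acl (j, l + d) \<longleftrightarrow> (j, l') \<in> acl (j, l)"
    and "(j, l'') \<in> acl (j, l + d) \<Longrightarrow> \<exists>l'. l'' = l' + d"
proof -
  obtain k where k: "k \<in> {1..n}" "k \<noteq> j" using ex_other by blast
  let ?u = "gen j k"
  have u: "?u \<in> G" "?u (j, l) = (j, l + d)" using gen j k gen_up[of j k l] D1(1) l by auto
  have deep: "l' \<ge> D0" if "(j, l') \<in> acl (j, l)" for l' using acl_same_ray(2)[OF j l that] by simp
  have eq: "acl (j, l + d) = ?u ` acl (j, l)" using acl_image_eq[OF u(1)] u(2) by metis
  show ex: "\<exists>l'. l'' = l' + d" if l'': "(j, l'') \<in> acl (j, l + d)" for l''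
  proof -
    obtain y where y: "y \<in> acl (j, l)" "(j, l'') = ?u y" using l'' eq by blast
    then have "y = (j, snd y)" using acl_same_ray(1)[OF j l y(1)] by (simp add: prod_eq_iff)
    then show ?thesis using y gen_up[of j k "snd y"] j k deep by (metis prod.inject)
  qed
  show "(j, l' + d) \<in> acl (j, l + d) \<longleftrightarrow> (j, l') \<in> acl (j, l)"
  proof
    assume "(j, l') \<in> acl (j, l)"
    then show "(j, l' + d) \<in> acl (j, l + d)" using gen_up[of j k l'] deep j k eq by force
  next
    assume "(j, l' + d) \<in> acl (j, l + d)"
    then obtain y where y: "y \<in> acl (j, l)" "(j, l' + d) = ?u y" using eq by blast
    then have yj: "y = (j, snd y)" using acl_same_ray(1)[OF j l y(1)] by (simp add: prod_eq_iff)
    then have "?u y = (j, snd y + d)" using y gen_up[of j k "snd y"] j k deep by metis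
    then show "(j, l') \<in> acl (j, l)" using y yj by simp
  qed
qed

lemma lead_shift: assumes "j \<in> {1..n}" "l \<ge> D1" shows "l + d \<in> lead j \<longleftrightarrow> l \<in> lead j"
proof -
  have "(\<forall>l'. (j, l') \<in> acl (j, l + d) \<longrightarrow> l + d \<le> l') \<longleftrightarrow> (\<forall>l'. (j, l') \<in> acl (j, l) \<longrightarrow> l \<le> l')"
    using acl_shift[OF assms] by (metis add_le_cancel_right)
  then show ?thesis using assms(2) unfolding lead_def by auto
qed

lemma lead_ex:
  assumes j: "j \<in> {1..n}" and l: "l \<ge> 2 * D1"
  shows "\<exists>l0\<in>lead j. l0 \<le> l \<and> l < l0 + D1 \<and> (j, l0) \<in> acl (j, l)"
proof -
  have lD: "l \<ge> D1" "(j, l) \<in> pts" using l deep_in_pts[OF j] D1(1) by auto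
  define l0 where "l0 = (LEAST l'. (j, l') \<in> acl (j, l))"
  have l0: "(j, l0) \<in> acl (j, l)" unfolding l0_def using acl_refl[OF lD(2)] by (rule LeastI)
  have le: "l0 \<le> l'" if "(j, l') \<in> acl (j, l)" for l' unfolding l0_def using that by (rule Least_le)
  have "acl (j, l0) = acl (j, l)" using acl_eq_iff[OF lD(2) acl_pts[OF l0]] l0 by simp
  moreover have "l < l0 + D1" using acl_near(1)[OF j lD(1) l0] .
  ultimately have "l0 \<in> lead j" using l le unfolding lead_def by auto
  then show ?thesis using l0 le[OF acl_refl[OF lD(2)]] \<open>l < l0 + D1\<close> by blast
qed

lemma lead_unique:
  assumes "j \<in> {1..n}" "i \<in> {1..n}" "l \<in> lead j" "m \<in> lead i" "acl (j, l) = acl (i, m)"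
  shows "j = i \<and> l = m"
proof -
  have D: "l \<ge> D1" "m \<ge> D1" using assms unfolding lead_def by auto
  have "(j, l) \<in> acl (i, m)" "(i, m) \<in> acl (j, l)"
    using acl_refl deep_in_pts[OF assms(1), of l] deep_in_pts[OF assms(2), of m] D D1(1) assms(5) by auto
  moreover from this have "j = i" using acl_same_ray(1)[OF assms(2) D(2)] by force
  ultimately show ?thesis using assms(3,4) unfolding lead_def by (auto intro: antisym)
qed

lemma infinite_lead: assumes "j \<in> {1..n}" shows "infinite (lead j)"
proof -
  have "\<exists>l0\<in>lead j. l0 > b" for b
  proof -
    obtain l0 where "l0 \<in> lead j" "2 * D1 + b + 1 < l0 + D1" using lead_ex[OF assms, of "2 * D1 + b + 1"] by auto
    then show ?thesis by (intro bexI[of _ l0]) auto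
  qed
  then show ?thesis unfolding infinite_nat_iff_unbounded by (metis less_imp_le)
qed

definition "lead_period j = card {m \<in> lead j. m < D1 + d}"

lemma card_lead_shift:
  assumes j: "j \<in> {1..n}" and that: "l \<ge> D1"
  shows "card {m \<in> lead j. m < l + d} = card {m \<in> lead j. m < l} + lead_period j"
proof -
  have "{m \<in> lead j. m < l + d} = {m \<in> lead j. m < D1 + d} \<union> (\<lambda>m. m + d) ` {m \<in> lead j. m < l}" (is "_ = ?A \<union> ?B")
  proof (intro equalityI subsetI)
    fix m assume m: "m \<in> {m \<in> lead j. m < l + d}"
    show "m \<in> ?A \<union> ?B"
    proof (cases "m < D1 + d")
      case False
      then have "m = (m - d) + d" "m - d \<ge> D1" by auto
      then show ?thesis using lead_shift[OF j, of "m - d"] m by (intro UnI2 image_eqI[of _ _ "m - d"]) auto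
    qed (use m in blast)
  next
    fix m assume "m \<in> ?A \<union> ?B"
    moreover have "m \<ge> D1" if "m \<in> lead j" for m using that unfolding lead_def by blast
    ultimately show "m \<in> {m \<in> lead j. m < l + d}" using that lead_shift[OF j] by auto
  qed
  moreover have "?A \<inter> ?B = {}" unfolding lead_def by auto
  moreover have "card ?B = card {m \<in> lead j. m < l}" by (intro card_image) (auto simp: inj_on_def)
  moreover have "finite ?A" "finite ?B" by auto
  ultimately show ?thesis unfolding lead_period_def by (simp add: card_Un_disjoint)
qed

text \<open>
  Every class with a point far out is a subset of a single ray. These classes are numbered on each
  ray in the order of their least elements, and translation by \<open>d\<close> preserves this order. The
  finitely many remaining classes are put at the beginning of the first ray.
\<close>

lemma ex_quotient_map:
  "\<exists>q e. q ` pts = ray_system n \<and> (\<forall>x\<in>pts. \<forall>y\<in>pts. q x = q y \<longleftrightarrow> y \<in> acl x) \<and>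
    (\<exists>L. \<forall>j\<in>{1..n}. \<forall>l\<ge>L. fst (q (j, l)) = j \<and> q (j, l + d) = (j, snd (q (j, l)) + e j))"
proof -
  define LS where "LS = Sigma {1..n} lead"
  define Lc where "Lc = acl ` LS"
  define Rest where "Rest = acl ` pts - Lc"
  have LSpts: "LS \<subseteq> pts" unfolding LS_def lead_def using deep_in_pts D1(1) by auto
  have inj: "inj_on acl LS"
    using lead_unique unfolding LS_def by (intro inj_onI) auto
  have "Rest \<subseteq> acl ` {x \<in> ray_system n. snd x < 2 * D1}"
  proof
    fix C assume "C \<in> Rest"
    then obtain x where x: "x \<in> pts" "C = acl x" "C \<notin> Lc" unfolding Rest_def by blast
    have xR: "x \<in> ray_system n" "fst x \<in> {1..n}" using x(1) by (auto simp: pts_def ray_system_def)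
    have "\<not> 2 * D1 \<le> snd x"
    proof
      assume "2 * D1 \<le> snd x"
      then obtain l0 where l0: "l0 \<in> lead (fst x)" "(fst x, l0) \<in> acl x" using lead_ex[OF xR(2), of "snd x"] by auto
      then have "acl x = acl (fst x, l0)" using acl_eq_iff[OF x(1) acl_pts[OF l0(2)]] by blast
      then show False using x l0(1) xR(2) unfolding Lc_def LS_def by blast
    qed
    then show "C \<in> acl ` {x \<in> ray_system n. snd x < 2 * D1}" using x(2) xR by auto
  qed
  then have finR: "finite Rest" by (rule finite_subset) (intro finite_imageI finite_core)
  define c where "c = card Rest"
  obtain \<rho> where \<rho>: "bij_betw \<rho> Rest {0..<c}" using ex_bij_betw_finite_nat[OF finR] unfolding c_def by blast
  define code where "code = (\<lambda>(j, l). (j, (if j = 1 then c else 0) + card {m \<in> lead j. m < l}))"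
  define q where "q x = (if acl x \<in> Rest then (1::nat, \<rho> (acl x)) else code (the_inv_into LS acl (acl x)))" for x
  have qL: "q x = code y" if "y \<in> LS" "acl x = acl y" for x y
    using that the_inv_into_f_f[OF inj that(1)] unfolding q_def Rest_def Lc_def by auto
  have qR: "q x = (1, \<rho> (acl x))" if "acl x \<in> Rest" for x using that unfolding q_def by simp
  have cases: "acl x \<in> Rest \<or> (\<exists>y\<in>LS. acl x = acl y)" if "x \<in> pts" for x
    using that unfolding Rest_def Lc_def by blast
  have \<rho>c: "\<rho> C < c" if "C \<in> Rest" for C using \<rho> that unfolding bij_betw_def by auto
  have code_inj: "y = y'" if y: "y \<in> LS" "y' \<in> LS" and eq: "code y = code y'" for y y'
  proof -
    obtain j l j' l' where "y = (j, l)" "y' = (j', l')" by (cases y; cases y')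
    then show ?thesis using y eq card_below_less[of l "lead j" l'] card_below_less[of l' "lead j" l]
      by (cases l l' rule: linorder_cases) (auto simp: code_def LS_def)
  qed
  have code_ge: "code y \<noteq> (1, m)" if "m < c" for y m using that by (cases y) (auto simp: code_def)
  have q_eq: "q x = q y \<longleftrightarrow> y \<in> acl x" if xy: "x \<in> pts" "y \<in> pts" for x y
  proof -
    have "q x = q y \<longleftrightarrow> acl x = acl y"
    proof
      show "acl x = acl y \<Longrightarrow> q x = q y" unfolding q_def by simp
      assume eq: "q x = q y"
      show "acl x = acl y"
      proof (cases "acl x \<in> Rest")
        case True
        then have "acl y \<in> Rest" using cases[OF xy(2)] qR[OF True] qL code_ge[OF \<rho>c[OF True]] eq by metis
        then show ?thesis using True qR eq \<rho> unfolding bij_betw_def inj_on_def by simp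
      next
        case False
        then obtain x' where x': "x' \<in> LS" "acl x = acl x'" using cases[OF xy(1)] by blast
        have "acl y \<notin> Rest" using eq qL[OF x'] qR code_ge \<rho>c by metis
        then obtain y' where y': "y' \<in> LS" "acl y = acl y'" using cases[OF xy(2)] by blast
        show ?thesis using code_inj[OF x'(1) y'(1)] eq qL[OF x'] qL[OF y'] x'(2) y'(2) by simp
      qed
    qed
    then show ?thesis using acl_eq_iff[OF xy] by simp
  qed
  have n1: "1 \<in> {1..n}" using three_le by simp
  have onto: "q ` pts = ray_system n"
  proof
    show "q ` pts \<subseteq> ray_system n"
    proof
      fix p assume "p \<in> q ` pts"
      then obtain x where x: "x \<in> pts" "p = q x" by blast
      show "p \<in> ray_system n"
      proof (cases "acl x \<in> Rest")
        case True then show ?thesis using qR[OF True] x n1 by (simp add: ray_system_def)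
      next
        case False
        then obtain y where y: "y \<in> LS" "acl x = acl y" using cases[OF x(1)] by blast
        then have "fst (q x) \<in> {1..n}" unfolding qL[OF y] by (cases y) (auto simp: code_def LS_def)
        then show ?thesis using x(2) by (cases "q x") (simp add: ray_system_def)
      qed
    qed
    show "ray_system n \<subseteq> q ` pts"
    proof
      fix p assume "p \<in> ray_system n"
      then obtain j l where p: "p = (j, l)" "j \<in> {1..n}" by (auto simp: ray_system_def)
      show "p \<in> q ` pts"
      proof (cases "j = 1 \<and> l < c")
        case True
        then have "l \<in> \<rho> ` Rest" using \<rho> unfolding bij_betw_def by simp
        then obtain x where "x \<in> pts" "acl x \<in> Rest" "\<rho> (acl x) = l" unfolding Rest_def by auto
        then show ?thesis using qR True p by (metis image_eqI)
      next
        case False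
        obtain m where m: "m \<in> lead j" "card {m' \<in> lead j. m' < m} = l - (if j = 1 then c else 0)"
          using card_below_surj[OF infinite_lead[OF p(2)]] by blast
        have y: "(j, m) \<in> LS" using m(1) p(2) unfolding LS_def by blast
        have "q (j, m) = (j, l)" using qL[OF y refl] False m(2) by (auto simp: code_def)
        then show ?thesis using p y LSpts by (metis image_eqI subsetD)
      qed
    qed
  qed
  have "fst (q (j, l)) = j \<and> q (j, l + d) = (j, snd (q (j, l)) + lead_period j)"
    if j: "j \<in> {1..n}" and l: "l \<ge> 2 * D1" for j l
  proof -
    obtain l0 where l0: "l0 \<in> lead j" "(j, l0) \<in> acl (j, l)" "l < l0 + D1" using lead_ex[OF j l] by blast
    have D: "l0 \<ge> D1" "l \<ge> D1" using l0 l by auto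
    have "(j, l) \<in> pts" "(j, l + d) \<in> pts" using D D1(1) deep_in_pts[OF j] by auto
    moreover have "(j, l0 + d) \<in> acl (j, l + d)" using acl_shift(1)[OF j D(2)] l0(2) by simp
    ultimately have eqs: "acl (j, l) = acl (j, l0)" "acl (j, l + d) = acl (j, l0 + d)"
      using acl_eq_iff acl_pts l0(2) by blast+
    have "(j, l0) \<in> LS" "(j, l0 + d) \<in> LS" using l0(1) lead_shift[OF j D(1)] j unfolding LS_def by auto
    from qL[OF this(1) eqs(1)] qL[OF this(2) eqs(2)] show ?thesis
      by (simp add: code_def card_lead_shift[OF j D(1)])
  qed
  then show ?thesis using onto q_eq by (intro exI[of _ q] exI[of _ lead_period]) blast
qed

end

text \<open>
  The map \<open>q\<close> identifies the set of classes with the ray system, in such a way that \<open>d\<close> steps on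
  ray \<open>j\<close> far out become \<open>e j\<close> steps.
\<close>

locale quotient_map = lattice_subgroup +
  fixes q :: "nat \<times> nat \<Rightarrow> nat \<times> nat" and e :: "nat \<Rightarrow> nat"
  assumes q_onto: "q ` pts = ray_system n"
    and q_eq_iff: "x \<in> pts \<Longrightarrow> y \<in> pts \<Longrightarrow> q x = q y \<longleftrightarrow> y \<in> acl x"
    and q_shift_ex: "\<exists>L. \<forall>j\<in>{1..n}. \<forall>l\<ge>L. fst (q (j, l)) = j \<and> q (j, l + d) = (j, snd (q (j, l)) + e j)"
begin

lemma q_in: "x \<in> pts \<Longrightarrow> q x \<in> ray_system n" using q_onto by blast

definition "fiber p = {x \<in> pts. q x = p}"

lemma fiber_eq_acl: assumes "x \<in> pts" shows "fiber (q x) = acl x"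
proof (rule Set.set_eqI)
  fix y show "y \<in> fiber (q x) \<longleftrightarrow> y \<in> acl x"
    unfolding fiber_def using q_eq_iff[OF assms, of y] acl_pts[of y x] by auto
qed

lemma fiber_ex: "p \<in> ray_system n \<Longrightarrow> \<exists>x\<in>pts. q x = p" unfolding q_onto[symmetric] by blast

lemma finite_fiber: "finite (fiber p)"
proof (cases "fiber p = {}")
  case False
  then obtain x where "x \<in> pts" "q x = p" unfolding fiber_def by blast
  then show ?thesis using fiber_eq_acl finite_acl by metis
qed simp

lemma finite_vimage: assumes "finite S" shows "finite {x \<in> pts. q x \<in> S}"
proof -
  have "{x \<in> pts. q x \<in> S} = (\<Union>p\<in>S. fiber p)" unfolding fiber_def by blast
  then show ?thesis using assms finite_fiber by simp
qed

definition proj :: "(nat \<times> nat \<Rightarrow> nat \<times> nat) \<Rightarrow> nat \<times> nat \<Rightarrow> nat \<times> nat" where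
  "proj g p = (if p \<in> ray_system n then q (g (SOME x. x \<in> fiber p)) else p)"

lemma proj_q: assumes "g \<in> G" "x \<in> pts" shows "proj g (q x) = q (g x)"
proof -
  let ?y = "SOME y. y \<in> fiber (q x)"
  have "?y \<in> fiber (q x)" by (rule someI[of _ x]) (use assms in \<open>simp add: fiber_def\<close>)
  then have y: "?y \<in> pts" "?y \<in> acl x" using fiber_eq_acl[OF assms(2)] unfolding fiber_def by auto
  have "g ?y \<in> acl (g x)" using acl_image[OF assms(1) y(2)] .
  then have "q (g ?y) = q (g x)" using q_eq_iff in_pts[OF assms(1)] assms(2) y(1) by metis
  then show ?thesis unfolding proj_def using q_in[OF assms(2)] by simp
qed

lemma proj_eqI: assumes "g \<in> G" "\<And>x. x \<in> pts \<Longrightarrow> q (g x) = f (q x)" "\<And>p. p \<notin> ray_system n \<Longrightarrow> f p = p"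
  shows "proj g = f"
proof
  fix p show "proj g p = f p"
  proof (cases "p \<in> ray_system n")
    case True
    then obtain x where "x \<in> pts" "q x = p" using fiber_ex by blast
    then show ?thesis using proj_q[OF assms(1)] assms(2) by metis
  next
    case False then show ?thesis using assms(3) by (simp add: proj_def)
  qed
qed

lemma proj_comp: assumes "g \<in> G" "h \<in> G" shows "proj (g \<circ> h) = proj g \<circ> proj h"
proof (rule proj_eqI[OF comp_in[OF assms]])
  fix x assume "x \<in> pts"
  then show "q ((g \<circ> h) x) = (proj g \<circ> proj h) (q x)"
    using proj_q[OF assms(1)] proj_q[OF assms(2)] in_pts[OF assms(2)] by simp
next
  fix p assume "p \<notin> ray_system n"
  then show "(proj g \<circ> proj h) p = p" by (simp add: proj_def)
qed

lemma proj_id: "proj id = id"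
  by (rule proj_eqI[OF id_in]) auto

lemma proj_in: assumes "g \<in> G" shows "proj g p \<in> ray_system n \<longleftrightarrow> p \<in> ray_system n"
proof (cases "p \<in> ray_system n")
  case True
  then obtain x where "x \<in> pts" "q x = p" using fiber_ex by blast
  then show ?thesis using proj_q[OF assms] q_in in_pts[OF assms] by metis
qed (simp add: proj_def)

lemma proj_finv: assumes "g \<in> G"
  shows "proj (finv g) \<circ> proj g = id" "proj g \<circ> proj (finv g) = id"
  using proj_comp[OF finv_in[OF assms] assms] proj_comp[OF assms finv_in[OF assms]]
    bij_finv(3,4)[OF bij_in[OF assms]] proj_id by simp_all

lemma proj_bij: "g \<in> G \<Longrightarrow> bij (proj g)"
  using proj_finv o_bij by blast

lemma finv_proj: assumes "g \<in> G" shows "finv (proj g) = proj (finv g)"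
  by (rule inv_unique_comp) (use proj_finv[OF assms] in auto)

lemma proj_permutes: assumes "g \<in> G" shows "proj g permutes ray_system n"
  using proj_bij[OF assms] proj_in[OF assms] by (auto simp: permutes_def bij_iff proj_def)

definition L0 :: nat where
  "L0 = (SOME L. \<forall>j\<in>{1..n}. \<forall>l\<ge>L. fst (q (j, l)) = j \<and> q (j, l + d) = (j, snd (q (j, l)) + e j))"

lemma q_shift:
  assumes "j \<in> {1..n}" "l \<ge> L0"
  shows "fst (q (j, l)) = j" "q (j, l + m * d) = (j, snd (q (j, l)) + m * e j)"
proof -
  have L: "\<forall>j\<in>{1..n}. \<forall>l\<ge>L0. fst (q (j, l)) = j \<and> q (j, l + d) = (j, snd (q (j, l)) + e j)"
    using someI_ex[OF q_shift_ex] unfolding L0_def .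
  then show 1: "fst (q (j, l)) = j" using assms by blast
  show "q (j, l + m * d) = (j, snd (q (j, l)) + m * e j)"
  proof (induction m)
    case 0 then show ?case using 1 by (simp add: prod_eq_iff)
  next
    case (Suc m)
    have "q (j, (l + m * d) + d) = (j, snd (q (j, l + m * d)) + e j)" using L assms by (meson trans_le_add1)
    then show ?case using Suc by (simp add: algebra_simps)
  qed
qed

text \<open>
  Fibres are finite, so the points of bounded height meet only finitely many of them.
\<close>

lemma deep_fiber:
  "\<exists>P. \<forall>j\<in>{1..n}. \<forall>p\<ge>P. \<forall>x\<in>fiber (j, p). fst x = j \<and> snd x \<ge> B"
proof -
  let ?B = "max B L0"
  let ?C = "q ` {x \<in> ray_system n. snd x < ?B}"
  have fin: "finite ?C" using finite_core by simp
  define P where "P = Suc (Max (insert 0 (snd ` ?C)))"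
  have "fst x = j \<and> snd x \<ge> B" if "j \<in> {1..n}" "p \<ge> P" "x \<in> fiber (j, p)" for j p x
  proof -
    have x: "x \<in> ray_system n" "q x = (j, p)" "fst x \<in> {1..n}"
      using that(3) unfolding fiber_def by (auto simp: pts_def ray_system_def)
    have "snd x \<ge> ?B"
    proof (rule ccontr)
      assume "\<not> ?thesis"
      then have "(j, p) \<in> ?C" using x by (metis (no_types, lifting) image_eqI mem_Collect_eq not_le)
      then have "p \<in> snd ` ?C" by (rule rev_image_eqI) simp
      then have "p \<le> Max (insert 0 (snd ` ?C))" using fin by (intro Max_ge) auto
      then show False using that(2) unfolding P_def by simp
    qed
    then show ?thesis using q_shift(1)[OF x(3), of "snd x"] x(2) by simp
  qed
  then show ?thesis by blast
qed

text \<open>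
  Otherwise a fibre would contain a whole arithmetic progression of points.
\<close>

lemma e_pos: assumes "j \<in> {1..n}" shows "e j > 0"
proof (rule ccontr)
  assume "\<not> ?thesis"
  define l where "l = L0 + D0"
  have l: "l \<ge> L0" "l \<ge> D0" by (auto simp: l_def)
  have "range (\<lambda>m. (j, l + m * d)) \<subseteq> fiber (q (j, l))"
    using q_shift[OF assms l(1)] \<open>\<not> e j > 0\<close> l(2) deep_in_pts[OF assms]
    by (auto simp: fiber_def prod_eq_iff)
  moreover have "inj (\<lambda>m. (j, l + m * d))" using d_pos by (auto simp: inj_def)
  then have "infinite (range (\<lambda>m. (j, l + m * d)))" by (rule range_inj_infinite)
  ultimately show False using finite_fiber finite_subset by blast
qed

lemma q_shift_int:
  assumes j: "j \<in> {1..n}" and l: "l \<ge> L0" "int l' = int l + int d * z" "l' \<ge> L0"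
  shows "fst (q (j, l')) = j" "int (snd (q (j, l'))) = int (snd (q (j, l))) + int (e j) * z"
proof -
  show "fst (q (j, l')) = j" using q_shift(1)[OF j l(3)] .
  show "int (snd (q (j, l'))) = int (snd (q (j, l))) + int (e j) * z"
  proof (cases "z \<ge> 0")
    case True
    then have "int l' = int (l + nat z * d)" using l(2) by (simp add: algebra_simps)
    then have "l' = l + nat z * d" unfolding of_nat_eq_iff .
    then show ?thesis using q_shift(2)[OF j l(1), of "nat z"] True by (simp add: algebra_simps)
  next
    case False
    then have "int l = int (l' + nat (- z) * d)" using l(2) by (simp add: algebra_simps)
    then have "l = l' + nat (- z) * d" unfolding of_nat_eq_iff .
    then show ?thesis using q_shift(2)[OF j l(3), of "nat (- z)"] False by (simp add: algebra_simps)
  qed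
qed

lemma proj_evt:
  assumes g: "g \<in> G" and j: "j \<in> {1..n}" and z: "trans_len g j = int d * z"
  shows "evt (proj g) j (int (e j) * z)"
proof -
  obtain L where L: "\<And>l. l \<ge> L \<Longrightarrow> fst (g (j, l)) = j \<and> int (snd (g (j, l))) = int l + trans_len g j"
    using houghton_threshold[OF in_houghton[OF g]] j by blast
  obtain P where P: "\<And>p x. p \<ge> P \<Longrightarrow> x \<in> fiber (j, p) \<Longrightarrow> fst x = j \<and> snd x \<ge> L + L0 + nat \<bar>trans_len g j\<bar>"
    using deep_fiber[of "L + L0 + nat \<bar>trans_len g j\<bar>"] j by blast
  have "fst (proj g (j, p)) = j \<and> int (snd (proj g (j, p))) = int p + int (e j) * z" if p: "p \<ge> P" for p
  proof -
    obtain x where x: "x \<in> pts" "q x = (j, p)" using fiber_ex[of "(j, p)"] j by (auto simp: ray_system_def)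
    have xf: "fst x = j" "snd x \<ge> L + L0 + nat \<bar>trans_len g j\<bar>" using P[OF p, of x] x by (auto simp: fiber_def)
    then have xj: "x = (j, snd x)" by (simp add: prod_eq_iff)
    have gx: "fst (g x) = j" "int (snd (g x)) = int (snd x) + trans_len g j"
      using L[of "snd x"] xj xf(2) by auto
    then have gx': "g x = (j, snd (g x))" by (simp add: prod_eq_iff)
    have "snd x \<ge> L0" "snd (g x) \<ge> L0" using xf(2) gx(2) by linarith+
    then have "fst (q (j, snd (g x))) = j" "int (snd (q (j, snd (g x)))) = int (snd (q (j, snd x))) + int (e j) * z"
      using q_shift_int[OF j, of "snd x" "snd (g x)" z] gx(2) z by auto
    moreover have "proj g (j, p) = q (j, snd (g x))" using proj_q[OF g x(1)] x(2) gx' by metis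
    moreover have "q (j, snd x) = (j, p)" using x(2) xj by metis
    ultimately show ?thesis by simp
  qed
  then show ?thesis unfolding evt_def by blast
qed

lemma proj_in_houghton: assumes "g \<in> G" shows "proj g \<in> carrier (houghton n)"
  unfolding houghton_carrier_iff
proof (intro conjI ballI)
  show "proj g permutes ray_system n" by (rule proj_permutes) fact
  fix j assume j: "j \<in> {1..n}"
  obtain z where "trans_len g j = int d * z" using dvd_trans_len[OF assms j] by blast
  then show "\<exists>k. evt (proj g) j k" using proj_evt[OF assms j] by blast
qed

lemma trans_len_proj:
  assumes "g \<in> G" "j \<in> {1..n}" "trans_len g j = int d * z"
  shows "trans_len (proj g) j = int (e j) * z"
  using proj_evt[OF assms] by (rule trans_len_eqI)

definition "Gam = proj ` G"

lemma Gam_subgroup: "subgroup Gam (houghton n)"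
proof -
  have "proj g \<circ> proj h \<in> Gam" if "g \<in> G" "h \<in> G" for g h
    unfolding proj_comp[OF that, symmetric] Gam_def using comp_in[OF that] by blast
  moreover have "id \<in> Gam" using proj_id id_in unfolding Gam_def by force
  moreover have "finv (proj g) \<in> Gam" if "g \<in> G" for g
    unfolding finv_proj[OF that] Gam_def using finv_in[OF that] by blast
  ultimately show ?thesis unfolding subgroup_houghton_iff using proj_in_houghton by (auto simp: Gam_def)
qed

text \<open>
  A permutation in Houghton's group has translation lengths summing to zero. Applied to the images
  of the elements \<open>gen i k\<close>, this forces all rays to be compressed by the same factor.
\<close>

lemma e_const: assumes "i \<in> {1..n}" "k \<in> {1..n}" shows "e i = e k"
proof (cases "i = k")
  case False
  have "trans_len (gen i k) j = int d * ((if j = i then 1 else 0) - (if j = k then 1 else 0))" if "j \<in> {1..n}" for j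
    using gen(2)[OF assms] that unfolding moves_def by blast
  then have "trans_len (proj (gen i k)) j = int (e j) * ((if j = i then 1 else 0) - (if j = k then 1 else 0))"
    if "j \<in> {1..n}" for j
    using trans_len_proj[OF gen(1)[OF assms]] that by blast
  then have "(\<Sum>j\<in>{1..n}. int (e j) * ((if j = i then 1 else 0) - (if j = k then 1 else 0))) = 0"
    using sum_trans_len[OF proj_in_houghton[OF gen(1)[OF assms]]] by simp
  then have "(\<Sum>j\<in>{1..n}. (if j = i then int (e j) else 0) - (if j = k then int (e j) else 0)) = 0"
    by (simp only: right_diff_distrib if_distrib[of "(*) _"] mult_1_right mult_zero_right)
  then show ?thesis using assms by (simp add: sum_subtractf)
qed simp

text \<open>
  All rays are compressed by the same factor, by \<open>e_const\<close>.
\<close>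

definition "e1 = e 1"

lemma e_eq: "j \<in> {1..n} \<Longrightarrow> e j = e1"
  unfolding e1_def by (rule e_const) (use three_le in auto)

lemma infinite_q: assumes "infinite A" "A \<subseteq> pts" shows "infinite (q ` A)"
proof
  assume "finite (q ` A)"
  then have "finite {x \<in> pts. q x \<in> q ` A}" by (rule finite_vimage)
  moreover have "A \<subseteq> {x \<in> pts. q x \<in> q ` A}" using assms(2) by blast
  ultimately show False using assms(1) finite_subset by blast
qed

lemma Gam_lattice: "lattice_subgroup n Gam e1 {}"
proof (rule lattice_subgroup.intro[OF three_le Gam_subgroup])
  show "has_moves n e1 Gam"
    unfolding has_moves_def
  proof (intro conjI ballI)
    show "e1 > 0" unfolding e1_def using e_pos three_le by simp
    fix i k assume ik: "i \<in> {1..n}" "k \<in> {1..n}"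
    have "moves n e1 i k (proj (gen i k))"
      unfolding moves_def
    proof
      fix j assume j: "j \<in> {1..n}"
      show "trans_len (proj (gen i k)) j = int e1 * ((if j = i then 1 else 0) - (if j = k then 1 else 0))"
        using trans_len_proj[OF gen(1)[OF ik] j] gen(2)[OF ik] j e_eq[OF j] unfolding moves_def by auto
    qed
    then show "\<exists>g\<in>Gam. moves n e1 i k g" using gen(1)[OF ik] unfolding Gam_def by blast
  qed
  show "int e1 dvd trans_len g j" if g: "g \<in> Gam" and j: "j \<in> {1..n}" for g j
  proof -
    obtain h where h: "h \<in> G" "g = proj h" using g unfolding Gam_def by blast
    obtain z where "trans_len h j = int d * z" using dvd_trans_len[OF h(1) j] by blast
    then have "trans_len g j = int e1 * z" using trans_len_proj[OF h(1) j] unfolding h(2) e_eq[OF j] by blast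
    then show ?thesis by simp
  qed
  show "infinite (orb Gam p)" if "p \<in> ray_system n - {}" for p
  proof -
    obtain x where x: "x \<in> pts" "q x = p" using fiber_ex \<open>p \<in> _\<close> by blast
    then have "infinite (q ` orb G x)" using infinite_orb infinite_q orb_subset[OF x(1)] unfolding pts_def by blast
    moreover have "q ` orb G x \<subseteq> orb Gam p"
    proof
      fix r assume "r \<in> q ` orb G x"
      then obtain g where "g \<in> G" "r = q (g x)" unfolding orb_def by blast
      then have "r = proj g p" "proj g \<in> Gam" using proj_q[of g x] x unfolding Gam_def by auto
      then show "r \<in> orb Gam p" unfolding orb_def by blast
    qed
    ultimately show ?thesis using finite_subset by blast
  qed
qed auto

text \<open>
  For \<open>y \<notin> acl x\<close> the orbit of \<open>y\<close> under the stabiliser of \<open>x\<close> is infinite, and \<open>q\<close> maps infinite sets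
  to infinite sets because its fibres are finite.
\<close>

lemma Gam_acl_trivial:
  assumes "p \<in> ray_system n" "p' \<in> ray_system n" "p \<noteq> p'"
  shows "infinite (orb (fixing Gam {p}) p')"
proof -
  obtain x y where x: "x \<in> pts" "q x = p" and y: "y \<in> pts" "q y = p'" using fiber_ex assms by metis
  have "y \<notin> acl x" using q_eq_iff[OF x(1) y(1)] assms(3) x(2) y(2) by simp
  then have inf: "infinite (orb (fixing G {x}) y)" using y(1) unfolding acl_def by blast
  have "orb (fixing G {x}) y \<subseteq> pts" using in_pts y(1) unfolding orb_def fixing_def by blast
  then have "infinite (q ` orb (fixing G {x}) y)" using inf infinite_q by blast
  moreover have "q ` orb (fixing G {x}) y \<subseteq> orb (fixing Gam {p}) p'"
  proof
    fix r assume "r \<in> q ` orb (fixing G {x}) y"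
    then obtain g where g: "g \<in> G" "g x = x" "r = q (g y)" unfolding orb_def fixing_def by blast
    have "proj g p = p" "r = proj g p'" using proj_q[OF g(1)] x y g by metis+
    then show "r \<in> orb (fixing Gam {p}) p'" using g(1) unfolding orb_def fixing_def Gam_def by blast
  qed
  ultimately show ?thesis using finite_subset by blast
qed

end

section \<open>Three-cycles\<close>

text \<open>
  B. H. Neumann's separation lemma. Let \<open>a \<in> A\<close>. If moving \<open>A - {a}\<close> away from larger and larger
  finite sets always leaves the image of \<open>a\<close> inside \<open>S\<close>, then this image can be taken to be one
  fixed point \<open>s\<close>; an element moving \<open>s\<close> out of \<open>S\<close> then finishes the job.
\<close>

lemma separation:
  assumes comp: "\<And>g h. g \<in> G \<Longrightarrow> h \<in> G \<Longrightarrow> g \<circ> h \<in> G" and "id \<in> G"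
    and inv: "\<And>g. g \<in> G \<Longrightarrow> finv g \<in> G" and inj: "\<And>g. g \<in> G \<Longrightarrow> inj g"
    and "finite A" "finite S" and "\<And>a. a \<in> A \<Longrightarrow> infinite (orb G a)"
  shows "\<exists>g\<in>G. g ` A \<inter> S = {}"
  using \<open>finite A\<close> \<open>finite S\<close> assms(7)
proof (induction A arbitrary: S rule: finite_induct)
  case empty then show ?case using \<open>id \<in> G\<close> by blast
next
  case (insert a A)
  show ?case
  proof (rule ccontr)
    assume none: "\<not> ?thesis"
    have "\<exists>s\<in>S. \<forall>S'. finite S' \<longrightarrow> (\<exists>g\<in>G. g a = s \<and> g ` A \<inter> S' = {})"
    proof (rule ccontr)
      assume "\<not> ?thesis"
      then have "\<forall>s\<in>S. \<exists>S'. finite S' \<and> (\<forall>g\<in>G. g a = s \<longrightarrow> g ` A \<inter> S' \<noteq> {})" by simp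
      from bchoice[OF this]
      obtain F where F: "\<forall>s\<in>S. finite (F s) \<and> (\<forall>g\<in>G. g a = s \<longrightarrow> g ` A \<inter> F s \<noteq> {})" ..
      then have "finite (S \<union> (\<Union>s\<in>S. F s))" using insert.prems(1) by blast
      from insert.IH[OF this] insert.prems(2)
      obtain g where g: "g \<in> G" "g ` A \<inter> (S \<union> (\<Union>s\<in>S. F s)) = {}" by auto
      have "g ` A \<inter> F (g a) \<noteq> {}" if "g a \<in> S" using F that g(1) by simp
      moreover have "g ` A \<inter> F (g a) = {}" if "g a \<in> S" using g(2) that by blast
      ultimately have "g a \<notin> S" by blast
      then have "g ` insert a A \<inter> S = {}" using g(2) by auto
      from this g(1) have "\<exists>g\<in>G. g ` insert a A \<inter> S = {}" by (rule bexI)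
      with none show False by contradiction
    qed
    \<comment> \<open>One point \<open>s\<close> works for all finite sets: otherwise the union of \<open>S\<close> and of counterexamples for all \<open>s \<in> S\<close> contradicts the induction hypothesis.\<close>
    then obtain s where s: "s \<in> S" "\<And>S'. finite S' \<Longrightarrow> \<exists>g\<in>G. g a = s \<and> g ` A \<inter> S' = {}" by auto
    obtain g0 where g0: "g0 \<in> G" "g0 a = s" using s(2)[of "{}"] by auto
    have "\<exists>h\<in>G. h s \<notin> S"
    proof (rule ccontr)
      assume *: "\<not> ?thesis"
      have "orb G a \<subseteq> S"
      proof
        fix z assume "z \<in> orb G a"
        then obtain g where "g \<in> G" "z = g a" unfolding orb_def by blast
        moreover have "a = finv g0 s" using inv_f_f[OF inj[OF g0(1)], of a] unfolding g0(2) by (rule sym)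
        ultimately have "z = (g \<circ> finv g0) s" "g \<circ> finv g0 \<in> G" using comp inv g0(1) by auto
        then show "z \<in> S" using * by blast
      qed
      then show False using insert.prems finite_subset by blast
    qed
    then obtain h where h: "h \<in> G" "h s \<notin> S" by blast
    have "finite {x. h x \<in> S}" using finite_vimageI[OF insert.prems(1) inj[OF h(1)]] by (simp add: vimage_def)
    then obtain g where g: "g \<in> G" "g a = s" "g ` A \<inter> {x. h x \<in> S} = {}" using s(2)[of "{x. h x \<in> S}"] by auto
    have "(h \<circ> g) ` insert a A \<inter> S = {}" using g h by auto
    from this comp[OF h(1) g(1)] have "\<exists>g\<in>G. g ` insert a A \<inter> S = {}" by (rule bexI)
    with none show False by contradiction
  qed
qed

definition cyc :: "'a \<Rightarrow> 'a \<Rightarrow> 'a \<Rightarrow> 'a \<Rightarrow> 'a" where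
  "cyc x y z w = (if w = x then y else if w = y then z else if w = z then x else w)"

abbreviation "distinct3 x y z \<equiv> x \<noteq> y \<and> y \<noteq> z \<and> x \<noteq> z"

lemma cyc_rotate: "distinct3 x y z \<Longrightarrow> cyc x y z = cyc y z x"
  by (auto simp: cyc_def fun_eq_iff)

lemma cyc_inverse: "distinct3 x y z \<Longrightarrow> cyc x z y \<circ> cyc x y z = id"
  by (auto simp: cyc_def fun_eq_iff)

lemma finv_cyc: "distinct3 x y z \<Longrightarrow> finv (cyc x y z) = cyc x z y"
  by (rule inv_unique_comp) (auto simp: cyc_inverse)

lemma cyc_conj: assumes "bij g" shows "g \<circ> cyc x y z \<circ> finv g = cyc (g x) (g y) (g z)"
proof
  fix w
  have "finv g w = v \<longleftrightarrow> w = g v" for v using bij_finv[OF assms] by metis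
  then show "(g \<circ> cyc x y z \<circ> finv g) w = cyc (g x) (g y) (g z) w"
    using bij_finv(2)[OF assms] by (auto simp: cyc_def)
qed

text \<open>Away from the common point of the supports and its images, each of \<open>f\<close> and \<open>f'\<close> is undone by its own inverse.\<close>

lemma commutator_cyc:
  assumes f: "bij f" and f': "bij f'" and meet: "\<And>w. f w \<noteq> w \<Longrightarrow> f' w \<noteq> w \<Longrightarrow> w = x" and x: "f x \<noteq> x" "f' x \<noteq> x"
  shows "f \<circ> f' \<circ> finv f \<circ> finv f' = cyc x (f x) (f' x)" and "distinct3 x (f x) (f' x)"
proof -
  have i: "finv f w = v \<longleftrightarrow> w = f v" "finv f' w = v \<longleftrightarrow> w = f' v" for w v
    using bij_finv[OF f] bij_finv[OF f'] by metis+
  have j: "f u = f v \<longleftrightarrow> u = v" "f' u = f' v \<longleftrightarrow> u = v" for u v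
    using f f' by (metis bij_pointE)+
  have ff: "f' (f x) = f x" "f (f' x) = f' x" using meet[of "f x"] meet[of "f' x"] x j by metis+
  show d: "distinct3 x (f x) (f' x)" using x ff j by metis
  show "f \<circ> f' \<circ> finv f \<circ> finv f' = cyc x (f x) (f' x)"
  proof
    fix w
    define a where "a = finv f' w"
    define b where "b = finv f a"
    have ab: "w = f' a" "a = f b" using a_def b_def i by metis+
    have "f (f' b) = cyc x (f x) (f' x) w"
    proof (cases "w = x")
      case True
      have "f a = a" using meet[of a] ab True x j by metis
      then have "b = a" using ab j by metis
      then show ?thesis using ab True by (simp add: cyc_def)
    next
      case wx: False
      show ?thesis
      proof (cases "w = f x")
        case True
        then have "a = f x" using ab ff j by metis
        then have "b = x" using ab j by metis
        then show ?thesis using True ff d x by (simp add: cyc_def)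
      next
        case wfx: False
        show ?thesis
        proof (cases "w = f' x")
          case True
          then have a: "a = x" using ab j by metis
          have "b \<noteq> x" using a ab x by metis
          then have "f' b = b" using meet[of b] a ab x by metis
          moreover have "f' x \<noteq> f x" "f' x \<noteq> x" using d by metis+
          ultimately show ?thesis using True a ab by (simp add: cyc_def)
        next
          case False
          have "f (f' b) = w"
          proof (cases "f' w = w")
            case True
            then have "a = w" using ab j by metis
            moreover have "b \<noteq> x" using calculation ab wfx by metis
            ultimately have "f' b = b \<or> f b = b" using meet[of b] by metis
            then show ?thesis using True ab \<open>a = w\<close> j by metis
          next
            case nf: False
            have "a \<noteq> x" using ab False by metis
            have "f' a \<noteq> a" using ab nf by metis
            then have "f a = a" using meet[of a] \<open>a \<noteq> x\<close> by metis
            then have "b = a" using ab j by metis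
            have "f w = w" using meet[of w] wx nf by metis
            then show ?thesis using ab \<open>b = a\<close> by metis
          qed
          then show ?thesis using wx wfx False by (simp add: cyc_def)
        qed
      qed
    qed
    then show "(f \<circ> f' \<circ> finv f \<circ> finv f') w = cyc x (f x) (f' x) w" by (simp add: a_def b_def)
  qed
qed

locale primitive_lattice = lattice_subgroup n G d "{}" for n G d +
  assumes acl_trivial: "p \<in> ray_system n \<Longrightarrow> p' \<in> ray_system n \<Longrightarrow> p \<noteq> p' \<Longrightarrow> infinite (orb (fixing G {p}) p')"
begin

lemma pts_eq: "pts = ray_system n" by (simp add: pts_def)

text \<open>
  An infinite block meets some ray in an infinite set, so it is preserved by every element fixing
  this ray far out. These elements spread the block over all rays; and two of the groups
  \<open>{g. trans_len g j = 0}\<close> generate \<open>G\<close>.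
\<close>

lemma block_contains_orbit:
  assumes B: "B \<subseteq> ray_system n" and block: "\<And>g. g \<in> G \<Longrightarrow> g ` B = B \<or> g ` B \<inter> B = {}"
    and xy: "x \<in> B" "y \<in> B" "x \<noteq> y"
  shows "orb G x \<subseteq> B"
proof -
  have same: "g ` B = B" if "g \<in> G" "b \<in> B" "g b \<in> B" for g b using block[OF that(1)] that by blast
  have "orb (fixing G {x}) y \<subseteq> B"
  proof
    fix z assume "z \<in> orb (fixing G {x}) y"
    then obtain g where g: "g \<in> G" "g x = x" "z = g y" unfolding orb_def fixing_def by blast
    then have "g ` B = B" using same[OF g(1) xy(1)] xy(1) by simp
    then show "z \<in> B" using g(3) xy(2) by blast
  qed
  then have infB: "infinite B" using acl_trivial[of x y] xy B finite_subset by blast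
  define far where "far j \<longleftrightarrow> (\<forall>L. \<exists>l\<ge>L. (j, l) \<in> B)" for j
  have "\<exists>j\<in>{1..n}. far j"
  proof (rule ccontr)
    assume "\<not> ?thesis"
    then have "\<forall>j\<in>{1..n}. \<exists>L. \<forall>l\<ge>L. (j, l) \<notin> B" unfolding far_def by blast
    then obtain L where L: "\<And>j l. j \<in> {1..n} \<Longrightarrow> l \<ge> L j \<Longrightarrow> (j, l) \<notin> B" by metis
    obtain j l where jl: "j \<in> {1..n}" "l \<ge> Max (L ` {1..n})" "(j, l) \<in> B"
      using infinite_orb_meets[OF infB B] by blast
    have "L j \<le> Max (L ` {1..n})" using jl(1) by simp
    then show False using L[OF jl(1), of l] jl by simp
  qed
  then obtain j where j: "j \<in> {1..n}" "far j" by blast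
  have stab: "g ` B = B" if s: "j \<in> {1..n}" "far j" "g \<in> G" "trans_len g j = 0" for g j
  proof -
    obtain L where L: "\<And>l. l \<ge> L \<Longrightarrow> fst (g (j, l)) = j \<and> int (snd (g (j, l))) = int l + trans_len g j"
      using houghton_threshold[OF in_houghton[OF s(3)]] s(1) by blast
    obtain l where l: "l \<ge> L" "(j, l) \<in> B" using s(2) unfolding far_def by blast
    have "g (j, l) = (j, l)" using L[OF l(1)] s(4) by (simp add: prod_eq_iff)
    then show ?thesis using same[OF s(3) l(2)] l(2) by simp
  qed
  obtain i where i: "i \<in> {1..n}" "i \<noteq> j" using ex_other by blast
  obtain k where k: "k \<in> {1..n}" "k \<noteq> i" "k \<noteq> j" using ex_other by blast
  have "far i"
    unfolding far_def
  proof
    fix L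
    have "x \<in> pts" using xy(1) B pts_eq by blast
    then obtain g l where g: "g \<in> G" "trans_len g j = 0" "l \<ge> D0" "g x = (i, l)" using reach[OF \<open>x \<in> pts\<close> i(1) j(1) i(2)] by blast
    let ?h = "gen i k ^^ L"
    have h: "?h \<in> G" using gen_pow_in i k by blast
    have "trans_len ?h j = 0" using trans_len_gen_pow[OF i(1) k(1) j(1)] i k by simp
    then have "g ` B = B" "?h ` B = B" using stab[OF j g(1,2)] stab[OF j h] by auto
    then have "(i, l) \<in> B" using imageI[OF xy(1), of g] g(4) by simp
    then have "?h (i, l) \<in> B" using imageI[of "(i, l)" B ?h] \<open>?h ` B = B\<close> by simp
    moreover have "?h (i, l) = (i, l + L * d)" using gen_up_pow[OF i(1) k(1) _ g(3)] k by simp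
    moreover have "l + L * d \<ge> L" using d_pos by (cases d) auto
    ultimately show "\<exists>l\<ge>L. (i, l) \<in> B" by auto
  qed
  have "g ` B = B" if g: "g \<in> G" for g
  proof -
    obtain z where z: "trans_len g j = int d * z" using dvd_trans_len[OF g j(1)] by blast
    define v where "v = (if z \<ge> 0 then gen j k ^^ nat z else gen k j ^^ nat (- z))"
    have v: "v \<in> G" unfolding v_def using gen_pow_in k j by simp
    have "trans_len v i = 0" "trans_len v j = int d * z"
      unfolding v_def using trans_len_gen_pow k j i by simp_all
    moreover have "trans_len (g \<circ> finv v) j = trans_len g j - trans_len v j"
      using trans_len_comp[OF in_houghton[OF g] in_houghton[OF finv_in[OF v]] j(1)]
        trans_len_inv[OF in_houghton[OF v] j(1)] by simp
    ultimately have "v ` B = B" "(g \<circ> finv v) ` B = B"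
      using stab[OF i(1) \<open>far i\<close> v] stab[OF j comp_in[OF g finv_in[OF v]]] z by auto
    moreover have "(g \<circ> finv v) ` (v ` B) = g ` B"
      using bij_finv(1)[OF bij_in[OF v]] by (simp add: image_image)
    ultimately show ?thesis by simp
  qed
  then show ?thesis using xy(1) unfolding orb_def by blast
qed

text \<open>
  A commutator has no translation, so it is finitary. Move \<open>x\<close> to a point of ray \<open>1\<close> fixed by
  \<open>?a = gen 2 3\<close>, and let \<open>h\<close> move this point to ray \<open>2\<close>, where \<open>?a\<close> has no fixed points far out.
  Then \<open>h\<close> and \<open>?a\<close> do not commute at this point.
\<close>

lemma finitary_mover:
  assumes x: "x \<in> ray_system n"
  shows "\<exists>f\<in>G. finite {w. f w \<noteq> w} \<and> f x \<noteq> x"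
proof -
  have n1: "(1::nat) \<in> {1..n}" "2 \<in> {1..n}" "3 \<in> {1..n}" using three_le by auto
  obtain g l where g: "g \<in> G" "l \<ge> D0" "g x = (1, l)" using reach[of x 1 2] x n1 pts_eq by auto
  have "(1, l) \<in> pts" using deep_in_pts n1 g by blast
  then obtain h l' where h: "h \<in> G" "l' \<ge> D0" "h (1, l) = (2, l')" using reach[of "(1, l)" 2 1] n1 by auto
  let ?a = "gen 2 3"
  have a: "?a \<in> G" using gen n1 by blast
  let ?c = "finv h \<circ> (?a \<circ> (h \<circ> finv ?a))"
  have c: "?c \<in> G" using comp_in finv_in a h(1) by simp
  have "?a (1, l) = (1, l)" using gen_fix n1 g(2) by simp
  then have "finv ?a (1, l) = (1, l)" using bij_finv(1)[OF bij_in[OF a]] by metis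
  moreover have "?a (2, l') = (2, l' + d)" using gen_up n1 h(2) by simp
  ultimately have "?c (1, l) = finv h (2, l' + d)" using h(3) by simp
  moreover have "finv h (2, l' + d) \<noteq> (1, l)"
    using h(3) bij_finv(2)[OF bij_in[OF h(1)], of "(2, l' + d)"] d_pos by auto
  ultimately have cx: "?c (1, l) \<noteq> (1, l)" by metis
  have "trans_len ?c j = 0" if j: "j \<in> {1..n}" for j
    using trans_len_comp[OF in_houghton in_houghton j] trans_len_inv[OF in_houghton j] comp_in finv_in a h(1) by simp
  then have fin: "finite {w. ?c w \<noteq> w}" using finite_support_if_trans_len_zero[OF in_houghton[OF c]] by blast
  let ?f = "finv g \<circ> (?c \<circ> g)"
  have gb: "bij g" using bij_in g by blast
  have "?f \<in> G" using comp_in finv_in c g(1) by simp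
  moreover have "{w. ?f w \<noteq> w} \<subseteq> finv g ` {w. ?c w \<noteq> w}"
  proof
    fix w assume "w \<in> {w. ?f w \<noteq> w}"
    have "?c (g w) \<noteq> g w"
    proof
      assume "?c (g w) = g w"
      then have "?f w = finv g (g w)" by simp
      then show False using \<open>w \<in> {w. ?f w \<noteq> w}\<close> bij_finv(1)[OF gb, of w] by simp
    qed
    then show "w \<in> finv g ` {w. ?c w \<noteq> w}" using bij_finv(1)[OF gb, of w] by (metis (mono_tags, lifting) image_eqI mem_Collect_eq)
  qed
  then have "finite {w. ?f w \<noteq> w}" using fin finite_subset by blast
  moreover have "?f x \<noteq> x"
  proof
    assume "?f x = x"
    then have "g (?f x) = g x" by simp
    then have "?c (g x) = g x" using bij_finv(2)[OF gb] by simp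
    then show False using cx g(3) by simp
  qed
  ultimately show ?thesis by blast
qed

definition "three_cycle x y z \<longleftrightarrow> distinct3 x y z \<and> cyc x y z \<in> G"

lemma three_cycle_rotate: "three_cycle x y z \<Longrightarrow> three_cycle y z x"
  unfolding three_cycle_def using cyc_rotate[of x y z] by auto

lemma three_cycle_inverse: "three_cycle x y z \<Longrightarrow> three_cycle x z y"
  unfolding three_cycle_def using finv_in finv_cyc[of x y z] by metis

lemma three_cycle_swap: "three_cycle x y z \<Longrightarrow> three_cycle y x z"
  using three_cycle_inverse three_cycle_rotate by blast

lemma three_cycle_conj: assumes "g \<in> G" "three_cycle x y z" shows "three_cycle (g x) (g y) (g z)"
proof -
  have "g \<circ> cyc x y z \<circ> finv g \<in> G" using assms comp_in finv_in unfolding three_cycle_def by blast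
  then show ?thesis using cyc_conj[OF bij_in[OF assms(1)]] assms inj_in[OF assms(1)] unfolding three_cycle_def by simp
qed

text \<open>
  By the separation lemma, applied to the stabiliser of \<open>x\<close>, a finitary permutation moving \<open>x\<close>
  has a conjugate whose support meets its own support in \<open>x\<close> only.
\<close>

lemma ex_three_cycle:
  assumes x: "x \<in> ray_system n"
  shows "\<exists>y z. three_cycle x y z"
proof -
  obtain f where f: "f \<in> G" "finite {w. f w \<noteq> w}" "f x \<noteq> x" using finitary_mover[OF x] by blast
  let ?S = "{w. f w \<noteq> w}"
  note F = fixing_subgroup[OF sub, of "{x}"]
  have SR: "?S \<subseteq> ray_system n" using permutes_not_in[OF houghton_permutes[OF in_houghton[OF f(1)]]] by blast
  have "\<exists>g\<in>fixing G {x}. g ` (?S - {x}) \<inter> ?S = {}"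
  proof (rule separation)
    show "infinite (orb (fixing G {x}) a)" if "a \<in> ?S - {x}" for a
      using acl_trivial[OF x, of a] that SR by blast
    show "inj g" if "g \<in> fixing G {x}" for g
      using bij_is_inj subgroup_houghtonD(5)[OF F that] .
  qed (use subgroup_houghtonD[OF F] f(2) in auto)
  then obtain g where g: "g \<in> G" "g x = x" "g ` (?S - {x}) \<inter> ?S = {}" unfolding fixing_def by blast
  let ?f' = "g \<circ> (f \<circ> finv g)"
  have gb: "bij g" using bij_in g by blast
  have f': "?f' \<in> G" using comp_in finv_in f g by simp
  have supp: "w \<in> g ` ?S" if "?f' w \<noteq> w" for w
  proof -
    have "f (finv g w) \<noteq> finv g w"
      using that bij_finv(2)[OF gb, of w] by (metis comp_apply)
    then show ?thesis using bij_finv(2)[OF gb, of w] by (metis (mono_tags, lifting) image_eqI mem_Collect_eq)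
  qed
  have "finv g x = x" using bij_finv(1)[OF gb, of x] g(2) by simp
  then have f'x: "?f' x \<noteq> x" using f(3) g(2) inj_in[OF g(1), of "f x" x] by simp
  have meet: "w = x" if "f w \<noteq> w" "?f' w \<noteq> w" for w
    using supp[OF that(2)] g(2,3) that(1) by auto
  have "f \<circ> ?f' \<circ> finv f \<circ> finv ?f' \<in> G" using comp_in finv_in f(1) f' by blast
  have cc: "f \<circ> ?f' \<circ> finv f \<circ> finv ?f' = cyc x (f x) (?f' x)" "distinct3 x (f x) (?f' x)"
    by (rule commutator_cyc[OF bij_in[OF f(1)] bij_in[OF f'] _ f(3) f'x]; rule meet; assumption)+
  have "three_cycle x (f x) (?f' x)"
    using \<open>f \<circ> ?f' \<circ> finv f \<circ> finv ?f' \<in> G\<close> unfolding three_cycle_def cc(1) using cc(2) by blast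
  then show ?thesis by blast
qed

text \<open>
  Conjugate the first three-cycle by the second one or by its inverse, according to the position
  of \<open>v\<close>, so that \<open>z\<close> is replaced by \<open>w\<close>.
\<close>

lemma three_cycle_exchange:
  assumes "three_cycle x y z" "three_cycle z w v" "w \<noteq> x" "w \<noteq> y"
  shows "three_cycle x y w"
proof -
  have d: "distinct3 x y z" "distinct3 z w v" "distinct3 z y x" "distinct3 v w z" using assms unfolding three_cycle_def by auto
  have c: "cyc z w v \<in> G" "cyc z v w \<in> G" using assms(2) three_cycle_inverse unfolding three_cycle_def by blast+
  consider "v \<noteq> x" "v \<noteq> y" | "v = x" | "v = y" by blast
  then show ?thesis
  proof cases
    case 1
    then show ?thesis using three_cycle_conj[OF c(1) assms(1)] d assms(3,4) by (simp add: cyc_def)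
  next
    case 2
    then have "three_cycle w y x" using three_cycle_conj[OF c(2) assms(1)] d assms(3,4) by (simp add: cyc_def)
    then show ?thesis using three_cycle_rotate three_cycle_inverse by blast
  next
    case 3
    then have "three_cycle x w y" using three_cycle_conj[OF c(2) assms(1)] d assms(3,4) by (simp add: cyc_def)
    then show ?thesis by (rule three_cycle_inverse)
  qed
qed

lemma three_cycle_points: assumes "three_cycle x y z" shows "y \<in> orb G x" "z \<in> orb G x" "x \<in> ray_system n"
proof -
  have c: "cyc x y z \<in> G" "cyc x z y \<in> G" using assms three_cycle_inverse unfolding three_cycle_def by blast+
  have y: "cyc x y z x = y" and "cyc x z y x = z" by (auto simp: cyc_def)
  then show "y \<in> orb G x" "z \<in> orb G x" using c unfolding orb_def by (metis image_eqI)+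
  show "x \<in> ray_system n" using permutes_not_in[OF houghton_permutes[OF in_houghton[OF c(1)]], of x] y assms
    unfolding three_cycle_def by metis
qed

text \<open>
  Being moved into each other by a three-cycle in \<open>G\<close> is an equivalence relation; its classes are
  blocks with more than one point.
\<close>

lemma three_cycle_if_same_orbit:
  assumes x: "x \<in> ray_system n" and y: "y \<in> orb G x" "y \<noteq> x"
  shows "\<exists>z. three_cycle x y z"
proof -
  define C where "C x = insert x {y. \<exists>z. three_cycle x y z}" for x
  have C_sym: "x \<in> C y" if "y \<in> C x" for x y using that three_cycle_swap unfolding C_def by blast
  have C_trans: "w \<in> C x" if xy: "y \<in> C x" and yw: "w \<in> C y" for x y w
  proof (cases "w = x \<or> y = x \<or> w = y")
    case False
    then obtain z v where T: "three_cycle x y z" "three_cycle y w v" using xy yw unfolding C_def by blast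
    show ?thesis
    proof (cases "w = z")
      case True then show ?thesis using three_cycle_inverse[OF T(1)] unfolding C_def by blast
    next
      case False
      have "three_cycle z x w" using three_cycle_exchange[OF three_cycle_rotate[OF three_cycle_rotate[OF T(1)]] T(2)] False \<open>\<not> (w = x \<or> y = x \<or> w = y)\<close> by blast
      then show ?thesis using three_cycle_rotate unfolding C_def by blast
    qed
  qed (use xy yw in \<open>auto simp: C_def\<close>)
  have C_img: "g ` C x = C (g x)" if g: "g \<in> G" for g x
  proof
    show "g ` C x \<subseteq> C (g x)" for x using three_cycle_conj[OF g] unfolding C_def by blast
    show "C (g x) \<subseteq> g ` C x"
    proof
      fix w assume "w \<in> C (g x)"
      then have "finv g w \<in> C (finv g (g x))" using three_cycle_conj[OF finv_in[OF g]] unfolding C_def by blast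
      then show "w \<in> g ` C x" using bij_finv(1,2)[OF bij_in[OF g]] by (metis image_eqI)
    qed
  qed
  have "orb G x \<subseteq> C x"
  proof -
    obtain y z where T: "three_cycle x y z" using ex_three_cycle[OF x] by blast
    show ?thesis
    proof (rule block_contains_orbit)
      show "C x \<subseteq> ray_system n" using three_cycle_points(3) three_cycle_swap x unfolding C_def by blast
      show "g ` C x = C x \<or> g ` C x \<inter> C x = {}" if "g \<in> G" for g
        unfolding C_img[OF that] using C_sym C_trans by blast
      show "x \<in> C x" "y \<in> C x" unfolding C_def using T by blast+
      show "x \<noteq> y" using T unfolding three_cycle_def by blast
    qed
  qed
  then show ?thesis using y unfolding C_def by blast
qed

theorem three_cycles_in:
  assumes "x \<in> ray_system n" "y \<in> orb G x" "z \<in> orb G x" "distinct3 x y z"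
  shows "cyc x y z \<in> G"
proof -
  obtain w where w: "three_cycle x y w" using three_cycle_if_same_orbit assms by metis
  have "three_cycle x y z"
  proof (cases "z = w")
    case False
    have zO: "z \<in> orb G w"
    proof -
      obtain g h where g: "g \<in> G" "w = g x" and h: "h \<in> G" "z = h x"
        using three_cycle_points(2)[OF w] assms(3) unfolding orb_def by blast
      have "z = (h \<circ> finv g) w" using g h bij_finv(1)[OF bij_in[OF g(1)]] by simp
      then show ?thesis using comp_in[OF h(1) finv_in[OF g(1)]] unfolding orb_def by blast
    qed
    have "w \<in> ray_system n" using three_cycle_points(3) three_cycle_rotate[OF three_cycle_rotate[OF w]] by blast
    then obtain v where "three_cycle w z v" using three_cycle_if_same_orbit zO False by metis
    then show ?thesis using three_cycle_exchange[OF w] assms(4) by metis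
  qed (use w in simp)
  then show ?thesis unfolding three_cycle_def by blast
qed

end

lemma cyc_mult: "distinct3 x y w \<Longrightarrow> distinct3 x y w' \<Longrightarrow> w \<noteq> w' \<Longrightarrow> cyc x w y \<circ> cyc x y w' = cyc y w' w"
  by (auto simp: cyc_def fun_eq_iff)

lemma cyc_square: "distinct3 x y z \<Longrightarrow> cyc x y z \<circ> cyc x y z = cyc x z y"
  by (auto simp: cyc_def fun_eq_iff)

context lattice_subgroup begin

lemma orb_self: "x \<in> orb G x"
  unfolding orb_def by (rule image_eqI[OF _ id_in]) simp

lemma orb_eq: assumes "y \<in> orb G x" shows "orb G y = orb G x"
proof -
  obtain g where g: "g \<in> G" "y = g x" using assms unfolding orb_def by blast
  have x: "x = finv g y" using bij_finv(1)[OF bij_in[OF g(1)]] g(2) by simp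
  have "orb G (h w) \<subseteq> orb G w" if "h \<in> G" for h w
  proof
    fix z assume "z \<in> orb G (h w)"
    then obtain k where "k \<in> G" "z = (k \<circ> h) w" unfolding orb_def by auto
    then show "z \<in> orb G w" using comp_in[OF _ that] unfolding orb_def by blast
  qed
  then show ?thesis using g x finv_in by (metis subset_antisym)
qed

lemma orb_meets_core:
  assumes "x \<in> pts" shows "\<exists>y\<in>orb G x. snd y < D0 + d"
proof -
  have n1: "(1::nat) \<in> {1..n}" "2 \<in> {1..n}" using three_le by auto
  obtain g l where g: "g \<in> G" "l \<ge> D0" "g x = (1, l)" using reach[OF assms n1] by auto
  define c where "c = (l - D0) div d"
  define r where "r = D0 + (l - D0) mod d"
  have r: "l = r + c * d" "r \<ge> D0" "r < D0 + d"
    using g(2) d_pos by (auto simp: r_def c_def algebra_simps)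
  let ?h = "gen 2 1 ^^ c"
  have "?h (1, l) = (1, r)" using gen_down_pow[OF n1(2,1) _ r(2), of c] r(1) by simp
  then have "(?h \<circ> g) x = (1, r)" using g(3) by simp
  moreover have "?h \<circ> g \<in> G" using comp_in gen_pow_in n1 g(1) by blast
  ultimately have "(1, r) \<in> orb G x" unfolding orb_def by (metis image_eqI)
  then show ?thesis using r(3) by force
qed

end

section \<open>Lifting three-cycles\<close>

sublocale quotient_map \<subseteq> Gam: primitive_lattice n Gam e1
  by (intro primitive_lattice.intro Gam_lattice primitive_lattice_axioms.intro Gam_acl_trivial)

context quotient_map begin

lemma Gam_lift: "\<gamma> \<in> Gam \<Longrightarrow> \<exists>g\<in>G. proj g = \<gamma>" unfolding Gam_def by blast

lemma proj_in_Gam: "g \<in> G \<Longrightarrow> proj g \<in> Gam" unfolding Gam_def by blast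

lemma q_image: assumes "g \<in> G" "x \<in> fiber b" shows "g x \<in> fiber (proj g b)"
  using assms(2) proj_q[OF assms(1), of x] in_pts[OF assms(1), of x] unfolding fiber_def by simp

definition "lifts S a b c \<longleftrightarrow> distinct3 a b c \<and> (\<exists>g\<in>G. proj g = cyc a b c \<and> (\<forall>p\<in>pts. q p \<in> S \<longrightarrow> g p = p))"

lemma lifts_rotate: "lifts S a b c \<Longrightarrow> lifts S b c a"
  unfolding lifts_def using cyc_rotate[of a b c] by auto

lemma lifts_conj:
  assumes "lifts S a b c" "h \<in> G" "\<And>s. s \<in> S \<Longrightarrow> proj h s = s"
  shows "lifts S (proj h a) (proj h b) (proj h c)"
proof -
  obtain g where g: "g \<in> G" "proj g = cyc a b c" "\<And>p. p \<in> pts \<Longrightarrow> q p \<in> S \<Longrightarrow> g p = p" and d: "distinct3 a b c"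
    using assms(1) unfolding lifts_def by blast
  let ?g = "h \<circ> (g \<circ> finv h)"
  have G: "?g \<in> G" using comp_in finv_in g(1) assms(2) by blast
  have "proj ?g = proj h \<circ> cyc a b c \<circ> finv (proj h)"
    unfolding proj_comp[OF assms(2) comp_in[OF g(1) finv_in[OF assms(2)]]] proj_comp[OF g(1) finv_in[OF assms(2)]]
      g(2) finv_proj[OF assms(2)] by (simp only: comp_assoc)
  then have pr: "proj ?g = cyc (proj h a) (proj h b) (proj h c)"
    using cyc_conj[OF proj_bij[OF assms(2)]] by simp
  have "?g p = p" if p: "p \<in> pts" "q p \<in> S" for p
  proof -
    have "q (finv h p) = finv (proj h) (q p)" using proj_q[OF finv_in[OF assms(2)] p(1)] finv_proj[OF assms(2)] by simp
    also have "\<dots> = q p" using bij_finv(1)[OF proj_bij[OF assms(2)], of "q p"] unfolding assms(3)[OF p(2)] .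
    finally have "g (finv h p) = finv h p" using g(3) in_pts[OF finv_in[OF assms(2)]] p by simp
    then show ?thesis using bij_finv(2)[OF bij_in[OF assms(2)]] by simp
  qed
  moreover have "distinct3 (proj h a) (proj h b) (proj h c)"
    using d proj_bij[OF assms(2)] by (metis bij_pointE)
  ultimately show ?thesis unfolding lifts_def using G pr by blast
qed

context
  fixes S :: "(nat \<times> nat) set" and x0 :: "nat \<times> nat"
  assumes S: "finite S" and x0: "x0 \<in> ray_system n"
begin

lemma orbit_avoid: assumes "finite F" shows "\<exists>u\<in>orb Gam x0. u \<notin> F"
proof -
  have "infinite (orb Gam x0)" using Gam.infinite_orb x0 by simp
  then have "\<not> orb Gam x0 \<subseteq> F" using finite_subset[OF _ assms] by blast
  then show ?thesis by blast
qed

lemma orbit_cyc: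
  assumes "a \<in> orb Gam x0" "b \<in> orb Gam x0" "c \<in> orb Gam x0" "distinct3 a b c"
  shows "cyc a b c \<in> Gam"
proof (rule Gam.three_cycles_in)
  show "a \<in> ray_system n" using Gam.orb_subset[of x0] x0 assms(1) by (auto simp: Gam.pts_def)
qed (use assms Gam.orb_eq[OF assms(1)] in auto)

text \<open>
  A lift of the three-cycle \<open>(c w u)\<close>, with a new point \<open>u\<close>, conjugates \<open>(a b c)\<close> to \<open>(a b w)\<close>.
\<close>

lemma lifts_replace:
  assumes V: "lifts S a b c" and c: "c \<in> orb Gam x0 - S" and w: "w \<in> orb Gam x0 - S" "w \<noteq> a" "w \<noteq> b" "w \<noteq> c"
  shows "lifts S a b w"
proof -
  have d: "distinct3 a b c" using V unfolding lifts_def by blast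
  obtain u where u: "u \<in> orb Gam x0" "u \<notin> S \<union> {a, b, c, w}" using orbit_avoid[of "S \<union> {a, b, c, w}"] S by auto
  have "cyc c w u \<in> Gam" using orbit_cyc[of c w u] c w u by auto
  then obtain h where h: "h \<in> G" "proj h = cyc c w u" using Gam_lift by blast
  have "proj h s = s" if "s \<in> S" for s unfolding h(2) using that c w u by (auto simp: cyc_def)
  then have "lifts S (proj h a) (proj h b) (proj h c)" using lifts_conj[OF V h(1)] by blast
  moreover have "proj h a = a" "proj h b = b" "proj h c = w" unfolding h(2) using d w u by (auto simp: cyc_def)
  ultimately show ?thesis by simp
qed

text \<open>
  There are infinitely many three-cycles \<open>(a b w)\<close>, but only finitely many permutations of the
  fibres over \<open>S\<close>: two lifts that agree there give a quotient acting trivially on these fibres.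
\<close>

lemma lifts_ex: "\<exists>a\<in>orb Gam x0 - S. \<exists>b\<in>orb Gam x0 - S. \<exists>c\<in>orb Gam x0 - S. lifts S a b c"
proof -
  obtain a where a: "a \<in> orb Gam x0" "a \<notin> S" using orbit_avoid[OF S] by blast
  obtain b where b: "b \<in> orb Gam x0" "b \<notin> insert a S" using orbit_avoid[of "insert a S"] S by blast
  define W where "W = orb Gam x0 - (S \<union> {a, b})"
  have W: "infinite W" unfolding W_def using Gam.infinite_orb x0 S by (intro Diff_infinite_finite) auto
  have "\<forall>w\<in>W. \<exists>g. g \<in> G \<and> proj g = cyc a b w"
  proof
    fix w assume "w \<in> W"
    then have "cyc a b w \<in> Gam" using orbit_cyc[of a b w] a b unfolding W_def by auto
    then show "\<exists>g. g \<in> G \<and> proj g = cyc a b w" using Gam_lift by blast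
  qed
  then obtain f where f: "\<And>w. w \<in> W \<Longrightarrow> f w \<in> G \<and> proj (f w) = cyc a b w" by metis
  let ?Q = "{p \<in> pts. q p \<in> S}"
  have Q: "finite ?Q" using finite_vimage[OF S] .
  let ?c = "\<lambda>w. restrict (f w) ?Q"
  have "?c ` W \<subseteq> ?Q \<rightarrow>\<^sub>E ?Q"
  proof
    fix r assume "r \<in> ?c ` W"
    then obtain w where w: "w \<in> W" "r = ?c w" by blast
    have "f w p \<in> ?Q" if p: "p \<in> ?Q" for p
    proof -
      have "q (f w p) = cyc a b w (q p)" using proj_q[of "f w" p] f[OF w(1)] p by auto
      also have "\<dots> = q p" using p a b w(1) unfolding W_def by (auto simp: cyc_def)
      finally show ?thesis using p in_pts[of "f w" p] f[OF w(1)] by auto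
    qed
    then show "r \<in> ?Q \<rightarrow>\<^sub>E ?Q" unfolding w(2) by auto
  qed
  then have "finite (?c ` W)" by (rule finite_subset) (intro finite_PiE Q)
  then have "\<not> inj_on ?c W" using W finite_imageD[of ?c W] by blast
  then obtain w w' where w: "w \<in> W" "w' \<in> W" "w \<noteq> w'" "?c w = ?c w'" unfolding inj_on_def by blast
  let ?g = "finv (f w) \<circ> f w'"
  have fw: "f w \<in> G" "f w' \<in> G" using f w by auto
  have dd: "distinct3 a b w" "distinct3 a b w'" using w a b unfolding W_def by auto
  have "proj ?g = cyc a w b \<circ> cyc a b w'"
    using proj_comp[OF finv_in[OF fw(1)] fw(2)] finv_proj[OF fw(1)] f w finv_cyc[OF dd(1)] by simp
  then have pr: "proj ?g = cyc b w' w" using cyc_mult[OF dd w(3)] by simp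
  have "?g p = p" if "p \<in> pts" "q p \<in> S" for p
    using fun_cong[OF w(4), of p] that bij_finv(1)[OF bij_in[OF fw(1)], of p] by simp
  moreover have "?g \<in> G" using comp_in finv_in fw by blast
  moreover have "distinct3 b w' w" using dd w(3) by blast
  ultimately have "lifts S b w' w" unfolding lifts_def using pr by blast
  moreover have "w \<in> orb Gam x0 - S" "w' \<in> orb Gam x0 - S" using w unfolding W_def by auto
  ultimately show ?thesis using b by blast
qed

lemma lifts_fresh:
  assumes V: "lifts S a b c" and abc: "{a, b, c} \<subseteq> orb Gam x0 - S" and uvw: "{u, v, w} \<subseteq> orb Gam x0 - S"
    and d: "distinct3 u v w" "{a, b, c} \<inter> {u, v, w} = {}"
  shows "lifts S u v w"
proof -
  have 1: "lifts S a b w" using lifts_replace[OF V] abc uvw d by auto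
  have 2: "lifts S w a v" using lifts_replace[OF lifts_rotate[OF lifts_rotate[OF 1]]] abc uvw d by auto
  have "lifts S v w u" using lifts_replace[OF lifts_rotate[OF lifts_rotate[OF 2]]] abc uvw d by auto
  then show ?thesis by (rule lifts_rotate[OF lifts_rotate])
qed

text \<open>
  Exchange the points one at a time, first for new points \<open>u\<close>, \<open>v\<close>, \<open>w\<close> and then for \<open>x\<close>, \<open>y\<close>, \<open>z\<close>.
\<close>

lemma lifts_all:
  assumes xyz: "{x, y, z} \<subseteq> orb Gam x0 - S" "distinct3 x y z"
  shows "lifts S x y z"
proof -
  obtain a b c where abc: "{a, b, c} \<subseteq> orb Gam x0 - S" "lifts S a b c" using lifts_ex by blast
  let ?F = "S \<union> {a, b, c, x, y, z}"
  have F: "finite ?F" using S by simp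
  obtain u where u: "u \<in> orb Gam x0" "u \<notin> ?F" using orbit_avoid[OF F] by blast
  obtain v where v: "v \<in> orb Gam x0" "v \<notin> insert u ?F" using orbit_avoid[of "insert u ?F"] F by blast
  obtain w where w: "w \<in> orb Gam x0" "w \<notin> insert v (insert u ?F)" using orbit_avoid[of "insert v (insert u ?F)"] F by blast
  have "lifts S u v w" by (rule lifts_fresh[OF abc(2,1)]) (use u v w in auto)
  then show ?thesis by (rule lifts_fresh) (use u v w xyz in auto)
qed

end

lemma lift_cyc:
  assumes "finite S" "x \<in> ray_system n" "y \<in> orb Gam x" "z \<in> orb Gam x" "distinct3 x y z" "x \<notin> S" "y \<notin> S" "z \<notin> S"
  shows "\<exists>g\<in>G. proj g = cyc x y z \<and> (\<forall>p\<in>pts. q p \<in> S \<longrightarrow> g p = p)"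
  using lifts_all[OF assms(1,2), of x y z] assms Gam.orb_self[of x] unfolding lifts_def by blast

section \<open>A canonical transport between fibres\<close>

text \<open>
  The elements preserving every class. The bottom group of the wreath product arises from them.
\<close>

definition "Ker = {g \<in> G. proj g = id}"

lemma Ker_comp: "k \<in> Ker \<Longrightarrow> k' \<in> Ker \<Longrightarrow> k \<circ> k' \<in> Ker"
  unfolding Ker_def using comp_in proj_comp by auto

lemma Ker_finv: "k \<in> Ker \<Longrightarrow> finv k \<in> Ker"
  unfolding Ker_def using finv_in finv_proj[of k] by auto

lemma id_Ker: "id \<in> Ker" unfolding Ker_def using id_in proj_id by blast

lemma Ker_fiber: "k \<in> Ker \<Longrightarrow> p \<in> fiber b \<Longrightarrow> k p \<in> fiber b"
  using q_image[of k p b] unfolding Ker_def by auto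

lemma Ker_in: "k \<in> Ker \<Longrightarrow> k \<in> G" unfolding Ker_def by blast

lemma proj_comp_Ker: "g \<in> G \<Longrightarrow> k \<in> Ker \<Longrightarrow> proj (g \<circ> k) = proj g" "g \<in> G \<Longrightarrow> k \<in> Ker \<Longrightarrow> proj (k \<circ> g) = proj g"
  unfolding Ker_def using proj_comp by auto

lemma Ker_conj: assumes "g \<in> G" "k \<in> Ker" shows "g \<circ> (k \<circ> finv g) \<in> Ker"
proof -
  have "proj (g \<circ> (k \<circ> finv g)) = proj g \<circ> proj (finv g)"
    using proj_comp[OF assms(1) comp_in[OF Ker_in[OF assms(2)] finv_in[OF assms(1)]]]
      proj_comp_Ker(2)[OF finv_in[OF assms(1)] assms(2)] by simp
  then show ?thesis unfolding Ker_def using proj_finv(2)[OF assms(1)] comp_in finv_in assms Ker_in by simp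
qed

text \<open>
  Transport maps are given by lifts of three-cycles or, from a fibre to itself, by \<open>Ker\<close>. Between
  two fibres they are determined up to the action of \<open>Ker\<close>, and they form a groupoid, which is a
  standard against which the action of other elements of \<open>G\<close> on the fibres is measured.
\<close>

definition transport :: "nat \<times> nat \<Rightarrow> nat \<times> nat \<Rightarrow> (nat \<times> nat \<Rightarrow> nat \<times> nat) \<Rightarrow> bool" where
  "transport b c f \<longleftrightarrow> (if b = c then \<exists>k\<in>Ker. \<forall>p\<in>fiber b. f p = k p
     else \<exists>s\<in>G. \<exists>z. distinct3 b c z \<and> proj s = cyc b c z \<and> (\<forall>p\<in>fiber b. f p = s p))"

lemma transport_lift: assumes "s \<in> G" "distinct3 b c z" "proj s = cyc b c z" shows "transport b c s"
  unfolding transport_def using assms by (simp only: if_False simp_thms) blast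

lemma transport_Ker: "k \<in> Ker \<Longrightarrow> transport b b k"
  unfolding transport_def by (simp only: if_True simp_thms) blast

lemma transport_cong: "(\<And>p. p \<in> fiber b \<Longrightarrow> f p = g p) \<Longrightarrow> transport b c f \<longleftrightarrow> transport b c g"
  unfolding transport_def by (intro if_cong refl bex_cong ex_cong conj_cong ball_cong) auto

lemma lift_in_orbit:
  assumes "s \<in> G" "distinct3 b c z" "proj s = cyc b c z"
  shows "b \<in> ray_system n" "c \<in> orb Gam b" "z \<in> orb Gam b"
  using Gam.three_cycle_points[of b c z] assms proj_in_Gam[OF assms(1)] unfolding Gam.three_cycle_def by auto

text \<open>
  For \<open>z \<noteq> z'\<close> the quotient of the three-cycles \<open>(b c z)\<close> and \<open>(b c z')\<close> is a three-cycle fixing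
  \<open>b\<close>. By \<open>lift_cyc\<close> it has a lift acting trivially on the fibre over \<open>b\<close>; multiplying by the
  inverse of this lift leaves an element of \<open>Ker\<close>.
\<close>

lemma transport_unique:
  assumes s: "s \<in> G" "distinct3 b c z" "proj s = cyc b c z" and s': "s' \<in> G" "distinct3 b c z'" "proj s' = cyc b c z'"
  shows "\<exists>k\<in>Ker. \<forall>p\<in>fiber b. s' p = s (k p)"
proof (cases "z = z'")
  case True
  have "proj (finv s \<circ> s') = id"
    using proj_comp[OF finv_in[OF s(1)] s'(1)] s'(3) s(3) True proj_finv(1)[OF s(1)] by metis
  then have "finv s \<circ> s' \<in> Ker" unfolding Ker_def using comp_in finv_in s(1) s'(1) by blast
  moreover have "s' p = s ((finv s \<circ> s') p)" for p using bij_finv(2)[OF bij_in[OF s(1)]] by simp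
  ultimately show ?thesis by blast
next
  case False
  have o: "b \<in> ray_system n" "c \<in> orb Gam b" "z \<in> orb Gam b" "z' \<in> orb Gam b"
    using lift_in_orbit[OF s] lift_in_orbit[OF s'] by auto
  have pr: "proj (finv s \<circ> s') = cyc c z' z"
    using proj_comp[OF finv_in[OF s(1)] s'(1)] finv_proj[OF s(1)] s(3) s'(3) finv_cyc[OF s(2)] cyc_mult[OF s(2) s'(2) False] by simp
  have cR: "c \<in> ray_system n" using o Gam.orb_subset[of b] by (auto simp: Gam.pts_def)
  obtain r where r: "r \<in> G" "proj r = cyc c z' z" "\<And>p. p \<in> pts \<Longrightarrow> q p \<in> {b} \<Longrightarrow> r p = p"
    using lift_cyc[of "{b}" c z' z] cR o Gam.orb_eq[OF o(2)] s(2) s'(2) False by blast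
  let ?k = "finv s \<circ> s' \<circ> finv r"
  have "proj ?k = proj r \<circ> proj (finv r)"
    using proj_comp[OF comp_in[OF finv_in[OF s(1)] s'(1)] finv_in[OF r(1)]] pr r(2) by simp
  then have "?k \<in> Ker" unfolding Ker_def using proj_finv(2)[OF r(1)] comp_in finv_in s(1) s'(1) r(1) by simp
  moreover have "s' p = s (?k p)" if p: "p \<in> fiber b" for p
  proof -
    have "r p = p" using r(3) p unfolding fiber_def by auto
    then have "finv r p = p" using bij_finv(1)[OF bij_in[OF r(1)], of p] by simp
    then show ?thesis using bij_finv(2)[OF bij_in[OF s(1)]] by simp
  qed
  ultimately show ?thesis by blast
qed

text \<open>
  For distinct \<open>b\<close>, \<open>c\<close>, \<open>a\<close> both maps may be taken, up to \<open>Ker\<close>, from a lift \<open>t\<close> of the single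
  three-cycle \<open>(b c a)\<close>, whose square is the three-cycle \<open>(b a c)\<close>.
\<close>

lemma transport_comp:
  assumes f: "transport b c f" and g: "transport c a g"
  shows "transport b a (g \<circ> f)"
proof (cases "b = c")
  case True
  then obtain k where k: "k \<in> Ker" "\<And>p. p \<in> fiber b \<Longrightarrow> f p = k p" using f unfolding transport_def by auto
  show ?thesis
  proof (cases "c = a")
    case True
    then obtain k' where k': "k' \<in> Ker" "\<And>p. p \<in> fiber b \<Longrightarrow> g p = k' p" using g \<open>b = c\<close> unfolding transport_def by auto
    have "(g \<circ> f) p = (k' \<circ> k) p" if "p \<in> fiber b" for p using k(2)[OF that] k'(2)[OF Ker_fiber[OF k(1) that]] by simp
    then show ?thesis
      using transport_Ker[OF Ker_comp[OF k'(1) k(1)], of b] transport_cong[of b "g \<circ> f" "k' \<circ> k"] \<open>b = c\<close> True by blast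
  next
    case False
    then obtain s z where s: "s \<in> G" "distinct3 b a z" "proj s = cyc b a z" "\<And>p. p \<in> fiber b \<Longrightarrow> g p = s p"
      using g \<open>b = c\<close> unfolding transport_def by auto
    have "(g \<circ> f) p = (s \<circ> k) p" if "p \<in> fiber b" for p using k(2)[OF that] s(4)[OF Ker_fiber[OF k(1) that]] by simp
    moreover have "transport b a (s \<circ> k)"
      using transport_lift[OF comp_in[OF s(1) Ker_in[OF k(1)]] s(2)] proj_comp_Ker(1)[OF s(1) k(1)] s(3) by simp
    ultimately show ?thesis using transport_cong[of b "g \<circ> f" "s \<circ> k"] by blast
  qed
next
  case bc: False
  then obtain s z where s: "s \<in> G" "distinct3 b c z" "proj s = cyc b c z" "\<And>p. p \<in> fiber b \<Longrightarrow> f p = s p"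
    using f unfolding transport_def by auto
  have sf: "s p \<in> fiber c" if "p \<in> fiber b" for p
    using q_image[OF s(1) that] s(3) by (simp add: cyc_def)
  show ?thesis
  proof (cases "c = a")
    case True
    then obtain k where k: "k \<in> Ker" "\<And>p. p \<in> fiber c \<Longrightarrow> g p = k p" using g unfolding transport_def by auto
    have "(g \<circ> f) p = (k \<circ> s) p" if "p \<in> fiber b" for p using s(4)[OF that] k(2)[OF sf[OF that]] by simp
    moreover have "transport b c (k \<circ> s)"
      using transport_lift[OF comp_in[OF Ker_in[OF k(1)] s(1)] s(2)] proj_comp_Ker(2)[OF s(1) k(1)] s(3) by simp
    ultimately show ?thesis using transport_cong[of b "g \<circ> f" "k \<circ> s"] True by blast
  next
    case ca: False
    then obtain s' z' where s': "s' \<in> G" "distinct3 c a z'" "proj s' = cyc c a z'" "\<And>p. p \<in> fiber c \<Longrightarrow> g p = s' p"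
      using g unfolding transport_def by auto
    show ?thesis
    proof (cases "b = a")
      case True
      have "proj (finv s) = cyc c b z"
        using finv_proj[OF s(1)] s(3) finv_cyc[OF s(2)] cyc_rotate[of b z c] cyc_rotate[of z c b] s(2) by auto
      moreover have "distinct3 c b z" "distinct3 c b z'" "proj s' = cyc c b z'" using s(2) s'(2,3) True by auto
      ultimately obtain k where k: "k \<in> Ker" "\<And>p. p \<in> fiber c \<Longrightarrow> s' p = finv s (k p)"
        using transport_unique[OF finv_in[OF s(1)], of c b z s' z'] s'(1) by blast
      let ?k = "finv s \<circ> (k \<circ> finv (finv s))"
      have fs: "finv (finv s) = s" using bij_in[OF s(1)] by (rule inv_inv_eq)
      have kK: "?k \<in> Ker" using Ker_conj[OF finv_in[OF s(1)] k(1)] .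
      have "(g \<circ> f) p = ?k p" if "p \<in> fiber b" for p
        unfolding fs using s(4)[OF that] s'(4)[OF sf[OF that]] k(2)[OF sf[OF that]] by simp
      then show ?thesis using transport_Ker[OF kK] transport_cong[of b "g \<circ> f" ?k] True by blast
    next
      case False
      have o: "b \<in> ray_system n" "c \<in> orb Gam b" using lift_in_orbit[OF s(1-3)] by auto
      have "a \<in> orb Gam b" using lift_in_orbit[OF s'(1-3)] Gam.orb_eq[OF o(2)] by auto
      then obtain t where t: "t \<in> G" "proj t = cyc b c a"
        using Gam_lift[OF Gam.three_cycles_in[OF o(1,2), of a]] bc ca False by blast
      have d: "distinct3 b c a" "distinct3 c a b" using bc ca False by auto
      have t': "proj t = cyc c a b" using t(2) cyc_rotate[OF d(1)] by simp
      obtain k where k: "k \<in> Ker" "\<And>p. p \<in> fiber b \<Longrightarrow> s p = t (k p)" using transport_unique[OF t(1) d(1) t(2) s(1-3)] by blast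
      obtain k' where k': "k' \<in> Ker" "\<And>p. p \<in> fiber c \<Longrightarrow> s' p = t (k' p)" using transport_unique[OF t(1) d(2) t' s'(1-3)] by blast
      let ?u = "t \<circ> (k' \<circ> (t \<circ> k))"
      have u: "?u \<in> G" using comp_in Ker_in k k' t by simp
      have "proj ?u = cyc b c a \<circ> cyc b c a"
        using proj_comp[OF t(1)] proj_comp_Ker[OF t(1)] proj_comp_Ker(2)[OF comp_in[OF t(1) Ker_in[OF k(1)]] k'(1)]
          proj_comp_Ker(1)[OF t(1) k(1)] comp_in Ker_in k(1) k'(1) t by simp
      then have "transport b a ?u" using cyc_square[OF d(1)] d by (intro transport_lift[OF u, of _ _ c]) auto
      moreover have "(g \<circ> f) p = ?u p" if "p \<in> fiber b" for p
        using s(4)[OF that] s'(4)[OF sf[OF that]] k'(2)[OF sf[OF that]] k(2)[OF that] by simp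
      ultimately show ?thesis using transport_cong[of b "g \<circ> f" ?u] by blast
    qed
  qed
qed

lemma transport_finv:
  assumes g: "g \<in> G" "proj g b = c" and tr: "transport b c g"
  shows "transport c b (finv g)"
proof -
  have gi: "finv g p \<in> fiber b" if "p \<in> fiber c" for p
    using q_image[OF finv_in[OF g(1)] that] finv_proj[OF g(1)] g(2) bij_finv(1)[OF proj_bij[OF g(1)]] by metis
  show ?thesis
  proof (cases "b = c")
    case True
    then obtain k where k: "k \<in> Ker" "\<And>p. p \<in> fiber b \<Longrightarrow> g p = k p" using tr unfolding transport_def by auto
    have "finv g p = finv k p" if "p \<in> fiber c" for p
      using k(2)[OF gi[OF that]] bij_finv[OF bij_in[OF g(1)]] bij_finv[OF bij_in[OF Ker_in[OF k(1)]]] by metis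
    then show ?thesis
      using transport_Ker[OF Ker_finv[OF k(1)], of c] transport_cong[of c "finv g" "finv k"] True by blast
  next
    case False
    then obtain s z where s: "s \<in> G" "distinct3 b c z" "proj s = cyc b c z" "\<And>p. p \<in> fiber b \<Longrightarrow> g p = s p"
      using tr unfolding transport_def by auto
    have "finv g p = finv s p" if "p \<in> fiber c" for p
      using s(4)[OF gi[OF that]] bij_finv[OF bij_in[OF g(1)]] bij_finv[OF bij_in[OF s(1)]] by metis
    moreover have "proj (finv s) = cyc c b z"
      using finv_proj[OF s(1)] s(3) finv_cyc[OF s(2)] cyc_rotate[of b z c] cyc_rotate[of z c b] s(2) by auto
    then have "transport c b (finv s)" using s(2) by (intro transport_lift[OF finv_in[OF s(1)], of _ _ z]) auto
    ultimately show ?thesis using transport_cong[of c "finv g" "finv s"] by blast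
  qed
qed

definition "good g b \<longleftrightarrow> transport b (proj g b) g"

lemma good_comp: assumes "g \<in> G" "h \<in> G" "good h b" "good g (proj h b)" shows "good (g \<circ> h) b"
  using assms transport_comp proj_comp[OF assms(1,2)] unfolding good_def by simp

lemma good_finv: assumes "g \<in> G" "good g b" shows "good (finv g) (proj g b)"
  using assms transport_finv[OF assms(1) refl] bij_finv(1)[OF proj_bij[OF assms(1)], of b] finv_proj[OF assms(1)]
  unfolding good_def by simp

text \<open>
  Write \<open>g\<close> as \<open>(g \<circ> s \<circ> finv g) \<circ> g \<circ> finv s\<close>, where \<open>s\<close> lifts a three-cycle moving \<open>b\<close> to \<open>c\<close>; then
  the first factor lifts a three-cycle too.
\<close>

lemma good_orbit:
  assumes g: "g \<in> G" "good g b" and b: "b \<in> ray_system n" and c: "c \<in> orb Gam b"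
  shows "good g c"
proof (cases "c = b")
  case False
  obtain z where z: "z \<in> orb Gam b" "z \<notin> {b, c}" using orbit_avoid[of "{}" b "{b, c}"] b by blast
  then obtain s where s: "s \<in> G" "proj s = cyc b c z"
    using Gam_lift[OF Gam.three_cycles_in[OF b c, of z]] False by blast
  have d: "distinct3 b c z" using False z by auto
  have sb: "proj s b = c" using s(2) by (simp add: cyc_def)
  have gs: "good s b" unfolding good_def sb using transport_lift[OF s(1) d s(2)] .
  have 1: "good (finv s) c" using good_finv[OF s(1) gs] sb by simp
  have sc: "proj (finv s) c = b" using sb finv_proj[OF s(1)] bij_finv(1)[OF proj_bij[OF s(1)], of b] by simp
  have 2: "good (g \<circ> finv s) c" using good_comp[OF g(1) finv_in[OF s(1)] 1] g(2) sc by simp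
  let ?u = "g \<circ> (s \<circ> finv g)"
  have u: "?u \<in> G" using comp_in finv_in g(1) s(1) by blast
  have "proj ?u = proj g \<circ> cyc b c z \<circ> finv (proj g)"
    unfolding proj_comp[OF g(1) comp_in[OF s(1) finv_in[OF g(1)]]] proj_comp[OF s(1) finv_in[OF g(1)]]
      s(2) finv_proj[OF g(1)] by (simp only: comp_assoc)
  then have pu: "proj ?u = cyc (proj g b) (proj g c) (proj g z)" using cyc_conj[OF proj_bij[OF g(1)]] by simp
  have d': "distinct3 (proj g b) (proj g c) (proj g z)" using d proj_bij[OF g(1)] by (metis bij_pointE)
  have "proj ?u (proj g b) = proj g c" unfolding pu by (simp add: cyc_def)
  then have 3: "good ?u (proj g b)" unfolding good_def using transport_lift[OF u d' pu] by simp
  have "proj (g \<circ> finv s) c = proj g b" using proj_comp[OF g(1) finv_in[OF s(1)]] sc by simp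
  then have "good (?u \<circ> (g \<circ> finv s)) c" using good_comp[OF u comp_in[OF g(1) finv_in[OF s(1)]] 2] 3 by simp
  moreover have "?u \<circ> (g \<circ> finv s) = g"
    using bij_finv(1)[OF bij_in[OF g(1)]] bij_finv(2)[OF bij_in[OF s(1)]] by (simp add: fun_eq_iff)
  ultimately show ?thesis by simp
qed (use g in simp)

lemma good_ex:
  assumes "g \<in> G" "b \<in> ray_system n" shows "\<exists>s\<in>G. proj s b = proj g b \<and> good s b"
proof (cases "proj g b = b")
  case True
  then show ?thesis using transport_Ker[OF id_Ker, of b] id_in proj_id unfolding good_def by (intro bexI[of _ id]) auto
next
  case False
  obtain z where z: "z \<in> orb Gam b" "z \<notin> {b, proj g b}" using orbit_avoid[of "{}" b "{b, proj g b}"] assms by blast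
  have "proj g b \<in> orb Gam b" using proj_in_Gam[OF assms(1)] unfolding orb_def by blast
  then obtain s where s: "s \<in> G" "proj s = cyc b (proj g b) z"
    using Gam_lift[OF Gam.three_cycles_in[OF assms(2), of "proj g b" z]] False z by auto
  have "proj s b = proj g b" unfolding s(2) by (simp add: cyc_def)
  moreover have "good s b" unfolding good_def \<open>proj s b = proj g b\<close>
    by (rule transport_lift[OF s(1) _ s(2)]) (use False z in auto)
  ultimately show ?thesis using s(1) by blast
qed

definition "Good = {g \<in> G. \<forall>b\<in>ray_system n. good g b}"

lemma Good_subgroup: "subgroup Good (houghton n)"
proof -
  have "id \<in> Good" unfolding Good_def good_def using id_in transport_Ker[OF id_Ker] proj_id by simp
  moreover have "g \<circ> h \<in> Good" if "g \<in> Good" "h \<in> Good" for g h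
    using that good_comp comp_in proj_in unfolding Good_def by simp
  moreover have "finv g \<in> Good" if "g \<in> Good" for g
  proof -
    have g: "g \<in> G" "\<And>b. b \<in> ray_system n \<Longrightarrow> good g b" using that unfolding Good_def by auto
    have "good (finv g) b" if b: "b \<in> ray_system n" for b
    proof -
      have "proj (finv g) b \<in> ray_system n" using proj_in[OF finv_in[OF g(1)]] b by blast
      from good_finv[OF g(1) g(2)[OF this]] show ?thesis
        using finv_proj[OF g(1)] bij_finv(2)[OF proj_bij[OF g(1)]] by simp
    qed
    then show ?thesis unfolding Good_def using finv_in g(1) by blast
  qed
  ultimately show ?thesis unfolding subgroup_houghton_iff using in_houghton by (auto simp: Good_def)
qed

text \<open>
  By \<open>good_orbit\<close> it suffices to test one point in each orbit, so a finite set \<open>?B\<close> of points. On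
  the fibre over such a point, \<open>g\<close> is the product of a permutation of this fibre and a transport map
  \<open>\<sigma> g b\<close>. There are finitely many choices for these permutations, and they determine a coset. The
  colouring is composed with inversion to obtain cosets on the side required by \<open>fin_idxI\<close>.
\<close>

lemma Good_fin_idx: "fin_idx Good G"
proof -
  let ?B = "{b \<in> ray_system n. snd b < Gam.D0 + e1}"
  let ?Q = "{p \<in> pts. q p \<in> ?B}"
  have Q: "finite ?Q" using finite_vimage[OF finite_core] .
  define \<sigma> where "\<sigma> g b = (SOME s. s \<in> G \<and> proj s b = proj g b \<and> good s b)" for g b
  have \<sigma>: "\<sigma> g b \<in> G \<and> proj (\<sigma> g b) b = proj g b \<and> good (\<sigma> g b) b" if "g \<in> G" "b \<in> ray_system n" for g b
  proof -
    have "\<exists>s. s \<in> G \<and> proj s b = proj g b \<and> good s b" using good_ex[OF that] by blast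
    from someI_ex[OF this] show ?thesis unfolding \<sigma>_def .
  qed
  define c where "c g = (\<lambda>p\<in>?Q. finv (\<sigma> g (q p)) (g p))" for g
  have into_Q: "finv (\<sigma> g (q p)) (g p) \<in> fiber (q p)" if "g \<in> G" "p \<in> pts" for g p
  proof -
    note s = \<sigma>[OF that(1) q_in[OF that(2)]]
    have "g p \<in> fiber (proj g (q p))" using q_image[OF that(1)] that(2) by (simp add: fiber_def)
    then have "finv (\<sigma> g (q p)) (g p) \<in> fiber (proj (finv (\<sigma> g (q p))) (proj g (q p)))"
      using q_image[OF finv_in] s by blast
    moreover have "proj (finv (\<sigma> g (q p))) (proj g (q p)) = q p"
      using s finv_proj[of "\<sigma> g (q p)"] bij_finv(1)[OF proj_bij[of "\<sigma> g (q p)"], of "q p"] by simp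
    ultimately show ?thesis by simp
  qed
  have key: "g \<circ> finv h \<in> Good" if gh: "g \<in> G" "h \<in> G" and eq: "c g = c h" for g h
  proof -
    have "good (g \<circ> finv h) (proj h b)" if b: "b \<in> ?B" for b
    proof -
      have bR: "b \<in> ray_system n" using b by blast
      note sg = \<sigma>[OF gh(1) bR] and sh = \<sigma>[OF gh(2) bR]
      let ?t = "\<sigma> g b \<circ> finv (\<sigma> h b)"
      have "good (finv (\<sigma> h b)) (proj h b)" using good_finv[of "\<sigma> h b" b] sh by simp
      moreover have "proj (finv (\<sigma> h b)) (proj h b) = b"
        using sh finv_proj[of "\<sigma> h b"] bij_finv(1)[OF proj_bij[of "\<sigma> h b"], of b] by simp
      ultimately have gt: "good ?t (proj h b)" using good_comp[of "\<sigma> g b" "finv (\<sigma> h b)" "proj h b"] sg sh finv_in by simp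
      have "proj ?t (proj h b) = proj g b"
        using proj_comp[of "\<sigma> g b" "finv (\<sigma> h b)"] sg sh finv_in \<open>proj (finv (\<sigma> h b)) (proj h b) = b\<close> by simp
      moreover have "proj (g \<circ> finv h) (proj h b) = proj g b"
        using proj_comp[OF gh(1) finv_in[OF gh(2)]] finv_proj[OF gh(2)] bij_finv(1)[OF proj_bij[OF gh(2)], of b] by simp
      moreover have "(g \<circ> finv h) p = ?t p" if p: "p \<in> fiber (proj h b)" for p
      proof -
        let ?p = "finv h p"
        have "?p \<in> fiber b" using q_image[OF finv_in[OF gh(2)] p] finv_proj[OF gh(2)] bij_finv(1)[OF proj_bij[OF gh(2)], of b] by simp
        then have pp: "?p \<in> ?Q" "q ?p = b" using b unfolding fiber_def by auto
        have hp: "h ?p = p" using bij_finv(2)[OF bij_in[OF gh(2)]] by simp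
        have "c g ?p = c h ?p" using eq by simp
        then have "finv (\<sigma> g b) (g ?p) = finv (\<sigma> h b) p" using pp hp unfolding c_def by simp
        then have "\<sigma> g b (finv (\<sigma> g b) (g ?p)) = ?t p" by simp
        then show ?thesis using bij_finv(2)[OF bij_in[of "\<sigma> g b"]] sg by simp
      qed
      ultimately show ?thesis using gt transport_cong[of "proj h b" "g \<circ> finv h" ?t] unfolding good_def by simp
    qed
    moreover have G: "g \<circ> finv h \<in> G" using comp_in finv_in gh by blast
    moreover have "good (g \<circ> finv h) a" if a: "a \<in> ray_system n" for a
    proof -
      obtain b where b: "b \<in> orb Gam a" "snd b < Gam.D0 + e1" using Gam.orb_meets_core[of a] a Gam.pts_eq by auto
      have bR: "b \<in> ray_system n" using b(1) Gam.orb_subset[of a] a by (auto simp: Gam.pts_def)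
      have 1: "proj h b \<in> orb Gam b" using proj_in_Gam[OF gh(2)] unfolding orb_def by blast
      have "a \<in> orb Gam (proj h b)" using Gam.orb_eq[OF 1] Gam.orb_eq[OF b(1)] Gam.orb_self[of a] by simp
      moreover have "proj h b \<in> ray_system n" using proj_in[OF gh(2)] bR by blast
      ultimately show ?thesis using good_orbit[OF G] \<open>\<And>b. b \<in> ?B \<Longrightarrow> good (g \<circ> finv h) (proj h b)\<close> b(2) bR by blast
    qed
    ultimately show ?thesis unfolding Good_def by blast
  qed
  show ?thesis
  proof (rule fin_idxI[OF sub, where c = "\<lambda>g. c (finv g)"])
    show "Good \<subseteq> G" unfolding Good_def by blast
    have "c (finv g) \<in> ?Q \<rightarrow>\<^sub>E ?Q" if "g \<in> G" for g
    proof -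
      have "finv (\<sigma> (finv g) (q p)) (finv g p) \<in> ?Q" if "p \<in> ?Q" for p
        using into_Q[OF finv_in[OF \<open>g \<in> G\<close>], of p] that unfolding fiber_def by auto
      then show ?thesis unfolding c_def by auto
    qed
    then show "finite ((\<lambda>g. c (finv g)) ` G)"
      using finite_PiE[OF Q, of "\<lambda>_. ?Q"] Q finite_subset[of "(\<lambda>g. c (finv g)) ` G" "?Q \<rightarrow>\<^sub>E ?Q"] by blast
    fix g h assume gh: "g \<in> G" "h \<in> G" "c (finv g) = c (finv h)"
    have "finv h \<circ> finv (finv g) \<in> Good" using key[OF finv_in[OF gh(2)] finv_in[OF gh(1)]] gh(3) by simp
    then show "finv h \<circ> g \<in> Good" using inv_inv_eq[OF bij_in[OF gh(1)]] by simp
  qed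
qed

lemma Ker_Good: "Ker \<subseteq> Good"
  unfolding Good_def good_def Ker_def using transport_Ker unfolding Ker_def by auto

lemma Ker_trans_len: assumes "k \<in> Ker" "j \<in> {1..n}" shows "trans_len k j = 0"
proof -
  have k: "k \<in> G" "proj k = id" using assms unfolding Ker_def by auto
  obtain z where z: "trans_len k j = int d * z" using dvd_trans_len[OF k(1) assms(2)] by blast
  have "int (e j) * z = 0" using trans_len_proj[OF k(1) assms(2) z] k(2) trans_len_id by simp
  then show ?thesis using e_pos[OF assms(2)] z by simp
qed

end

text \<open>
  Stabilisers of classes act on these classes like the group of elements preserving all classes.
\<close>

definition (in lattice_subgroup) inner :: bool where
  "inner \<longleftrightarrow> (\<forall>g\<in>G. \<forall>x\<in>pts. g x \<in> acl x \<longrightarrow>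
     (\<exists>k\<in>G. (\<forall>y\<in>pts. k y \<in> acl y) \<and> (\<forall>y\<in>acl x. k y = g y)))"

text \<open>
  The subgroup \<open>Good\<close> has this property because transport maps from a fibre to itself are
  restrictions of elements of \<open>Ker\<close>, and it contains \<open>Ker\<close>.
\<close>

lemma (in lattice_subgroup) ex_inner_subgroup:
  "\<exists>H c. fin_idx H G \<and> lattice_subgroup n H c Fx \<and> lattice_subgroup.inner n H Fx"
proof -
  obtain q e where qe: "q ` pts = ray_system n" "\<forall>x\<in>pts. \<forall>y\<in>pts. q x = q y \<longleftrightarrow> y \<in> acl x"
    "\<exists>L. \<forall>j\<in>{1..n}. \<forall>l\<ge>L. fst (q (j, l)) = j \<and> q (j, l + d) = (j, snd (q (j, l)) + e j)"
    using ex_quotient_map by blast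
  interpret Q: quotient_map n G d Fx q e
    using qe by unfold_locales blast+
  define H' where "H' c = {g\<in>Q.Good. \<forall>j\<in>{1..n}. int c dvd trans_len g j}" for c
  obtain c where c: "subgroup (H' c) (houghton n)" "fin_idx (H' c) Q.Good" "has_moves n c (H' c)"
    using lattice_refine[OF sub has_moves Q.Good_subgroup Q.Good_fin_idx] unfolding H'_def by blast
  have fi: "fin_idx (H' c) G" by (rule fin_idx_trans[OF sub Q.Good_fin_idx c(2)])
  have HG: "H' c \<subseteq> G" using fi fin_idx_def by blast
  have lat: "lattice_subgroup n (H' c) c Fx"
  proof (rule lattice_subgroup.intro[OF three_le c(1,3)])
    show "int c dvd trans_len g j" if "g \<in> H' c" "j \<in> {1..n}" for g j
      using that unfolding H'_def by blast
    show "g x = x" if "g \<in> H' c" "x \<in> Fx" for g x using that HG fix_Fx by blast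
    show "infinite (orb (H' c) x)" if "x \<in> ray_system n - Fx" for x
      using fin_idx_infinite_orbit[OF sub c(1) fi] infinite_orb[OF that] .
  qed (rule Fx)+
  interpret H: lattice_subgroup n "H' c" c Fx by (rule lat)
  have acl: "H.acl x = acl x" for x by (rule acl_fin_idx[OF lattice_subgroup_axioms lat fi])
  have "H.inner"
    unfolding H.inner_def acl
  proof (intro ballI impI)
    fix g x assume g: "g \<in> H' c" and x: "x \<in> H.pts" "g x \<in> acl x"
    have xp: "x \<in> pts" using x(1) unfolding pts_def H.pts_def .
    have gG: "g \<in> G" "g \<in> Q.Good" using g HG unfolding H'_def by auto
    have "q (g x) = q x" using Q.q_eq_iff[OF xp] in_pts[OF gG(1)] xp x(2) by metis
    then have "Q.proj g (q x) = q x" using Q.proj_q[OF gG(1) xp] by simp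
    moreover have "Q.good g (q x)" using gG(2) Q.q_in[OF xp] unfolding Q.Good_def by blast
    ultimately obtain k where k: "k \<in> Q.Ker" "\<And>p. p \<in> Q.fiber (q x) \<Longrightarrow> g p = k p"
      unfolding Q.good_def Q.transport_def by auto
    have "k \<in> H' c" using k(1) Q.Ker_Good Q.Ker_trans_len unfolding H'_def by auto
    moreover have "k y \<in> acl y" if y: "y \<in> pts" for y
      using Q.Ker_fiber[OF k(1), of y "q y"] Q.fiber_eq_acl[OF y] y by (auto simp: Q.fiber_def)
    moreover have "k y = g y" if "y \<in> acl x" for y using k(2)[of y] that Q.fiber_eq_acl[OF xp] by simp
    ultimately show "\<exists>k\<in>H' c. (\<forall>y\<in>H.pts. k y \<in> acl y) \<and> (\<forall>y\<in>acl x. k y = g y)"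
      unfolding pts_def H.pts_def by blast
  qed
  then show ?thesis using fi lat by blast
qed

section \<open>The kernel of the action on the quotient ray system\<close>

locale inner_quotient_map = quotient_map +
  assumes inner: inner
begin

lemma inner_on_fiber:
  assumes g: "g \<in> G" and b: "b \<in> ray_system n" "proj g b = b"
  shows "\<exists>k\<in>Ker. \<forall>p\<in>fiber b. k p = g p"
proof -
  obtain x where x: "x \<in> pts" "q x = b" using fiber_ex b(1) by blast
  have "g x \<in> fiber b" using q_image[OF g, of x b] x b(2) by (simp add: fiber_def)
  then have "g x \<in> acl x" using fiber_eq_acl[OF x(1)] x(2) by simp
  then obtain k where k: "k \<in> G" "\<And>y. y \<in> pts \<Longrightarrow> k y \<in> acl y" "\<And>y. y \<in> acl x \<Longrightarrow> k y = g y"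
    using inner x(1) g unfolding inner_def by blast
  have "proj k = id"
  proof (rule proj_eqI[OF k(1)])
    fix y assume y: "y \<in> pts"
    show "q (k y) = id (q y)" using k(2)[OF y] q_eq_iff[OF y] in_pts[OF k(1)] y by (metis id_apply)
  qed simp
  then show ?thesis using k fiber_eq_acl[OF x(1)] x(2) unfolding Ker_def by (intro bexI[of _ k]) auto
qed

lemma Ker_finite_support: assumes "k \<in> Ker" shows "finite {p. k p \<noteq> p}"
  using finite_support_if_trans_len_zero[OF in_houghton[OF Ker_in[OF assms]]] Ker_trans_len[OF assms] by blast

text \<open>
  Take \<open>g\<close> lifting a three-cycle from \<open>b\<close> to \<open>c\<close> and fixing the other fibres in the support of \<open>k0\<close>
  pointwise. In the product of \<open>k0\<close> and the conjugate by \<open>g\<close> of its inverse everything cancels on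
  these fibres.
\<close>

lemma Ker_localize_aux:
  assumes k0: "k0 \<in> Ker" and b: "b \<in> ray_system n" and c: "c \<in> orb Gam b" "c \<noteq> b"
    and triv: "\<And>p. p \<in> fiber c \<Longrightarrow> k0 p = p"
  shows "\<exists>k\<in>Ker. (\<forall>p\<in>fiber b. k p = k0 p) \<and> (\<forall>p\<in>pts. q p \<notin> {b, c} \<longrightarrow> k p = p)"
proof -
  define S where "S = q ` {p \<in> pts. k0 p \<noteq> p} - {b}"
  have S: "finite S" unfolding S_def using Ker_finite_support[OF k0] by simp
  have offS: "k0 p = p" if "p \<in> fiber a" "a \<notin> S" "a \<noteq> b" for p a
    using that unfolding S_def fiber_def by blast
  have cS: "c \<notin> S" using triv unfolding S_def fiber_def by blast
  \<comment> \<open>A third point for the three-cycle, over which \<open>k0\<close> is trivial.\<close>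
  obtain z where z: "z \<in> orb Gam b" "z \<notin> S \<union> {b, c}" using orbit_avoid[of "{}" b "S \<union> {b, c}"] b S by blast
  obtain g where g: "g \<in> G" "proj g = cyc b c z" "\<And>p. p \<in> pts \<Longrightarrow> q p \<in> S \<Longrightarrow> g p = p"
    using lift_cyc[OF S b c(1) z(1)] c z cS unfolding S_def by blast
  have d: "distinct3 b c z" using c z by auto
  let ?k = "k0 \<circ> (g \<circ> (finv k0 \<circ> finv g))"
  have kK: "?k \<in> Ker" by (rule Ker_comp[OF k0 Ker_conj[OF g(1) Ker_finv[OF k0]]])
  have ginv: "finv g p \<in> fiber (cyc b z c a)" if "p \<in> fiber a" for p a
    using q_image[OF finv_in[OF g(1)] that] finv_proj[OF g(1)] g(2) finv_cyc[OF d] by simp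
  have gg: "g (finv g p) = p" "finv g (g p) = p" for p using bij_finv[OF bij_in[OF g(1)]] by auto
  have kk: "k0 (finv k0 p) = p" "finv k0 (k0 p) = p" for p using bij_finv[OF bij_in[OF Ker_in[OF k0]]] by auto
  have "?k p = k0 p" if p: "p \<in> fiber b" for p
  proof -
    have "finv g p \<in> fiber z" using ginv[OF p] by (simp add: cyc_def)
    then have "k0 (finv g p) = finv g p" using offS z by blast
    then have "finv k0 (finv g p) = finv g p" using kk by metis
    then show ?thesis using gg by simp
  qed
  moreover have "?k p = p" if p: "p \<in> pts" "q p \<notin> {b, c}" for p
  proof -
    have pf: "p \<in> fiber (q p)" using p by (simp add: fiber_def)
    show ?thesis
    proof (cases "q p \<in> S")
      case True
      have "finv g p = p" using g(3)[OF p(1) True] gg by metis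
      moreover have f: "finv k0 p \<in> fiber (q p)" using Ker_fiber[OF Ker_finv[OF k0] pf] .
      then have "g (finv k0 p) = finv k0 p" using g(3) True unfolding fiber_def by simp
      ultimately show ?thesis using kk by simp
    next
      case False
      have k0p: "k0 p = p" using offS[OF pf False] p(2) by simp
      have "k0 (finv g p) = finv g p"
      proof (cases "q p = z")
        case True
        then have "finv g p \<in> fiber c" using ginv[OF pf] d z(2) by (simp add: cyc_def)
        then show ?thesis by (rule triv)
      next
        case qz: False
        then have "finv g p \<in> fiber (q p)" using ginv[OF pf] p(2) by (simp add: cyc_def)
        then show ?thesis using offS False p(2) by blast
      qed
      then have "finv k0 (finv g p) = finv g p" using kk by metis
      then show ?thesis using gg k0p by simp
    qed
  qed
  ultimately show ?thesis using kK by blast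
qed

text \<open>
  A detour through a fibre over \<open>c'\<close> on which \<open>k0\<close> is trivial removes the condition on the fibre
  over \<open>c\<close>.
\<close>

lemma Ker_localize:
  assumes k0: "k0 \<in> Ker" and b: "b \<in> ray_system n" and c: "c \<in> orb Gam b" "c \<noteq> b"
  shows "\<exists>k\<in>Ker. (\<forall>p\<in>fiber b. k p = k0 p) \<and> (\<forall>p\<in>pts. q p \<notin> {b, c} \<longrightarrow> k p = p)"
proof -
  define S where "S = q ` {p \<in> pts. k0 p \<noteq> p}"
  have S: "finite S" unfolding S_def using Ker_finite_support[OF k0] by simp
  obtain c' where c': "c' \<in> orb Gam b" "c' \<notin> S \<union> {b, c}" using orbit_avoid[of "{}" b "S \<union> {b, c}"] b S by blast
  have "k0 p = p" if "p \<in> fiber c'" for p using that c'(2) unfolding S_def fiber_def by blast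
  then obtain k1 where k1: "k1 \<in> Ker" "\<forall>p\<in>fiber b. k1 p = k0 p" "\<forall>p\<in>pts. q p \<notin> {b, c'} \<longrightarrow> k1 p = p"
    using Ker_localize_aux[OF k0 b c'(1)] c'(2) by blast
  have "k1 p = p" if "p \<in> fiber c" for p using that k1(3) c(2) c'(2) unfolding fiber_def by auto
  then obtain k where "k \<in> Ker" "\<forall>p\<in>fiber b. k p = k1 p" "\<forall>p\<in>pts. q p \<notin> {b, c} \<longrightarrow> k p = p"
    using Ker_localize_aux[OF k1(1) b c] by blast
  then show ?thesis using k1(2) by (intro bexI[of _ k]) auto
qed

section \<open>Frames\<close>

definition base :: "nat \<times> nat \<Rightarrow> nat \<times> nat" where
  "base b = (SOME a. a \<in> orb Gam b)"

lemma base_in_orb: "base b \<in> orb Gam b"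
  unfolding base_def by (rule someI[of _ b]) (rule Gam.orb_self)

lemma base_eq: "a \<in> orb Gam b \<Longrightarrow> base a = base b"
  unfolding base_def using Gam.orb_eq by simp

lemma base_in: assumes "b \<in> ray_system n" shows "base b \<in> ray_system n"
  using base_in_orb[of b] Gam.orb_subset[of b] assms by (auto simp: Gam.pts_def)

text \<open>
  The elements \<open>\<tau> b\<close> identify all fibres over an orbit with the fibre over its base point. The
  second condition makes the coordinate functions of the embedding finitely supported.
\<close>

definition frame :: "(nat \<times> nat \<Rightarrow> nat \<times> nat \<Rightarrow> nat \<times> nat) \<Rightarrow> bool" where
  "frame \<tau> \<longleftrightarrow> (\<forall>b\<in>ray_system n. \<tau> b \<in> G \<and> proj (\<tau> b) (base b) = b) \<and>
     (\<forall>g\<in>G. finite {b \<in> ray_system n. \<exists>p\<in>fiber (base b). g (\<tau> b p) \<noteq> \<tau> (proj g b) p})"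

text \<open>
  Frames that are compatible with the translations along the rays exist; elements of \<open>G\<close> preserve
  such a frame at all but finitely many points.
\<close>

lemma ex_frame: "\<exists>\<tau>. frame \<tau>"
proof -
  define other where "other j = (SOME k. k \<in> {1..n} \<and> k \<noteq> j)" for j :: nat
  have other: "other j \<in> {1..n} \<and> other j \<noteq> j" for j
  proof -
    have "\<exists>k. k \<in> {1..n} \<and> k \<noteq> j" using ex_other[of j j] by blast
    from someI_ex[OF this] show ?thesis unfolding other_def .
  qed
  define u where "u j = gen j (other j)" for j
  have uG: "(u j ^^ m) \<in> G" if "j \<in> {1..n}" for j m unfolding u_def using gen_pow_in[OF that] other by blast
  have e1: "e1 > 0" using e_pos[of 1] three_le unfolding e1_def by simp
  obtain P where P: "\<And>j p x. j \<in> {1..n} \<Longrightarrow> p \<ge> P \<Longrightarrow> x \<in> fiber (j, p) \<Longrightarrow> fst x = j \<and> snd x \<ge> D0 + L0"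
    using deep_fiber[of "D0 + L0"] by blast
  have uact: "(u j ^^ m) x = (j, snd x + m * d)" if "j \<in> {1..n}" "p \<ge> P" "x \<in> fiber (j, p)" for j p x m
  proof -
    have "x = (j, snd x)" "snd x \<ge> D0" using P[OF that] by (auto simp: prod_eq_iff)
    then show ?thesis using gen_up_pow[OF that(1), of "other j" "snd x" m] other[of j] unfolding u_def by metis
  qed
  have uproj: "proj (u j ^^ m) (j, p) = (j, p + m * e1)" if j: "j \<in> {1..n}" "p \<ge> P" for j p m
  proof -
    obtain x where x: "x \<in> pts" "q x = (j, p)" using fiber_ex[of "(j, p)"] j by (auto simp: ray_system_def)
    have xf: "x \<in> fiber (j, p)" using x by (simp add: fiber_def)
    have xj: "x = (j, snd x)" "snd x \<ge> L0" using P[OF j xf] by (auto simp: prod_eq_iff)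
    have "proj (u j ^^ m) (j, p) = q (j, snd x + m * d)" using proj_q[OF uG[OF j(1)] x(1)] x(2) uact[OF j xf] by metis
    also have "\<dots> = (j, snd (q (j, snd x)) + m * e1)" using q_shift(2)[OF j(1) xj(2)] e_eq[OF j(1)] by simp
    finally show ?thesis using x(2) xj(1) by simp
  qed
  define \<tau>0 where "\<tau>0 b = (SOME g. g \<in> G \<and> proj g (base b) = b)" for b
  have \<tau>0: "\<tau>0 b \<in> G \<and> proj (\<tau>0 b) (base b) = b" for b
  proof -
    have "b \<in> orb Gam (base b)" using Gam.orb_eq[OF base_in_orb[of b]] Gam.orb_self[of b] by simp
    then obtain \<gamma> where "\<gamma> \<in> Gam" "b = \<gamma> (base b)" unfolding orb_def by blast
    then have "\<exists>g. g \<in> G \<and> proj g (base b) = b" using Gam_lift by metis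
    from someI_ex[OF this] show ?thesis unfolding \<tau>0_def .
  qed
  \<comment> \<open>Below height \<open>P\<close> the choice is arbitrary; above, it is arbitrary on one period and then translated.\<close>
  define \<tau> where "\<tau> = (\<lambda>(j, p). if p < P then \<tau>0 (j, p) else (u j ^^ ((p - P) div e1)) \<circ> \<tau>0 (j, P + (p - P) mod e1))"
  have \<tau>1: "\<tau> b \<in> G \<and> proj (\<tau> b) (base b) = b" if bR: "b \<in> ray_system n" for b
  proof -
    obtain j p where b: "b = (j, p)" "j \<in> {1..n}" using bR by (cases b) (auto simp: ray_system_def)
    show ?thesis
    proof (cases "p < P")
      case True then show ?thesis using \<tau>0 b by (simp add: \<tau>_def)
    next
      case False
      let ?m = "(p - P) div e1" and ?r = "P + (p - P) mod e1"
      have p: "p = ?r + ?m * e1" using False by simp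
      have u: "proj (u j ^^ ?m) (j, ?r) = (j, p)" using uproj[OF b(2), of ?r ?m] p by simp
      then have "(j, p) \<in> orb Gam (j, ?r)" using proj_in_Gam[OF uG[OF b(2)]] unfolding orb_def by (metis image_eqI)
      then have "base (j, p) = base (j, ?r)" by (rule base_eq)
      then have "proj ((u j ^^ ?m) \<circ> \<tau>0 (j, ?r)) (base (j, p)) = (j, p)"
        using proj_comp[OF uG[OF b(2)], of "\<tau>0 (j, ?r)"] \<tau>0[of "(j, ?r)"] u by simp
      moreover have "(u j ^^ ?m) \<circ> \<tau>0 (j, ?r) \<in> G" using comp_in[OF uG[OF b(2)]] \<tau>0 by blast
      ultimately show ?thesis using False b by (simp add: \<tau>_def)
    qed
  qed
  have \<tau>2: "\<tau> (j, p + m * e1) = (u j ^^ m) \<circ> \<tau> (j, p)" if p: "p \<ge> P" for j p m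
  proof -
    have eq: "p + m * e1 - P = (p - P) + m * e1" using p by simp
    have "(p + m * e1 - P) div e1 = m + (p - P) div e1" "(p + m * e1 - P) mod e1 = (p - P) mod e1"
      unfolding eq using e1 by simp_all
    then show ?thesis using p by (simp add: \<tau>_def funpow_add comp_assoc)
  qed
  have "finite {b \<in> ray_system n. \<exists>p\<in>fiber (base b). g (\<tau> b p) \<noteq> \<tau> (proj g b) p}" if g: "g \<in> G" for g
  proof -
    obtain L where L: "\<And>j l. j \<in> {1..n} \<Longrightarrow> l \<ge> L \<Longrightarrow> fst (g (j, l)) = j \<and> int (snd (g (j, l))) = int l + trans_len g j"
      using houghton_threshold[OF in_houghton[OF g]] by blast
    obtain N where N: "\<And>j p. j \<in> {1..n} \<Longrightarrow> p \<ge> N \<Longrightarrow> fst (proj g (j, p)) = j \<and> int (snd (proj g (j, p))) = int p + trans_len (proj g) j"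
      using houghton_threshold[OF proj_in_houghton[OF g]] by blast
    obtain P' where P': "\<And>j p x. j \<in> {1..n} \<Longrightarrow> p \<ge> P' \<Longrightarrow> x \<in> fiber (j, p) \<Longrightarrow> fst x = j \<and> snd x \<ge> L"
      using deep_fiber[of L] by blast
    define B where "B = P + P' + N + (\<Sum>j\<in>{1..n}. nat \<bar>trans_len (proj g) j\<bar>)"
    have "g (\<tau> (j, p) x) = \<tau> (proj g (j, p)) x" if j: "j \<in> {1..n}" and p: "p \<ge> B" and x: "x \<in> fiber (base (j, p))" for j p x
    proof -
      have jp: "(j, p) \<in> ray_system n" using j by (simp add: ray_system_def)
      obtain z where z: "trans_len g j = int d * z" using dvd_trans_len[OF g j] by blast
      have tz: "trans_len (proj g) j = int e1 * z" using trans_len_proj[OF g j z] e_eq[OF j] by simp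
      have pB: "p \<ge> P" "p \<ge> P'" "p \<ge> N" and pt: "p \<ge> P + nat \<bar>trans_len (proj g) j\<bar>"
        using p member_le_sum[of j "{1..n}" "\<lambda>j. nat \<bar>trans_len (proj g) j\<bar>"] j unfolding B_def by auto
      define p' where "p' = snd (proj g (j, p))"
      have gb: "proj g (j, p) = (j, p')" and p'i: "int p' = int p + int e1 * z"
        using N[OF j pB(3)] tz by (auto simp: p'_def prod_eq_iff)
      have pP: "p' \<ge> P" using p'i pt tz by linarith
      have yf: "\<tau> (j, p) x \<in> fiber (j, p)" using q_image[of "\<tau> (j, p)" x "base (j, p)"] \<tau>1[OF jp] x by simp
      define y where "y = \<tau> (j, p) x"
      have y: "y = (j, snd y)" "snd y \<ge> L" using P'[OF j pB(2), of y] yf by (auto simp: y_def prod_eq_iff)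
      have gy: "fst (g y) = j" "int (snd (g y)) = int (snd y) + int d * z" using L[OF j y(2)] y(1) z by auto
      show ?thesis
      proof (cases "z \<ge> 0")
        case True
        then have "int p' = int (p + nat z * e1)" using p'i by (simp add: algebra_simps)
        then have "p' = p + nat z * e1" unfolding of_nat_eq_iff .
        then have "\<tau> (j, p') x = (u j ^^ nat z) y" using \<tau>2[OF pB(1), of j "nat z"] by (simp add: y_def)
        also have "\<dots> = (j, snd y + nat z * d)" using uact[OF j pB(1) yf] by (simp add: y_def)
        also have "\<dots> = g y"
        proof -
          have "int (snd (g y)) = int (snd y + nat z * d)" using gy(2) True by (simp add: algebra_simps)
          then have "snd (g y) = snd y + nat z * d" unfolding of_nat_eq_iff .
          then show ?thesis using gy(1) by (simp add: prod_eq_iff)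
        qed
        finally show ?thesis using gb by (simp add: y_def)
      next
        case False
        then have "int p = int (p' + nat (- z) * e1)" using p'i by (simp add: algebra_simps)
        then have pp: "p = p' + nat (- z) * e1" unfolding of_nat_eq_iff .
        define w where "w = \<tau> (j, p') x"
        have "(j, p') \<in> ray_system n" using j by (simp add: ray_system_def)
        moreover have "base (j, p') = base (j, p)"
          using base_eq[of "(j, p')" "(j, p)"] gb proj_in_Gam[OF g] unfolding orb_def by (metis image_eqI)
        ultimately have wf: "w \<in> fiber (j, p')"
          using q_image[of "\<tau> (j, p')" x "base (j, p')"] \<tau>1[of "(j, p')"] x by (simp add: w_def)
        have "y = (u j ^^ nat (- z)) w" using \<tau>2[OF pP, of j "nat (- z)"] pp by (simp add: y_def w_def)
        also have "\<dots> = (j, snd w + nat (- z) * d)" using uact[OF j pP wf] .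
        finally have "int (snd (g y)) = int (snd w)" using gy False by (simp add: algebra_simps)
        moreover have "fst w = j" using P[OF j pP wf] by simp
        ultimately have "g y = w" using gy(1) by (simp add: prod_eq_iff)
        then show ?thesis using gb by (simp add: y_def w_def)
      qed
    qed
    then have "{b \<in> ray_system n. \<exists>p\<in>fiber (base b). g (\<tau> b p) \<noteq> \<tau> (proj g b) p} \<subseteq> {b \<in> ray_system n. snd b < B}"
      by (auto simp: ray_system_def not_le[symmetric])
    then show ?thesis using finite_core finite_subset by blast
  qed
  then have "frame \<tau>" unfolding frame_def using \<tau>1 by blast
  then show ?thesis by blast
qed

end

section \<open>Embedding into the restricted multi-wreath product\<close>

lemma finite_group_nat_copy:
  assumes H: "group H" and fin: "finite (carrier H)"
  shows "\<exists>(M :: nat monoid) c. group M \<and> finite (carrier M) \<and> c \<in> iso H M"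
proof -
  interpret H: group H by fact
  obtain f :: "'a \<Rightarrow> nat" where f: "inj_on f (carrier H)"
    using finite_imp_inj_to_nat_seg[OF fin] by blast
  define M where "M = \<lparr>carrier = f ` carrier H,
    monoid.mult = (\<lambda>m n. f (inv_into (carrier H) f m \<otimes>\<^bsub>H\<^esub> inv_into (carrier H) f n)), one = f \<one>\<^bsub>H\<^esub>\<rparr>"
  have iso: "f \<in> iso H M"
    using f by (auto simp: iso_def hom_def M_def bij_betw_def)
  then have "group (M\<lparr>one := f \<one>\<^bsub>H\<^esub>\<rparr>)" by (rule H.iso_imp_img_group)
  then have "group M" by (simp add: M_def)
  then show ?thesis using iso fin by (intro exI[of _ M] exI[of _ f]) (simp add: M_def)
qed

lemma (in group) finite_rcosets_if_representatives:
  assumes H: "subgroup H G" and F: "finite F" and rep: "\<And>x. x \<in> carrier G \<Longrightarrow> \<exists>h\<in>H. h \<otimes> x \<in> F"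
  shows "finite (rcosets H)"
proof -
  have "rcosets H \<subseteq> (\<lambda>y. H #> y) ` F"
  proof
    fix C assume "C \<in> rcosets H"
    then obtain x where x: "x \<in> carrier G" "C = H #> x" unfolding RCOSETS_def by blast
    obtain h where h: "h \<in> H" "h \<otimes> x \<in> F" using rep[OF x(1)] by blast
    have "h \<otimes> x \<in> H #> x" using h(1) unfolding r_coset_def by blast
    then have "H #> x = H #> (h \<otimes> x)" using repr_independence[OF _ x(1) H] by blast
    then show "C \<in> (\<lambda>y. H #> y) ` F" using x(2) h(2) by blast
  qed
  then show ?thesis using F finite_subset by blast
qed

definition restr :: "'a set \<Rightarrow> ('a \<Rightarrow> 'a) \<Rightarrow> 'a \<Rightarrow> 'a" where
  "restr F f p = (if p \<in> F then f p else p)"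

lemma restr_cong: "(\<And>p. p \<in> F \<Longrightarrow> f p = g p) \<Longrightarrow> restr F f = restr F g"
  by (auto simp: restr_def fun_eq_iff)

lemma restr_comp: "(\<And>p. p \<in> F \<Longrightarrow> g p \<in> F) \<Longrightarrow> restr F (f \<circ> g) = restr F f \<circ> restr F g"
  by (auto simp: restr_def fun_eq_iff)

context quotient_map begin

text \<open>
  The group induced by \<open>Ker\<close> on a fibre; permutations act on the right. These finite groups are
  the bottom groups of the wreath product.
\<close>

definition fiber_group :: "nat \<times> nat \<Rightarrow> (nat \<times> nat \<Rightarrow> nat \<times> nat) monoid" where
  "fiber_group b = \<lparr>carrier = restr (fiber b) ` Ker, monoid.mult = (\<lambda>f h. h \<circ> f), one = id\<rparr>"

lemma restr_id: "restr F id = id" by (auto simp: restr_def)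

lemma fiber_group_group: "group (fiber_group b)"
proof (rule groupI)
  fix f h assume "f \<in> carrier (fiber_group b)" "h \<in> carrier (fiber_group b)"
  then obtain k k' where k: "k \<in> Ker" "f = restr (fiber b) k" and k': "k' \<in> Ker" "h = restr (fiber b) k'"
    unfolding fiber_group_def by auto
  have "h \<circ> f = restr (fiber b) (k' \<circ> k)" unfolding k k' by (rule restr_comp[symmetric]) (rule Ker_fiber[OF k(1)])
  then show "f \<otimes>\<^bsub>fiber_group b\<^esub> h \<in> carrier (fiber_group b)"
    using Ker_comp[OF k'(1) k(1)] unfolding fiber_group_def by simp
next
  show "\<one>\<^bsub>fiber_group b\<^esub> \<in> carrier (fiber_group b)"
    using id_Ker restr_id[of "fiber b"] unfolding fiber_group_def by (simp only: partial_object.simps monoid.simps) (metis image_eqI)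
next
  fix f assume "f \<in> carrier (fiber_group b)"
  then obtain k where k: "k \<in> Ker" "f = restr (fiber b) k" unfolding fiber_group_def by auto
  have "finv k \<circ> k = id" using bij_finv(3)[OF bij_in[OF Ker_in[OF k(1)]]] .
  have "k \<circ> finv k = id" using bij_finv(4)[OF bij_in[OF Ker_in[OF k(1)]]] .
  then have "f \<circ> restr (fiber b) (finv k) = id"
    unfolding k(2) using restr_comp[of "fiber b" "finv k" k] Ker_fiber[OF Ker_finv[OF k(1)]] restr_id[of "fiber b"] by simp
  then show "\<exists>h\<in>carrier (fiber_group b). h \<otimes>\<^bsub>fiber_group b\<^esub> f = \<one>\<^bsub>fiber_group b\<^esub>"
    using Ker_finv[OF k(1)] unfolding fiber_group_def by (intro bexI[of _ "restr (fiber b) (finv k)"]) simp_all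
qed (auto simp: fiber_group_def comp_assoc)

lemma finite_fiber_group: "finite (carrier (fiber_group b))"
proof -
  have "f permutes fiber b" if f: "f \<in> carrier (fiber_group b)" for f
  proof -
    obtain k where k: "k \<in> Ker" "f = restr (fiber b) k" using f unfolding fiber_group_def by auto
    have "bij_betw k (fiber b) (fiber b)"
    proof (rule bij_betw_byWitness[where f' = "finv k"])
      show "k ` fiber b \<subseteq> fiber b" using Ker_fiber[OF k(1)] by blast
      show "finv k ` fiber b \<subseteq> fiber b" using Ker_fiber[OF Ker_finv[OF k(1)]] by blast
    qed (use bij_finv[OF bij_in[OF Ker_in[OF k(1)]]] in auto)
    then have "bij_betw f (fiber b) (fiber b)" using bij_betw_cong[of "fiber b" k f] by (simp add: k(2) restr_def)
    then show ?thesis by (rule bij_imp_permutes) (simp add: k(2) restr_def)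
  qed
  then have "carrier (fiber_group b) \<subseteq> {f. f permutes fiber b}" by blast
  then show ?thesis using finite_permutations[OF finite_fiber[of b]] finite_subset by blast
qed

end

locale framed_quotient = inner_quotient_map n G d Fx q e for n G d Fx q e +
  fixes \<tau> :: "nat \<times> nat \<Rightarrow> nat \<times> nat \<Rightarrow> nat \<times> nat"
    and M :: "nat \<times> nat \<Rightarrow> nat monoid" and c :: "nat \<times> nat \<Rightarrow> (nat \<times> nat \<Rightarrow> nat \<times> nat) \<Rightarrow> nat"
  assumes frame: "frame \<tau>"
    and M_group: "group (M b)" and M_finite: "finite (carrier (M b))" and c_iso: "c b \<in> iso (fiber_group b) (M b)"
begin

abbreviation "R \<equiv> ray_system n"
abbreviation "\<Gamma> \<equiv> houghton n\<lparr>carrier := Gam\<rparr>"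
abbreviation "actn \<equiv> (\<lambda>(g :: nat \<times> nat \<Rightarrow> nat \<times> nat) x. g x)"

definition W :: "(nat \<times> nat) set \<Rightarrow> nat monoid" where "W \<Omega> = M (SOME a. a \<in> \<Omega>)"

lemma orbit_eq: "orbit \<Gamma> actn b = orb Gam b"
  unfolding orbit_def orb_def by auto

lemma W_orbit: "W (orbit \<Gamma> actn b) = M (base b)"
  unfolding W_def orbit_eq base_def ..

text \<open>
  The action of \<open>g\<close> from the fibre over \<open>b\<close> to the fibre over its image, read in the frame. On the
  fibre over the base point it agrees with an element of \<open>Ker\<close>.
\<close>

definition "cocycle g b = finv (\<tau> (proj g b)) \<circ> (g \<circ> \<tau> b)"
definition "val g b = c (base b) (restr (fiber (base b)) (cocycle g b))"
definition "wr_embed g = ((\<lambda>b\<in>R. val g b), proj g)"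

lemma \<tau>_in: "b \<in> R \<Longrightarrow> \<tau> b \<in> G" and proj_\<tau>: "b \<in> R \<Longrightarrow> proj (\<tau> b) (base b) = b"
  using frame unfolding frame_def by auto

lemma base_proj: "g \<in> G \<Longrightarrow> base (proj g b) = base b"
  by (rule base_eq) (use proj_in_Gam in \<open>auto simp: orb_def\<close>)

lemma base_base: "base (base b) = base b"
  by (rule base_eq[OF base_in_orb])

lemma cocycle_in:
  assumes "g \<in> G" "b \<in> R"
  shows "cocycle g b \<in> G" "proj (cocycle g b) (base b) = base b"
proof -
  have b': "proj g b \<in> R" using proj_in[OF assms(1)] assms(2) by blast
  show "cocycle g b \<in> G" unfolding cocycle_def using comp_in finv_in assms(1) \<tau>_in[OF assms(2)] \<tau>_in[OF b'] by blast
  have "proj (cocycle g b) = finv (proj (\<tau> (proj g b))) \<circ> (proj g \<circ> proj (\<tau> b))"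
    unfolding cocycle_def proj_comp[OF finv_in[OF \<tau>_in[OF b']] comp_in[OF assms(1) \<tau>_in[OF assms(2)]]]
      proj_comp[OF assms(1) \<tau>_in[OF assms(2)]] finv_proj[OF \<tau>_in[OF b']] ..
  then show "proj (cocycle g b) (base b) = base b"
    using proj_\<tau>[OF assms(2)] proj_\<tau>[OF b'] base_proj[OF assms(1), of b]
      bij_finv(1)[OF proj_bij[OF \<tau>_in[OF b']], of "base b"] by simp
qed

lemma cocycle_fiber:
  assumes "g \<in> G" "b \<in> R" "p \<in> fiber (base b)" shows "cocycle g b p \<in> fiber (base b)"
  using q_image[OF cocycle_in(1)[OF assms(1,2)] assms(3)] cocycle_in(2)[OF assms(1,2)] by simp

lemma restr_cocycle_in:
  assumes "g \<in> G" "b \<in> R" shows "restr (fiber (base b)) (cocycle g b) \<in> carrier (fiber_group (base b))"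
proof -
  obtain k where k: "k \<in> Ker" "\<And>p. p \<in> fiber (base b) \<Longrightarrow> k p = cocycle g b p"
    using inner_on_fiber[OF cocycle_in(1)[OF assms] base_in[OF assms(2)] cocycle_in(2)[OF assms]] by blast
  then have "restr (fiber (base b)) (cocycle g b) = restr (fiber (base b)) k" by (intro restr_cong) simp
  then show ?thesis using k(1) unfolding fiber_group_def by simp
qed

lemma cocycle_comp:
  assumes "g \<in> G" "h \<in> G" "b \<in> R"
  shows "cocycle (h \<circ> g) b = cocycle h (proj g b) \<circ> cocycle g b"
proof -
  have b': "proj g b \<in> R" using proj_in[OF assms(1)] assms(3) by blast
  show ?thesis
    unfolding cocycle_def proj_comp[OF assms(2,1)] using bij_finv(2)[OF bij_in[OF \<tau>_in[OF b']]] by (simp add: fun_eq_iff)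
qed

lemma c_hom: "c b \<in> hom (fiber_group b) (M b)" and c_bij: "bij_betw (c b) (carrier (fiber_group b)) (carrier (M b))"
  using c_iso[of b] unfolding iso_def by auto

lemma c_one: "c b id = \<one>\<^bsub>M b\<^esub>"
  using hom_one[OF c_hom fiber_group_group M_group, of b] by (simp add: fiber_group_def)

lemma val_in: "g \<in> G \<Longrightarrow> b \<in> R \<Longrightarrow> val g b \<in> carrier (M (base b))"
  unfolding val_def using hom_in_carrier[OF c_hom] restr_cocycle_in by blast

lemma val_comp:
  assumes "g \<in> G" "h \<in> G" "b \<in> R"
  shows "val (h \<circ> g) b = val g b \<otimes>\<^bsub>M (base b)\<^esub> val h (proj g b)"
proof -
  have b': "proj g b \<in> R" using proj_in[OF assms(1)] assms(3) by blast
  have bb: "base (proj g b) = base b" by (rule base_proj[OF assms(1)])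
  let ?F = "fiber (base b)"
  have "restr ?F (cocycle (h \<circ> g) b) = restr ?F (cocycle h (proj g b)) \<circ> restr ?F (cocycle g b)"
    unfolding cocycle_comp[OF assms] by (rule restr_comp) (rule cocycle_fiber[OF assms(1,3)])
  also have "\<dots> = restr ?F (cocycle g b) \<otimes>\<^bsub>fiber_group (base b)\<^esub> restr ?F (cocycle h (proj g b))"
    by (simp add: fiber_group_def)
  finally show ?thesis
    unfolding val_def bb
    using hom_mult[OF c_hom restr_cocycle_in[OF assms(1,3)] restr_cocycle_in[OF assms(2) b', unfolded bb]] by simp
qed

lemma val_eq_iff:
  assumes "g \<in> G" "h \<in> G" "b \<in> R"
  shows "val g b = val h b \<longleftrightarrow> (\<forall>p\<in>fiber (base b). cocycle g b p = cocycle h b p)"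
proof
  assume "val g b = val h b"
  then have "restr (fiber (base b)) (cocycle g b) = restr (fiber (base b)) (cocycle h b)"
    unfolding val_def using inj_onD[OF bij_betw_imp_inj_on[OF c_bij]] restr_cocycle_in assms by blast
  then show "\<forall>p\<in>fiber (base b). cocycle g b p = cocycle h b p" unfolding restr_def fun_eq_iff by metis
next
  assume "\<forall>p\<in>fiber (base b). cocycle g b p = cocycle h b p"
  then show "val g b = val h b" unfolding val_def using restr_cong[of "fiber (base b)"] by metis
qed

lemma val_one: "(\<And>p. p \<in> fiber (base b) \<Longrightarrow> cocycle g b p = p) \<Longrightarrow> val g b = \<one>\<^bsub>M (base b)\<^esub>"
proof -
  assume "\<And>p. p \<in> fiber (base b) \<Longrightarrow> cocycle g b p = p"
  then have "restr (fiber (base b)) (cocycle g b) = id" by (auto simp: restr_def fun_eq_iff)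
  then show ?thesis unfolding val_def using c_one by simp
qed

lemma finite_val_support:
  assumes g: "g \<in> G" shows "finite {b \<in> R. val g b \<noteq> \<one>\<^bsub>M (base b)\<^esub>}"
proof -
  have "{b \<in> R. val g b \<noteq> \<one>\<^bsub>M (base b)\<^esub>} \<subseteq> {b \<in> R. \<exists>p\<in>fiber (base b). g (\<tau> b p) \<noteq> \<tau> (proj g b) p}"
  proof (intro subsetI CollectI conjI)
    fix b assume b: "b \<in> {b \<in> R. val g b \<noteq> \<one>\<^bsub>M (base b)\<^esub>}"
    then show "b \<in> R" by blast
    have b': "proj g b \<in> R" using proj_in[OF g] b by blast
    show "\<exists>p\<in>fiber (base b). g (\<tau> b p) \<noteq> \<tau> (proj g b) p"
    proof (rule ccontr)
      assume "\<not> ?thesis"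
      then have "cocycle g b p = p" if "p \<in> fiber (base b)" for p
        using that bij_finv(1)[OF bij_in[OF \<tau>_in[OF b']], of p] by (simp add: cocycle_def)
      then show False using val_one b by blast
    qed
  qed
  then show ?thesis using frame g finite_subset unfolding frame_def by blast
qed

abbreviation "B \<equiv> wreath_base \<Gamma> R actn W"
abbreviation "Wr \<equiv> multi_wreath \<Gamma> R actn W"

lemma B_eq: "B = sum_group R (\<lambda>b. M (base b))"
  unfolding wreath_base_def W_orbit ..

lemma carrier_B: "carrier B = {\<phi> \<in> \<Pi>\<^sub>E b\<in>R. carrier (M (base b)). finite {b \<in> R. \<phi> b \<noteq> \<one>\<^bsub>M (base b)\<^esub>}}"
  unfolding B_eq by (rule carrier_sum_group) (rule M_group)

lemma \<Gamma>_group: "group \<Gamma>"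
  by (rule group.subgroup_imp_group[OF group_houghton Gam_subgroup])

lemma Wr_group: "group Wr"
proof (rule group_multi_wreath[OF \<Gamma>_group])
  show "right_action \<Gamma> R actn" by (rule right_action_houghton[OF Gam_subgroup])
  show "group (W \<Omega>)" for \<Omega> unfolding W_def by (rule M_group)
qed

lemma carrier_Wr: "carrier Wr = carrier B \<times> Gam"
  by (simp add: multi_wreath_def)

lemma inv_inv_\<Gamma>: assumes "\<gamma> \<in> Gam" shows "inv\<^bsub>\<Gamma>\<^esub> (inv\<^bsub>\<Gamma>\<^esub> \<gamma>) = \<gamma>"
  using group.inv_inv[OF \<Gamma>_group, of \<gamma>] assms by simp

lemma mult_Wr:
  assumes "a \<in> Gam"
  shows "(\<phi>, a) \<otimes>\<^bsub>Wr\<^esub> (\<psi>, b) = ((\<lambda>x\<in>R. \<phi> x \<otimes>\<^bsub>M (base x)\<^esub> \<psi> (a x)), b \<circ> a)"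
  unfolding multi_wreath_def monoid.simps case_prod_conv B_eq mult_sum_group
  by (auto simp: wreath_base_act_def inv_inv_\<Gamma>[OF assms] fun_eq_iff)

lemma embed_in: assumes "g \<in> G" shows "wr_embed g \<in> carrier Wr"
proof -
  have "{b \<in> R. (\<lambda>b\<in>R. val g b) b \<noteq> \<one>\<^bsub>M (base b)\<^esub>} = {b \<in> R. val g b \<noteq> \<one>\<^bsub>M (base b)\<^esub>}" by auto
  then have "(\<lambda>b\<in>R. val g b) \<in> carrier B"
    unfolding carrier_B using finite_val_support[OF assms] val_in[OF assms] by auto
  then show ?thesis unfolding carrier_Wr wr_embed_def using proj_in_Gam[OF assms] by blast
qed

lemma embed_hom: "wr_embed \<in> hom (houghton n\<lparr>carrier := G\<rparr>) Wr"
proof (rule homI)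
  fix g assume "g \<in> carrier (houghton n\<lparr>carrier := G\<rparr>)"
  then show "wr_embed g \<in> carrier Wr" using embed_in by simp
next
  fix g h assume "g \<in> carrier (houghton n\<lparr>carrier := G\<rparr>)" "h \<in> carrier (houghton n\<lparr>carrier := G\<rparr>)"
  then have gh: "g \<in> G" "h \<in> G" by auto
  have "(\<lambda>b\<in>R. val (h \<circ> g) b) = (\<lambda>b\<in>R. (\<lambda>b\<in>R. val g b) b \<otimes>\<^bsub>M (base b)\<^esub> (\<lambda>b\<in>R. val h b) (proj g b))"
    using val_comp[OF gh] proj_in[OF gh(1)] by (intro restrict_ext) simp
  then show "wr_embed (g \<otimes>\<^bsub>houghton n\<lparr>carrier := G\<rparr>\<^esub> h) = wr_embed g \<otimes>\<^bsub>Wr\<^esub> wr_embed h"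
    unfolding wr_embed_def mult_Wr[OF proj_in_Gam[OF gh(1)]] using proj_comp[OF gh(2,1)] by simp
qed

lemma embed_inj: "inj_on wr_embed G"
proof (rule inj_onI)
  fix g h assume gh: "g \<in> G" "h \<in> G" and eq: "wr_embed g = wr_embed h"
  then have pr: "proj g = proj h" and v: "(\<lambda>b\<in>R. val g b) = (\<lambda>b\<in>R. val h b)" unfolding wr_embed_def by auto
  have "g y = h y" if y: "y \<in> pts" for y
  proof -
    let ?b = "q y"
    have b: "?b \<in> R" using q_in[OF y] .
    have b': "proj g ?b \<in> R" using proj_in[OF gh(1)] b by blast
    have "val g ?b = val h ?b" using fun_cong[OF v, of ?b] b by simp
    then have eq: "\<And>p. p \<in> fiber (base ?b) \<Longrightarrow> cocycle g ?b p = cocycle h ?b p" using val_eq_iff[OF gh b] by blast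
    let ?p = "finv (\<tau> ?b) y"
    have \<tau>p: "\<tau> ?b ?p = y" using bij_finv(2)[OF bij_in[OF \<tau>_in[OF b]]] .
    have "y \<in> fiber ?b" using y by (simp add: fiber_def)
    then have "?p \<in> fiber (proj (finv (\<tau> ?b)) ?b)" using q_image[OF finv_in[OF \<tau>_in[OF b]]] by blast
    moreover have "proj (finv (\<tau> ?b)) ?b = base ?b"
      using finv_proj[OF \<tau>_in[OF b]] proj_\<tau>[OF b] bij_finv(1)[OF proj_bij[OF \<tau>_in[OF b]], of "base ?b"] by simp
    ultimately have "finv (\<tau> (proj g ?b)) (g y) = finv (\<tau> (proj g ?b)) (h y)"
      using eq[of ?p] \<tau>p pr unfolding cocycle_def by simp
    then show ?thesis using bij_finv(2)[OF bij_in[OF \<tau>_in[OF b']]] by metis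
  qed
  moreover have "g y = h y" if "y \<notin> pts" for y
  proof (cases "y \<in> Fx")
    case True then show ?thesis using fix_Fx[OF gh(1) True] fix_Fx[OF gh(2) True] by simp
  next
    case False
    then have "y \<notin> R" using that by (simp add: pts_def)
    then show ?thesis using permutes_not_in[OF houghton_permutes[OF in_houghton]] gh by metis
  qed
  ultimately show "g = h" by blast
qed

lemma finite_bases: "finite (base ` R)"
proof -
  have "base ` R \<subseteq> base ` {b \<in> R. snd b < Gam.D0 + e1}"
  proof
    fix a assume "a \<in> base ` R"
    then obtain b where b: "b \<in> R" "a = base b" by blast
    obtain y where y: "y \<in> orb Gam b" "snd y < Gam.D0 + e1" using Gam.orb_meets_core[of b] b(1) Gam.pts_eq by auto
    have "y \<in> R" using y(1) Gam.orb_subset[of b] b(1) by (auto simp: Gam.pts_def)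
    then have "y \<in> {b \<in> R. snd b < Gam.D0 + e1}" using y(2) by blast
    then show "a \<in> base ` {b \<in> R. snd b < Gam.D0 + e1}"
      by (rule rev_image_eqI) (simp add: b(2) base_eq[OF y(1)])
  qed
  then show ?thesis by (rule finite_subset) (intro finite_imageI finite_core)
qed

definition "reps = {(\<phi>, id :: nat \<times> nat \<Rightarrow> nat \<times> nat) | \<phi>. \<phi> \<in> carrier B \<and> (\<forall>b\<in>R. b \<noteq> base b \<longrightarrow> \<phi> b = \<one>\<^bsub>M (base b)\<^esub>)}"

lemma finite_reps: "finite reps"
proof -
  let ?S = "{\<phi> \<in> carrier B. \<forall>b\<in>R. b \<noteq> base b \<longrightarrow> \<phi> b = \<one>\<^bsub>M (base b)\<^esub>}"
  let ?A = "base ` R"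
  have "inj_on (\<lambda>\<phi>. restrict \<phi> ?A) ?S"
  proof (rule inj_onI)
    fix \<phi> \<psi> assume \<phi>: "\<phi> \<in> ?S" and \<psi>: "\<psi> \<in> ?S" and eq: "restrict \<phi> ?A = restrict \<psi> ?A"
    show "\<phi> = \<psi>"
    proof (rule PiE_ext)
      show "\<phi> \<in> (\<Pi>\<^sub>E b\<in>R. carrier (M (base b)))" "\<psi> \<in> (\<Pi>\<^sub>E b\<in>R. carrier (M (base b)))"
        using \<phi> \<psi> carrier_B by auto
      fix b assume b: "b \<in> R"
      show "\<phi> b = \<psi> b"
      proof (cases "b = base b")
        case True
        then have "b \<in> ?A" using b by blast
        then show ?thesis using fun_cong[OF eq, of b] by simp
      next
        case False then show ?thesis using \<phi> \<psi> b by auto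
      qed
    qed
  qed
  moreover have "(\<lambda>\<phi>. restrict \<phi> ?A) ` ?S \<subseteq> (\<Pi>\<^sub>E b\<in>?A. carrier (M (base b)))"
    using base_in unfolding carrier_B by auto
  then have "finite ((\<lambda>\<phi>. restrict \<phi> ?A) ` ?S)"
    by (rule finite_subset) (intro finite_PiE finite_bases M_finite)
  ultimately have "finite ?S" using finite_imageD by blast
  moreover have "reps = (\<lambda>\<phi>. (\<phi>, id)) ` ?S" unfolding reps_def by auto
  ultimately show ?thesis by simp
qed

text \<open>
  The kernel contains, for each \<open>b\<close>, an element with a prescribed value at \<open>b\<close> whose support is
  contained in \<open>{b, base b}\<close>. Such elements clear the values of \<open>\<phi>\<close> away from the base points.
\<close>

lemma ex_rep_base:
  assumes "\<phi> \<in> carrier B"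
  shows "\<exists>h\<in>wr_embed ` G. h \<otimes>\<^bsub>Wr\<^esub> (\<phi>, id) \<in> reps"
  using assms
proof (induction "card {b \<in> R. \<phi> b \<noteq> \<one>\<^bsub>M (base b)\<^esub> \<and> b \<noteq> base b}" arbitrary: \<phi>)
  case 0
  have fin: "finite {b \<in> R. \<phi> b \<noteq> \<one>\<^bsub>M (base b)\<^esub> \<and> b \<noteq> base b}"
    by (rule finite_subset[of _ "{b \<in> R. \<phi> b \<noteq> \<one>\<^bsub>M (base b)\<^esub>}"]) (use 0(2) carrier_B in auto)
  then have "{b \<in> R. \<phi> b \<noteq> \<one>\<^bsub>M (base b)\<^esub> \<and> b \<noteq> base b} = {}" using 0(1) by simp
  then have "(\<phi>, id) \<in> reps" unfolding reps_def using 0(2) by blast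
  moreover have "(\<phi>, id) \<in> carrier Wr"
    unfolding carrier_Wr using 0(2) subgroup_houghtonD(2)[OF Gam_subgroup] by blast
  then have "\<one>\<^bsub>Wr\<^esub> \<otimes>\<^bsub>Wr\<^esub> (\<phi>, id) = (\<phi>, id)" using group.is_monoid[OF Wr_group] monoid.l_one by metis
  moreover have "wr_embed id = \<one>\<^bsub>Wr\<^esub>"
    using hom_one[OF embed_hom group.subgroup_imp_group[OF group_houghton sub] Wr_group] by simp
  then have "\<one>\<^bsub>Wr\<^esub> \<in> wr_embed ` G" using id_in by (metis image_eqI)
  ultimately show ?case by (metis)
next
  case (Suc m)
  interpret Wr: group Wr by (rule Wr_group)
  let ?S = "\<lambda>\<phi>. {b \<in> R. \<phi> b \<noteq> \<one>\<^bsub>M (base b)\<^esub> \<and> b \<noteq> base b}"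
  have "?S \<phi> \<noteq> {}"
  proof
    assume "?S \<phi> = {}"
    then have "card (?S \<phi>) = 0" by (simp only: card.empty)
    then show False using Suc.hyps(2) by simp
  qed
  then obtain b where b: "b \<in> R" "\<phi> b \<noteq> \<one>\<^bsub>M (base b)\<^esub>" "b \<noteq> base b" by blast
  interpret Mb: group "M (base b)" by (rule M_group)
  let ?F = "fiber (base b)"
  have \<phi>b: "\<phi> b \<in> carrier (M (base b))" using Suc.prems b(1) unfolding carrier_B by auto
  then have "inv\<^bsub>M (base b)\<^esub> \<phi> b \<in> c (base b) ` carrier (fiber_group (base b))"
    using c_bij[of "base b"] unfolding bij_betw_def by simp
  then obtain k' where k': "k' \<in> Ker" "c (base b) (restr ?F k') = inv\<^bsub>M (base b)\<^esub> \<phi> b"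
    unfolding fiber_group_def by auto
  have \<tau>G: "\<tau> b \<in> G" by (rule \<tau>_in[OF b(1)])
  note \<tau>f = bij_finv[OF bij_in[OF \<tau>G]]
  let ?k0 = "\<tau> b \<circ> (k' \<circ> finv (\<tau> b))"
  have k0: "?k0 \<in> Ker" by (rule Ker_conj[OF \<tau>G k'(1)])
  obtain k where k: "k \<in> Ker" "\<And>p. p \<in> fiber b \<Longrightarrow> k p = ?k0 p" "\<And>p. p \<in> pts \<Longrightarrow> q p \<notin> {b, base b} \<Longrightarrow> k p = p"
    using Ker_localize[OF k0 b(1) base_in_orb] b(3) by metis
  have kG: "k \<in> G" "proj k = id" using k(1) unfolding Ker_def by auto
  have cock: "cocycle k a = finv (\<tau> a) \<circ> (k \<circ> \<tau> a)" for a unfolding cocycle_def kG(2) by simp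
  have \<tau>fib: "\<tau> a p \<in> fiber a" if "a \<in> R" "p \<in> fiber (base a)" for a p
    using q_image[OF \<tau>_in[OF that(1)] that(2)] proj_\<tau>[OF that(1)] by simp
  have "cocycle k b p = k' p" if "p \<in> ?F" for p
    using k(2)[OF \<tau>fib[OF b(1) that]] \<tau>f by (simp add: cock)
  then have "restr ?F (cocycle k b) = restr ?F k'" by (rule restr_cong)
  then have vb: "val k b = inv\<^bsub>M (base b)\<^esub> \<phi> b" unfolding val_def using k'(2) by simp
  have va: "val k a = \<one>\<^bsub>M (base a)\<^esub>" if a: "a \<in> R" "a \<noteq> b" "a \<noteq> base a" for a
  proof (rule val_one)
    fix p assume p: "p \<in> fiber (base a)"
    have "a \<noteq> base b" using a(3) base_base[of b] by auto
    then have "k (\<tau> a p) = \<tau> a p" using k(3)[of "\<tau> a p"] \<tau>fib[OF a(1) p] a(2) unfolding fiber_def by auto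
    then show "cocycle k a p = p" using bij_finv(1)[OF bij_in[OF \<tau>_in[OF a(1)]]] by (simp add: cock)
  qed
  define \<psi> where "\<psi> = (\<lambda>x\<in>R. (\<lambda>x\<in>R. val k x) x \<otimes>\<^bsub>M (base x)\<^esub> \<phi> (proj k x))"
  have prod: "wr_embed k \<otimes>\<^bsub>Wr\<^esub> (\<phi>, id) = (\<psi>, id)"
    unfolding wr_embed_def mult_Wr[OF proj_in_Gam[OF kG(1)]] \<psi>_def by (simp add: kG(2))
  have \<phi>W: "(\<phi>, id) \<in> carrier Wr" unfolding carrier_Wr using Suc.prems subgroup_houghtonD(2)[OF Gam_subgroup] by blast
  have "wr_embed k \<otimes>\<^bsub>Wr\<^esub> (\<phi>, id) \<in> carrier Wr" using Wr.m_closed[OF embed_in[OF kG(1)] \<phi>W] .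
  then have \<psi>B: "\<psi> \<in> carrier B" unfolding prod carrier_Wr by blast
  have \<psi>b: "\<psi> b = \<one>\<^bsub>M (base b)\<^esub>" using vb b(1) \<phi>b Mb.l_inv by (simp add: \<psi>_def kG(2))
  have \<psi>a: "\<psi> a = \<phi> a" if a: "a \<in> R" "a \<noteq> b" "a \<noteq> base a" for a
  proof -
    interpret Ma: group "M (base a)" by (rule M_group)
    have "\<phi> a \<in> carrier (M (base a))" using Suc.prems a(1) unfolding carrier_B by auto
    then show ?thesis using va[OF a] a(1) by (simp add: \<psi>_def kG(2))
  qed
  have ins: "?S \<phi> = insert b (?S \<psi>)"
  proof (intro equalityI subsetI)
    fix x assume x: "x \<in> ?S \<phi>"
    show "x \<in> insert b (?S \<psi>)"
    proof (cases "x = b")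
      case False then show ?thesis using x \<psi>a[of x] by simp
    qed simp
  next
    fix x assume x: "x \<in> insert b (?S \<psi>)"
    show "x \<in> ?S \<phi>"
    proof (cases "x = b")
      case True then show ?thesis using b by simp
    next
      case False then show ?thesis using x \<psi>a[of x] by simp
    qed
  qed
  have nin: "b \<notin> ?S \<psi>" using \<psi>b by simp
  have "finite (?S \<psi>)"
    by (rule finite_subset[of _ "{b \<in> R. \<psi> b \<noteq> \<one>\<^bsub>M (base b)\<^esub>}"]) (use \<psi>B carrier_B in auto)
  then have "card (?S \<phi>) = Suc (card (?S \<psi>))" unfolding ins using nin by (rule card_insert_disjoint)
  then have "m = card (?S \<psi>)" using Suc.hyps(2) by linarith
  then obtain h where h: "h \<in> G" "wr_embed h \<otimes>\<^bsub>Wr\<^esub> (\<psi>, id) \<in> reps" using Suc.hyps(1)[OF _ \<psi>B] by blast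
  have hk: "wr_embed (k \<circ> h) = wr_embed h \<otimes>\<^bsub>Wr\<^esub> wr_embed k" using hom_mult[OF embed_hom, of h k] h(1) kG(1) by simp
  have "wr_embed (k \<circ> h) \<otimes>\<^bsub>Wr\<^esub> (\<phi>, id) = wr_embed h \<otimes>\<^bsub>Wr\<^esub> (\<psi>, id)"
    unfolding hk prod[symmetric] by (rule Wr.m_assoc[OF embed_in[OF h(1)] embed_in[OF kG(1)] \<phi>W])
  then show ?case using h(2) comp_in[OF kG(1) h(1)] by (metis image_eqI)
qed

text \<open>
  An element of \<open>wr_embed ` G\<close> corrects the second component to the identity, and \<open>ex_rep_base\<close> leaves
  finitely many possibilities for the first one.
\<close>

lemma embed_finite_index: "finite (rcosets\<^bsub>Wr\<^esub> (wr_embed ` G))"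
proof -
  interpret Wr: group Wr by (rule Wr_group)
  interpret h: group_hom "houghton n\<lparr>carrier := G\<rparr>" Wr wr_embed
    by (intro group_hom.intro group_hom_axioms.intro group.subgroup_imp_group[OF group_houghton sub] Wr_group embed_hom)
  have sub': "subgroup (wr_embed ` G) Wr" using h.img_is_subgroup by simp
  show ?thesis
  proof (rule Wr.finite_rcosets_if_representatives[OF sub' finite_reps])
    fix x assume x: "x \<in> carrier Wr"
    then obtain \<phi> \<gamma> where \<gamma>: "x = (\<phi>, \<gamma>)" "\<gamma> \<in> Gam" unfolding carrier_Wr by blast
    then obtain g where g: "x = (\<phi>, proj g)" "g \<in> G" using Gam_lift by blast
    let ?i = "finv g"
    have i: "?i \<in> G" by (rule finv_in[OF g(2)])
    define \<psi> where "\<psi> = fst (wr_embed ?i \<otimes>\<^bsub>Wr\<^esub> x)"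
    have "snd (wr_embed ?i \<otimes>\<^bsub>Wr\<^esub> x) = proj g \<circ> proj ?i"
      unfolding g(1) wr_embed_def mult_Wr[OF proj_in_Gam[OF i]] by simp
    then have eq: "wr_embed ?i \<otimes>\<^bsub>Wr\<^esub> x = (\<psi>, id)" using proj_finv(2)[OF g(2)] unfolding \<psi>_def by (simp add: prod_eq_iff)
    have "wr_embed ?i \<otimes>\<^bsub>Wr\<^esub> x \<in> carrier Wr" by (rule Wr.m_closed[OF embed_in[OF i] x])
    then have "\<psi> \<in> carrier B" unfolding eq carrier_Wr by blast
    then obtain h where h: "h \<in> G" "wr_embed h \<otimes>\<^bsub>Wr\<^esub> (\<psi>, id) \<in> reps" using ex_rep_base by blast
    have "(wr_embed h \<otimes>\<^bsub>Wr\<^esub> wr_embed ?i) \<otimes>\<^bsub>Wr\<^esub> x \<in> reps"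
      using h(2) Wr.m_assoc[OF embed_in[OF h(1)] embed_in[OF i] x] unfolding eq by simp
    moreover have "wr_embed h \<otimes>\<^bsub>Wr\<^esub> wr_embed ?i \<in> wr_embed ` G"
      using subgroup.m_closed[OF sub'] h(1) i by blast
    ultimately show "\<exists>h\<in>wr_embed ` G. h \<otimes>\<^bsub>Wr\<^esub> x \<in> reps" by blast
  qed
qed

end

section \<open>The commensurability theorem\<close>

context framed_quotient begin

text \<open>
  A part with two points is a block, and \<open>block_contains_orbit\<close> applies.
\<close>

lemma \<Gamma>_strongly_orbit_primitive: "strongly_orbit_primitive \<Gamma> R actn"
  unfolding strongly_orbit_primitive_def
proof (intro allI impI ballI)
  fix \<P> P assume inv: "invariant_partition \<Gamma> R actn \<P>" and P: "P \<in> \<P>"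
  have part: "partition_on R \<P>" and img: "\<And>g. g \<in> Gam \<Longrightarrow> g ` P \<in> \<P>"
    using inv P unfolding invariant_partition_def by auto
  have PR: "P \<subseteq> R" "P \<noteq> {}" using partition_onD1[OF part] partition_onD3[OF part] P by auto
  show "is_singleton P \<or> (\<exists>\<Omega>\<in>orbits \<Gamma> R actn. \<Omega> \<subseteq> P)"
  proof (cases "is_singleton P")
    case False
    obtain x where x: "x \<in> P" using PR(2) by blast
    obtain y where y: "y \<in> P" "y \<noteq> x" using False x unfolding is_singleton_def by blast
    have "orb Gam x \<subseteq> P"
    proof (rule Gam.block_contains_orbit[OF PR(1) _ x y(1)])
      show "g ` P = P \<or> g ` P \<inter> P = {}" if "g \<in> Gam" for g
        using disjointD[OF partition_onD2[OF part] img[OF that] P] by blast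
    qed (use y in simp)
    moreover have "orb Gam x \<in> orbits \<Gamma> R actn"
      unfolding orbits_def orbit_eq[symmetric] using x PR(1) by blast
    ultimately show ?thesis by blast
  qed simp
qed

lemma finite_orbits: "finite (orbits \<Gamma> R actn)"
proof -
  have "orbits \<Gamma> R actn \<subseteq> orb Gam ` {b \<in> R. snd b < Gam.D0 + e1}"
  proof
    fix \<Omega> assume "\<Omega> \<in> orbits \<Gamma> R actn"
    then obtain b where b: "b \<in> R" "\<Omega> = orb Gam b" unfolding orbits_def orbit_eq by blast
    obtain y where y: "y \<in> orb Gam b" "snd y < Gam.D0 + e1" using Gam.orb_meets_core[of b] b(1) Gam.pts_eq by auto
    have "y \<in> R" using y(1) Gam.orb_subset[of b] b(1) by (auto simp: Gam.pts_def)
    then have "y \<in> {b \<in> R. snd b < Gam.D0 + e1}" using y(2) by blast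
    then show "\<Omega> \<in> orb Gam ` {b \<in> R. snd b < Gam.D0 + e1}"
      by (rule rev_image_eqI) (simp add: b(2) Gam.orb_eq[OF y(1)])
  qed
  then show ?thesis by (rule finite_subset) (intro finite_imageI finite_core)
qed

lemma infinite_orbits: "\<Omega> \<in> orbits \<Gamma> R actn \<Longrightarrow> infinite \<Omega>"
  using Gam.infinite_orb unfolding orbits_def orbit_eq by auto

end

theorem theorem8p8:
  fixes n :: nat and G :: "(nat \<times> nat \<Rightarrow> nat \<times> nat) set"
  assumes "n \<ge> 3"
    and "subgroup G (houghton n)"
    and "hirsch_length (houghton n\<lparr>carrier := G\<rparr>) = n - 1"
  shows "\<exists>(\<Gamma> :: (nat \<times> nat \<Rightarrow> nat \<times> nat) monoid) (W :: (nat \<times> nat) set \<Rightarrow> nat monoid).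
    (\<exists>K. subgroup K (houghton n) \<and> \<Gamma> = houghton n\<lparr>carrier := K\<rparr>) \<and>
    hirsch_length \<Gamma> = n - 1 \<and>
    strongly_orbit_primitive \<Gamma> (ray_system n) (\<lambda>g x. g x) \<and>
    finite (orbits \<Gamma> (ray_system n) (\<lambda>g x. g x)) \<and>
    (\<forall>\<Omega>\<in>orbits \<Gamma> (ray_system n) (\<lambda>g x. g x).
       infinite \<Omega> \<and> group (W \<Omega>) \<and> finite (carrier (W \<Omega>))) \<and>
    abstractly_commensurable (houghton n\<lparr>carrier := G\<rparr>)
      (multi_wreath \<Gamma> (ray_system n) (\<lambda>g x. g x) W)"
proof -
  note G = assms(2)
  obtain d0 where "has_moves n d0 G" using full_hirsch_length_iff[OF G] assms(3) by blast
  then obtain G1 d1 Fx where G1: "fin_idx G1 G" "lattice_subgroup n G1 d1 Fx"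
    using ex_lattice_subgroup[OF assms(1) G] by blast
  then obtain H d where H: "fin_idx H G1" "lattice_subgroup n H d Fx" "lattice_subgroup.inner n H Fx"
    using lattice_subgroup.ex_inner_subgroup[OF G1(2)] by blast
  interpret H: lattice_subgroup n H d Fx by (rule H(2))
  obtain q e where "q ` H.pts = ray_system n" "\<forall>x\<in>H.pts. \<forall>y\<in>H.pts. q x = q y \<longleftrightarrow> y \<in> H.acl x"
    "\<exists>L. \<forall>j\<in>{1..n}. \<forall>l\<ge>L. fst (q (j, l)) = j \<and> q (j, l + d) = (j, snd (q (j, l)) + e j)"
    using H.ex_quotient_map by blast
  then interpret Q: inner_quotient_map n H d Fx q e
    using H(3) by unfold_locales blast+
  obtain \<tau> where \<tau>: "Q.frame \<tau>" using Q.ex_frame by blast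
  have "\<forall>b. \<exists>M c. group (M :: nat monoid) \<and> finite (carrier M) \<and> c \<in> iso (Q.fiber_group b) M"
    using finite_group_nat_copy[OF Q.fiber_group_group Q.finite_fiber_group] by blast
  then obtain M c where Mc: "\<And>b. group (M b :: nat monoid)" "\<And>b. finite (carrier (M b))" "\<And>b. c b \<in> iso (Q.fiber_group b) (M b)"
    by metis
  interpret framed_quotient n H d Fx q e \<tau> M c
    by (intro framed_quotient.intro framed_quotient_axioms.intro Q.inner_quotient_map_axioms \<tau> Mc)
  let ?A = "houghton n\<lparr>carrier := G\<rparr>"
  \<comment> \<open>The common subgroup of finite index is \<open>H\<close>.\<close>
  have fi: "fin_idx H G" by (rule fin_idx_trans[OF G G1(1) H(1)])
  have HG: "H \<subseteq> G" using fi fin_idx_def by blast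
  have gA: "group ?A" and gH: "group (houghton n\<lparr>carrier := H\<rparr>)"
    using group.subgroup_imp_group[OF group_houghton] G H.sub by blast+
  have "abstractly_commensurable ?A Wr"
    unfolding abstractly_commensurable_def
  proof (intro conjI exI)
    show "group ?A" "group Wr" "group (houghton n\<lparr>carrier := H\<rparr>)" by (fact gA Wr_group gH)+
    show "id \<in> mon (houghton n\<lparr>carrier := H\<rparr>) ?A" using HG by (auto simp: mon_def hom_def)
    show "wr_embed \<in> mon (houghton n\<lparr>carrier := H\<rparr>) Wr" using embed_hom embed_inj by (simp add: mon_def)
    show "finite (rcosets\<^bsub>?A\<^esub> (id ` carrier (houghton n\<lparr>carrier := H\<rparr>)))"
      using fin_idx_finite_rcosets[OF G H.sub fi] by simp
    show "finite (rcosets\<^bsub>Wr\<^esub> (wr_embed ` carrier (houghton n\<lparr>carrier := H\<rparr>)))"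
      using embed_finite_index by simp
  qed
  moreover have "hirsch_length \<Gamma> = n - 1"
    using full_hirsch_length_iff[OF Q.Gam_subgroup] Q.Gam.has_moves by blast
  moreover have "\<forall>\<Omega>\<in>orbits \<Gamma> R actn. infinite \<Omega> \<and> group (W \<Omega>) \<and> finite (carrier (W \<Omega>))"
    using infinite_orbits M_group M_finite unfolding W_def by blast
  ultimately show ?thesis
    using Q.Gam_subgroup \<Gamma>_strongly_orbit_primitive finite_orbits by blast
qed

end
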